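(* Let $G$ be a Lie group and $A$ a smooth $G$-module with Lie algebra $\mathfrak a$. The maps $$D_n:=\mathrm{ev}_{\mathbf 1}\circ\tau\circ\Phi_n:C^n_s(G,A)\to C^n_c(\mathfrak g,\mathfrak a),\qquad n\ge1,$$ induce a morphism of chain complexes $D:(C^n_s(G,A),d_G)_{n\ge1}\to(C^n_c(\mathfrak g,\mathfrak a),d_{\mathfrak g})_{n\ge1}$ and in particular homomorphisms $$D_n:H^n_s(G,A)\to H^n_c(\mathfrak g,\mathfrak a),\qquad n\ge2.$$ For $A=\mathfrak a$ these assertions hold for all $n\in\mathbb N_0$, and if $A\cong\mathfrak a/\Gamma_A$ for a discrete subgroup $\Gamma_A$ of $\mathfrak a$, then $D_1$ also induces a homomorphism $$D_1:H^1_s(G,A)\to H^1_c(\mathfrak g,\mathfrak a),\qquad[f]\mapsto[df(\mathbf 1)].$$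
   Context: A Lie group is a group that is a smooth manifold modeled on a locally convex space with smooth group operations (smooth = all iterated directional derivatives exist and are continuous). $\mathfrak g=T_{\mathbf 1}(G)$. A smooth $G$-module is an abelian Lie group $A$ (additive) with a smooth action map $G\times A\to A$ by automorphisms; $\mathfrak a$ is then a smooth $G$-module and a topological $\mathfrak g$-module. $C^n_c(\mathfrak g,\mathfrak a)$: continuous alternating $n$-linear maps $\mathfrak g^n\to\mathfrak a$ ($C^0_c=\mathfrak a$) with the Chevalley–Eilenberg differential $(d_{\mathfrak g}f)(x_0,\dots,x_p)=\sum_j(-1)^jx_j.f(\dots,\hat x_j,\dots)+\sum_{i<j}(-1)^{i+j}f([x_i,x_j],\dots,\hat x_i,\dots,\hat x_j,\dots)$; cohomology $H^n_c$. $C^n_s(G,A)$: functions $f:G^n\to A$ smooth in an identity neighborhood and vanishing if some argument is $\mathbf 1$, with $(d_Gf)(g_0,\dots,g_n)=g_0.f(g_1,\dots,g_n)+\sum_{j=1}^n(-1)^jf(g_0,\dots,g_{j-1}g_j,\dots,g_n)+(-1)^{n+1}f(g_0,\dots,g_{n-1})$; cohomology $H^n_s$. $\Phi_n(f):G^{n+1}\to A$ is given by $\Phi_n(f)(g_0,\dots,g_n)=g_0.f(g_0^{-1}g_1,g_1^{-1}g_2,\dots,g_{n-1}^{-1}g_n)$; it is smooth in a neighborhood of the diagonal. For a function $F:G^{n+1}\to A$ smooth near the diagonal, $\tau(F)\in\Omega^n(G,\mathfrak a)$ is the $\mathfrak a$-valued $n$-form $$\tau(F)(p)(v_1,\dots,v_n)=\sum_{\sigma\in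 S_n}\mathrm{sgn}(\sigma)\,\frac{\partial^n}{\partial t_1\cdots\partial t_n}\Big|_{t_i=0}F\big(p,\gamma_{\sigma(1)}(t_1),\dots,\gamma_{\sigma(n)}(t_n)\big),$$ where $\gamma_i$ are smooth curves with $\gamma_i(0)=p$, $\gamma_i'(0)=v_i$; the first derivative of an $A$-valued function is the logarithmic derivative with values in $\mathfrak a$ (tangent vectors of $A$ are translated to $T_{\mathbf 0}(A)=\mathfrak a$). If $A=\mathfrak a$ and $n=0$, $\tau(F)=F$. $\mathrm{ev}_{\mathbf 1}$ maps an $n$-form $\Omega$ to its value $\Omega_{\mathbf 1}\in C^n_c(\mathfrak g,\mathfrak a)$ at the identity. *)

theory Defs
  imports "HOL-Analysis.Analysis" "HOL-Algebra.Coset" "HOL-Library.Function_Algebras"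
begin

section \<open>Locally convex spaces and smooth maps\<close>

class locally_convex = real_vector + topological_ab_group_add + t2_space +
  assumes tendsto_scaleR_Pair:
      "filterlim (\<lambda>p. fst p *\<^sub>R snd p) (nhds (r *\<^sub>R x)) (nhds (r::real) \<times>\<^sub>F nhds x)"
    and locally_convex:
      "open U \<Longrightarrow> 0 \<in> U \<Longrightarrow> \<exists>V. open V \<and> 0 \<in> V \<and> V \<subseteq> U \<and>
        (\<forall>x\<in>V. \<forall>y\<in>V. \<forall>u\<ge>0. \<forall>v\<ge>0. u + v = 1 \<longrightarrow> u *\<^sub>R x + v *\<^sub>R y \<in> V)"

instantiation "fun" :: (type, real_vector) real_vector
begin

definition scaleR_fun :: "real \<Rightarrow> ('a \<Rightarrow> 'b) \<Rightarrow> 'a \<Rightarrow> 'b"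
  where "scaleR_fun r f = (\<lambda>x. r *\<^sub>R f x)"

instance
  by standard (auto simp: scaleR_fun_def fun_eq_iff algebra_simps)

end

text \<open>
  Points of an \<open>n\<close>-fold power \<open>X\<^sup>n\<close> are represented by sequences \<open>x :: nat \<Rightarrow> 'x\<close> of
  which only \<open>x 0, \<dots>, x (n - 1)\<close> matter: a function on \<open>X\<^sup>n\<close> is a function \<open>f\<close> on sequences with
  \<open>depends_below n f\<close>. For such functions, continuity (in the product topology) and
  directional differentiability are the same on sequences as on \<open>X\<^sup>n\<close>, and functions on
  \<open>X\<^sup>0\<close> are the constants.
\<close>

definition depends_below :: "nat \<Rightarrow> ((nat \<Rightarrow> 'x) \<Rightarrow> 'y) \<Rightarrow> bool"
  where "depends_below n f \<longleftrightarrow> (\<forall>x y. (\<forall>i<n. x i = y i) \<longrightarrow> f x = f y)"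

definition has_dir_deriv ::
    "('e::real_vector \<Rightarrow> 'f::{real_vector,topological_space}) \<Rightarrow> 'e \<Rightarrow> 'e \<Rightarrow> 'f \<Rightarrow> bool"
  where "has_dir_deriv f x h l \<longleftrightarrow> ((\<lambda>t::real. (f (x + t *\<^sub>R h) - f x) /\<^sub>R t) \<longlongrightarrow> l) (at 0)"

definition dir_deriv :: "('e::real_vector \<Rightarrow> 'f::{real_vector,t2_space}) \<Rightarrow> 'e \<Rightarrow> 'e \<Rightarrow> 'f"
  where "dir_deriv f x h = (THE l. has_dir_deriv f x h l)"

primrec iter_deriv :: "('e::real_vector \<Rightarrow> 'f::{real_vector,t2_space}) \<Rightarrow> 'e list \<Rightarrow> 'e \<Rightarrow> 'f"
  where
    "iter_deriv f [] = f"
  | "iter_deriv f (h # hs) = (\<lambda>x. dir_deriv (iter_deriv f hs) x h)"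

text \<open>
  Only meaningful for open \<open>U\<close>. Continuity of the \<open>k\<close>-th iterated derivative is joint continuity
  in the base point and the \<open>k\<close> directions.
\<close>

definition smooth_on ::
    "('e::{real_vector,topological_space}) set \<Rightarrow> ('e \<Rightarrow> 'f::{real_vector,t2_space}) \<Rightarrow> bool"
  where "smooth_on U f \<longleftrightarrow>
    (\<forall>hs. \<forall>x\<in>U. \<forall>h. \<exists>l. has_dir_deriv (iter_deriv f hs) x h l) \<and>
    (\<forall>k. continuous_on (U \<times> (UNIV :: (nat \<Rightarrow> 'e) set))
           (\<lambda>(x, h). iter_deriv f (map h [0..<k]) x))"


section \<open>Manifolds modeled on locally convex spaces\<close>

text \<open>
  A chart is a pair of a domain and a coordinate map. Besides an atlas, a manifold carries a
  preferred chart at each point. A tangent vector at \<open>p\<close> is represented by its coordinates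
  in the preferred chart at \<open>p\<close>, so that every tangent space is identified with the model space.
\<close>

type_synonym ('m, 'e) chart = "'m set \<times> ('m \<Rightarrow> 'e)"

abbreviation chart_inv :: "('m, 'e) chart \<Rightarrow> 'e \<Rightarrow> 'm"
  where "chart_inv c \<equiv> inv_into (fst c) (snd c)"

record ('m, 'e) manifold =
  atlas :: "('m, 'e) chart set"
  chart_at :: "'m \<Rightarrow> ('m, 'e) chart"

definition is_chart :: "('m::topological_space, 'e::topological_space) chart \<Rightarrow> bool"
  where "is_chart c \<longleftrightarrow> open (fst c) \<and> open (snd c ` fst c) \<and>
    homeomorphism (fst c) (snd c ` fst c) (snd c) (chart_inv c)"

definition smooth_manifold ::
    "('m::t2_space, 'e::{real_vector,t2_space}) manifold \<Rightarrow> bool"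
  where "smooth_manifold M \<longleftrightarrow>
    (\<forall>c\<in>atlas M. is_chart c) \<and>
    (\<forall>p. chart_at M p \<in> atlas M \<and> p \<in> fst (chart_at M p)) \<and>
    (\<forall>c\<in>atlas M. \<forall>d\<in>atlas M. smooth_on (snd c ` (fst c \<inter> fst d)) (snd d \<circ> chart_inv c))"

text \<open>Only meaningful for open \<open>S\<close>.\<close>

definition smooth_map ::
    "('m::t2_space, 'e::{real_vector,t2_space}) manifold \<Rightarrow>
     ('n::t2_space, 'f::{real_vector,t2_space}) manifold \<Rightarrow> 'm set \<Rightarrow> ('m \<Rightarrow> 'n) \<Rightarrow> bool"
  where "smooth_map M N S f \<longleftrightarrow> continuous_on S f \<and>
    (\<forall>c\<in>atlas M. \<forall>d\<in>atlas N.
       smooth_on (snd c ` (fst c \<inter> S \<inter> f -` fst d)) (snd d \<circ> f \<circ> chart_inv c))"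

definition vector_manifold :: "('e, 'e) manifold"
  where "vector_manifold = \<lparr>atlas = {(UNIV, id)}, chart_at = (\<lambda>_. (UNIV, id))\<rparr>"

definition prod_chart :: "('m, 'e) chart \<Rightarrow> ('n, 'f) chart \<Rightarrow> ('m \<times> 'n, 'e \<times> 'f) chart"
  where "prod_chart c d = (fst c \<times> fst d, map_prod (snd c) (snd d))"

definition prod_manifold ::
    "('m, 'e) manifold \<Rightarrow> ('n, 'f) manifold \<Rightarrow> ('m \<times> 'n, 'e \<times> 'f) manifold"
  where "prod_manifold M N =
    \<lparr>atlas = {prod_chart c d |c d. c \<in> atlas M \<and> d \<in> atlas N},
     chart_at = (\<lambda>(p, q). prod_chart (chart_at M p) (chart_at N q))\<rparr>"

text \<open>
  Smoothness on \<open>W\<^sup>n\<close>, for open \<open>W\<close>, of a function on the power \<open>M\<^sup>n\<close>, tested in product charts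
  \<open>c 0 \<times> \<dots> \<times> c (n - 1)\<close>. The components with index \<open>\<ge> n\<close> are irrelevant when
  \<open>depends_below n f\<close>.
\<close>

definition smooth_on_power ::
    "('m::t2_space, 'e::{real_vector,t2_space}) manifold \<Rightarrow>
     ('a::t2_space, 'b::{real_vector,t2_space}) manifold \<Rightarrow>
     nat \<Rightarrow> 'm set \<Rightarrow> ((nat \<Rightarrow> 'm) \<Rightarrow> 'a) \<Rightarrow> bool"
  where "smooth_on_power M N n W f \<longleftrightarrow>
    continuous_on {x. \<forall>i<n. x i \<in> W} f \<and>
    (\<forall>c d. (\<forall>i<n. c i \<in> atlas M) \<longrightarrow> d \<in> atlas N \<longrightarrow>
       smooth_on
         {u. (\<forall>i<n. u i \<in> snd (c i) ` (fst (c i) \<inter> W)) \<and> f (\<lambda>i. chart_inv (c i) (u i)) \<in> fst d}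
         (\<lambda>u. snd d (f (\<lambda>i. chart_inv (c i) (u i)))))"

text \<open>\<open>T\<^sub>p f : T\<^sub>p M \<rightarrow> T\<^bsub>f p\<^esub> N\<close> in the preferred charts at \<open>p\<close> and \<open>f p\<close>.\<close>

definition tangent_map ::
    "('m, 'e::real_vector) manifold \<Rightarrow> ('n, 'f::{real_vector,t2_space}) manifold \<Rightarrow>
     ('m \<Rightarrow> 'n) \<Rightarrow> 'm \<Rightarrow> 'e \<Rightarrow> 'f"
  where "tangent_map M N f p v =
    dir_deriv (snd (chart_at N (f p)) \<circ> f \<circ> chart_inv (chart_at M p)) (snd (chart_at M p) p) v"

definition curve_with_velocity ::
    "('m::t2_space, 'e::{real_vector,t2_space}) manifold \<Rightarrow> 'm \<Rightarrow> 'e \<Rightarrow> (real \<Rightarrow> 'm) \<Rightarrow> bool"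
  where "curve_with_velocity M p v \<gamma> \<longleftrightarrow>
    (\<exists>\<epsilon>>0. smooth_map vector_manifold M {-\<epsilon><..<\<epsilon>} \<gamma>) \<and>
    \<gamma> 0 = p \<and> tangent_map vector_manifold M \<gamma> 0 1 = v"


section \<open>Lie groups, their Lie algebras and smooth modules\<close>

class group_mult = monoid_mult + inverse +
  assumes group_mult_left_inverse: "inverse a * a = 1"
    and group_mult_divide: "a / b = a * inverse b"

definition lie_group ::
    "('g::{group_mult,t2_space}, 'e::{real_vector,t2_space}) manifold \<Rightarrow> bool"
  where "lie_group M \<longleftrightarrow> smooth_manifold M \<and>
    smooth_map (prod_manifold M M) M UNIV (\<lambda>(g, h). g * h) \<and>
    smooth_map M M UNIV inverse"

definition abelian_lie_group ::
    "('a::{ab_group_add,t2_space}, 'b::{real_vector,t2_space}) manifold \<Rightarrow> bool"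
  where "abelian_lie_group M \<longleftrightarrow> smooth_manifold M \<and>
    smooth_map (prod_manifold M M) M UNIV (\<lambda>(a, b). a + b) \<and>
    smooth_map M M UNIV uminus"

definition smooth_module ::
    "('g::{group_mult,t2_space}, 'e::{real_vector,t2_space}) manifold \<Rightarrow>
     ('a::{ab_group_add,t2_space}, 'b::{real_vector,t2_space}) manifold \<Rightarrow>
     ('g \<Rightarrow> 'a \<Rightarrow> 'a) \<Rightarrow> bool"
  where "smooth_module G A act \<longleftrightarrow> abelian_lie_group A \<and>
    (\<forall>a. act 1 a = a) \<and>
    (\<forall>g h a. act (g * h) a = act g (act h a)) \<and>
    (\<forall>g a b. act g (a + b) = act g a + act g b) \<and>
    smooth_map (prod_manifold G A) A UNIV (\<lambda>(g, a). act g a)"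

text \<open>
  The left invariant vector field \<open>p \<mapsto> T\<^sub>1(\<lambda>\<^sub>p) x\<close>, \<open>\<lambda>\<^sub>p h = p * h\<close>, in the preferred chart at \<open>1\<close>
  (for every point \<open>p\<close> of its domain, and as a function of the coordinate \<open>u\<close> of \<open>p\<close>).
  The Lie bracket on \<open>T\<^sub>1 G\<close> is the value at \<open>1\<close> of the bracket of left invariant vector fields,
  which in local coordinates is \<open>[X, Y](u) = dY(u)(X u) - dX(u)(Y u)\<close>.
\<close>

definition left_inv_field ::
    "('g::group_mult, 'e::{real_vector,t2_space}) manifold \<Rightarrow> 'e \<Rightarrow> 'e \<Rightarrow> 'e"
  where "left_inv_field G x u = (let c = chart_at G 1 in
    dir_deriv (\<lambda>w. snd c (chart_inv c u * chart_inv c w)) (snd c 1) x)"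

definition lie_bracket ::
    "('g::group_mult, 'e::{real_vector,t2_space}) manifold \<Rightarrow> 'e \<Rightarrow> 'e \<Rightarrow> 'e"
  where "lie_bracket G x y = (let X = left_inv_field G x; Y = left_inv_field G y;
      u = snd (chart_at G 1) 1
    in dir_deriv Y u (X u) - dir_deriv X u (Y u))"

text \<open>The derived actions of \<open>G\<close> and of its Lie algebra on \<open>T\<^sub>0 A\<close>.\<close>

definition derived_act ::
    "('a::ab_group_add, 'b::{real_vector,t2_space}) manifold \<Rightarrow> ('g \<Rightarrow> 'a \<Rightarrow> 'a) \<Rightarrow> 'g \<Rightarrow> 'b \<Rightarrow> 'b"
  where "derived_act A act g = tangent_map A A (act g) 0"

definition lie_act ::
    "('g::group_mult, 'e::real_vector) manifold \<Rightarrow>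
     ('a::ab_group_add, 'b::{real_vector,t2_space}) manifold \<Rightarrow>
     ('g \<Rightarrow> 'a \<Rightarrow> 'a) \<Rightarrow> 'e \<Rightarrow> 'b \<Rightarrow> 'b"
  where "lie_act G A act x w = tangent_map G vector_manifold (\<lambda>g. derived_act A act g w) 1 x"


section \<open>Cochain complexes and cohomology\<close>

definition additive_group :: "'x set \<Rightarrow> ('x::{plus,zero}) monoid"
  where "additive_group C = \<lparr>carrier = C, mult = (+), one = 0\<rparr>"

definition cocycles ::
    "(nat \<Rightarrow> ('x::{plus,zero}) set) \<Rightarrow> (nat \<Rightarrow> 'x \<Rightarrow> 'x) \<Rightarrow> nat \<Rightarrow> 'x set"
  where "cocycles C d n = {f \<in> C n. d n f = 0}"

definition coboundaries ::
    "(nat \<Rightarrow> ('x::{plus,zero}) set) \<Rightarrow> (nat \<Rightarrow> 'x \<Rightarrow> 'x) \<Rightarrow> nat \<Rightarrow> 'x set"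
  where "coboundaries C d n = (case n of 0 \<Rightarrow> {0} | Suc m \<Rightarrow> d m ` C m)"

definition cohomology ::
    "(nat \<Rightarrow> ('x::{plus,zero}) set) \<Rightarrow> (nat \<Rightarrow> 'x \<Rightarrow> 'x) \<Rightarrow> nat \<Rightarrow> 'x set monoid"
  where "cohomology C d n = additive_group (cocycles C d n) Mod coboundaries C d n"

definition cohomology_class ::
    "(nat \<Rightarrow> ('x::{plus,zero}) set) \<Rightarrow> (nat \<Rightarrow> 'x \<Rightarrow> 'x) \<Rightarrow> nat \<Rightarrow> 'x \<Rightarrow> 'x set"
  where "cohomology_class C d n f =
    coboundaries C d n #>\<^bsub>additive_group (cocycles C d n)\<^esub> f"

definition cochain_morphism ::
    "nat \<Rightarrow> (nat \<Rightarrow> ('x::{plus,zero}) set) \<Rightarrow> (nat \<Rightarrow> 'x \<Rightarrow> 'x) \<Rightarrow>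
     (nat \<Rightarrow> ('y::{plus,zero}) set) \<Rightarrow> (nat \<Rightarrow> 'y \<Rightarrow> 'y) \<Rightarrow> (nat \<Rightarrow> 'x \<Rightarrow> 'y) \<Rightarrow> bool"
  where "cochain_morphism n\<^sub>0 C d C' d' D \<longleftrightarrow>
    (\<forall>n\<ge>n\<^sub>0. D n \<in> hom (additive_group (C n)) (additive_group (C' n)) \<and>
       (\<forall>f\<in>C n. D (Suc n) (d n f) = d' n (D n f)))"

definition induces_cohomology_hom ::
    "(nat \<Rightarrow> ('x::{plus,zero}) set) \<Rightarrow> (nat \<Rightarrow> 'x \<Rightarrow> 'x) \<Rightarrow>
     (nat \<Rightarrow> ('y::{plus,zero}) set) \<Rightarrow> (nat \<Rightarrow> 'y \<Rightarrow> 'y) \<Rightarrow> nat \<Rightarrow> ('x \<Rightarrow> 'y) \<Rightarrow> bool"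
  where "induces_cohomology_hom C d C' d' n \<delta> \<longleftrightarrow>
    \<delta> ` cocycles C d n \<subseteq> cocycles C' d' n \<and>
    (\<exists>\<Psi>\<in>hom (cohomology C d n) (cohomology C' d' n). \<forall>f\<in>cocycles C d n.
       \<Psi> (cohomology_class C d n f) = cohomology_class C' d' n (\<delta> f))"


subsection \<open>Locally smooth group cochains\<close>

definition group_cochains ::
    "('g::{group_mult,t2_space}, 'e::{real_vector,t2_space}) manifold \<Rightarrow>
     ('a::{ab_group_add,t2_space}, 'b::{real_vector,t2_space}) manifold \<Rightarrow>
     nat \<Rightarrow> ((nat \<Rightarrow> 'g) \<Rightarrow> 'a) set"
  where "group_cochains G A n = {f. depends_below n f \<and>
    (\<exists>W. open W \<and> 1 \<in> W \<and> smooth_on_power G A n W f) \<and>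
    (\<forall>g. (\<exists>i<n. g i = 1) \<longrightarrow> f g = 0)}"

definition alt_sign :: "nat \<Rightarrow> 'a::ab_group_add \<Rightarrow> 'a"
  where "alt_sign k a = (if even k then a else - a)"

text \<open>\<open>(g\<^sub>0, \<dots>, g\<^bsub>j-1\<^esub> g\<^sub>j, \<dots>)\<close> for \<open>j \<ge> 1\<close>\<close>

definition merge_entries :: "nat \<Rightarrow> (nat \<Rightarrow> 'g::times) \<Rightarrow> nat \<Rightarrow> 'g"
  where "merge_entries j g = (\<lambda>k. if k < j - 1 then g k
    else if k = j - 1 then g (j - 1) * g j else g (Suc k))"

definition group_diff ::
    "('g::times \<Rightarrow> 'a::ab_group_add \<Rightarrow> 'a) \<Rightarrow> nat \<Rightarrow> ((nat \<Rightarrow> 'g) \<Rightarrow> 'a) \<Rightarrow> (nat \<Rightarrow> 'g) \<Rightarrow> 'a"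
  where "group_diff act n f g = act (g 0) (f (\<lambda>k. g (Suc k)))
    + (\<Sum>j=1..n. alt_sign j (f (merge_entries j g))) + alt_sign (n + 1) (f g)"


subsection \<open>Continuous Lie algebra cochains\<close>

definition lie_cochains ::
    "nat \<Rightarrow> ((nat \<Rightarrow> 'e::{real_vector,topological_space}) \<Rightarrow> 'b::{real_vector,topological_space}) set"
  where "lie_cochains n = {\<omega>. depends_below n \<omega> \<and>
    (\<forall>i<n. \<forall>x. linear (\<lambda>v. \<omega> (x(i := v)))) \<and>
    (\<forall>x. \<forall>i<n. \<forall>j<n. i \<noteq> j \<longrightarrow> x i = x j \<longrightarrow> \<omega> x = 0) \<and>
    continuous_on UNIV \<omega>}"

definition delete_entry :: "nat \<Rightarrow> (nat \<Rightarrow> 'e) \<Rightarrow> nat \<Rightarrow> 'e"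
  where "delete_entry j x = (\<lambda>k. if k < j then x k else x (Suc k))"

definition lie_diff ::
    "('g::group_mult, 'e::{real_vector,t2_space}) manifold \<Rightarrow>
     ('a::ab_group_add, 'b::{real_vector,t2_space}) manifold \<Rightarrow> ('g \<Rightarrow> 'a \<Rightarrow> 'a) \<Rightarrow>
     nat \<Rightarrow> ((nat \<Rightarrow> 'e) \<Rightarrow> 'b) \<Rightarrow> (nat \<Rightarrow> 'e) \<Rightarrow> 'b"
  where "lie_diff G A act p \<omega> x =
    (\<Sum>j\<le>p. alt_sign j (lie_act G A act (x j) (\<omega> (delete_entry j x))))
    + (\<Sum>j\<le>p. \<Sum>i<j. alt_sign (i + j)
         (\<omega> (case_nat (lie_bracket G (x i) (x j)) (delete_entry i (delete_entry j x)))))"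


section \<open>The derivation maps from group cochains to Lie algebra cochains\<close>

definition Phi ::
    "('g::group_mult \<Rightarrow> 'a \<Rightarrow> 'a) \<Rightarrow> ((nat \<Rightarrow> 'g) \<Rightarrow> 'a) \<Rightarrow> (nat \<Rightarrow> 'g) \<Rightarrow> 'a"
  where "Phi act f g = act (g 0) (f (\<lambda>k. inverse (g k) * g (Suc k)))"

text \<open>The velocity of an \<open>A\<close>-valued curve at time \<open>t\<close>, translated to \<open>T\<^sub>0 A\<close>\<close>

definition log_deriv ::
    "('a::ab_group_add, 'b::{real_vector,t2_space}) manifold \<Rightarrow> (real \<Rightarrow> 'a) \<Rightarrow> real \<Rightarrow> 'b"
  where "log_deriv A c t = tangent_map vector_manifold A (\<lambda>s. c s - c t) t 1"

definition partial_deriv ::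
    "nat \<Rightarrow> ((nat \<Rightarrow> real) \<Rightarrow> 'b::{real_vector,t2_space}) \<Rightarrow> (nat \<Rightarrow> real) \<Rightarrow> 'b"
  where "partial_deriv k h t = dir_deriv (\<lambda>s. h (t(k := s))) (t k) 1"

text \<open>\<open>\<partial>\<^sup>k/\<partial>t\<^sub>0\<dots>\<partial>t\<^bsub>k-1\<^esub>\<close>\<close>

primrec iter_partial ::
    "nat \<Rightarrow> ((nat \<Rightarrow> real) \<Rightarrow> 'b::{real_vector,t2_space}) \<Rightarrow> (nat \<Rightarrow> real) \<Rightarrow> 'b"
  where
    "iter_partial 0 h = h"
  | "iter_partial (Suc k) h = iter_partial k (partial_deriv k h)"

text \<open>
  \<open>\<partial>\<^sup>n/\<partial>t\<^sub>0\<dots>\<partial>t\<^bsub>n-1\<^esub>\<close> at \<open>t = 0\<close> of an \<open>A\<close>-valued function, the innermost derivative being the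
  logarithmic one. The value for \<open>n = 0\<close> is used only when \<open>A\<close> is a locally convex space with its
  identity chart, where it is the value \<open>h 0\<close> itself.
\<close>

definition mixed_deriv ::
    "('a::ab_group_add, 'b::{real_vector,t2_space}) manifold \<Rightarrow> nat \<Rightarrow> ((nat \<Rightarrow> real) \<Rightarrow> 'a) \<Rightarrow> 'b"
  where "mixed_deriv A n h = (case n of
      0 \<Rightarrow> snd (chart_at A 0) (h (\<lambda>_. 0))
    | Suc m \<Rightarrow> iter_partial m (\<lambda>t. log_deriv A (\<lambda>s. h (t(m := s))) (t m)) (\<lambda>_. 0))"

text \<open>
  \<open>tau G A n F p (v\<^sub>0, \<dots>, v\<^bsub>n-1\<^esub>)\<close> is the common value of the defining expression for all choices
  of smooth curves \<open>\<gamma>\<^sub>i\<close> through \<open>p\<close> with velocity \<open>v\<^sub>i\<close>.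
\<close>

definition tau ::
    "('g::t2_space, 'e::{real_vector,t2_space}) manifold \<Rightarrow>
     ('a::ab_group_add, 'b::{real_vector,t2_space}) manifold \<Rightarrow>
     nat \<Rightarrow> ((nat \<Rightarrow> 'g) \<Rightarrow> 'a) \<Rightarrow> 'g \<Rightarrow> (nat \<Rightarrow> 'e) \<Rightarrow> 'b"
  where "tau G A n F p v = (THE w. \<forall>\<gamma>. (\<forall>i<n. curve_with_velocity G p (v i) (\<gamma> i)) \<longrightarrow>
    w = (\<Sum>\<sigma> | \<sigma> permutes {..<n}.
      of_int (sign \<sigma>) *\<^sub>R mixed_deriv A n (\<lambda>t. F (case_nat p (\<lambda>i. \<gamma> (\<sigma> i) (t i))))))"

definition Dmap ::
    "('g::{group_mult,t2_space}, 'e::{real_vector,t2_space}) manifold \<Rightarrow>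
     ('a::ab_group_add, 'b::{real_vector,t2_space}) manifold \<Rightarrow> ('g \<Rightarrow> 'a \<Rightarrow> 'a) \<Rightarrow>
     nat \<Rightarrow> ((nat \<Rightarrow> 'g) \<Rightarrow> 'a) \<Rightarrow> (nat \<Rightarrow> 'e) \<Rightarrow> 'b"
  where "Dmap G A act n f = tau G A n (Phi act f) 1"


section \<open>Quotients of a locally convex space by a discrete subgroup\<close>

text \<open>
  \<open>A \<cong> \<aa>/\<Gamma>\<close> as Lie groups, where the smooth structure of \<open>\<aa>/\<Gamma>\<close> is the one for which the projection
  \<open>\<aa> \<rightarrow> \<aa>/\<Gamma>\<close> is a local diffeomorphism: a map out of \<open>\<aa>/\<Gamma>\<close> is smooth iff its composition with the
  projection is, and a map into \<open>\<aa>/\<Gamma>\<close> is smooth iff it has smooth local lifts to \<open>\<aa>\<close>.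
\<close>

definition iso_to_discrete_quotient ::
    "('a::{ab_group_add,t2_space}, 'b::{real_vector,t2_space}) manifold \<Rightarrow> 'b set \<Rightarrow> bool"
  where "iso_to_discrete_quotient A \<Gamma> \<longleftrightarrow>
    subgroup \<Gamma> (additive_group UNIV) \<and> discrete \<Gamma> \<and>
    (\<exists>F\<in>iso (additive_group UNIV Mod \<Gamma>) (additive_group UNIV).
       smooth_map vector_manifold A UNIV (\<lambda>v. F (\<Gamma> #>\<^bsub>additive_group UNIV\<^esub> v)) \<and>
       (\<forall>a. \<exists>W s. open W \<and> a \<in> W \<and> smooth_map A vector_manifold W s \<and>
          (\<forall>b\<in>W. F (\<Gamma> #>\<^bsub>additive_group UNIV\<^esub> s b) = b)))"

end

(*
  In charts at the neutral elements, a cochain f becomes a smooth function vanishing on the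
  coordinate hyperplanes through the base point. Hence D_n f is the alternation of the mixed
  derivative T of f, one direction per slot, and T is multilinear; no other derivative of f of
  order at most n in distinct slots survives, which also removes the inverses from Phi_n.

  Applied to d_G f, the first term of the group differential gives x_0.T(x_1, ..., x_n), the last
  term does not depend on its last slot and gives 0, and the term with g_{i} g_{i+1} gives a mixed
  derivative whose antisymmetrisation in x_i, x_{i+1} is T(..., [x_i, x_{i+1}], ...). Alternating
  over all permutations yields the Chevalley-Eilenberg differential of D_n f.

  In degree 1 the coboundary of a in A is g.a - a. If a = q(w) for a smooth homomorphism
  q : Lie(A) -> A, its derivative at 1 is x.(dq(0) w): replace w by w/N, where everything happens
  in one chart, multiply by N, and let N tend to infinity.
*)

theory Submission
  imports Defs "Jordan_Normal_Form.Determinant"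
begin

text \<open>Completeness of the model spaces is not assumed, so there are no integrals: limits of
  difference quotients, symmetry of second derivatives, the product rule and smoothness of
  compositions all go back to one mean value statement for open convex sets of slopes. Several group
  arguments and several time parameters are handled by treating sequence spaces as locally convex
  spaces of their own. The chart of A at 0 is not additive, so differentiation in it need not
  respect sums of A-valued functions. It does so at common zeros of the summands, because addition
  is the identity on both axes. The logarithmic derivative provides such zeros: it amounts to
  subtracting from h(t) its value at t_m = 0 and differentiating first in t_m, on the hyperplane t_m
  = 0. The mixed derivative of the term with g_i g_{i+1} also contains a second derivative of f
  within one slot. It cancels against that of the term with g_{i+1} g_i. Antisymmetrising costs a
  factor 1/2 under alternation, compensated because each pair of entries reaches the bracket in both
  orders.\<close>

section \<open>Products and function spaces as locally convex spaces\<close>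

lemma tendsto_fun_iff:
  fixes f :: "'t \<Rightarrow> 'i \<Rightarrow> 'a::topological_space"
  shows "(f \<longlongrightarrow> l) F \<longleftrightarrow> (\<forall>i. ((\<lambda>t. f t i) \<longlongrightarrow> l i) F)"
  using limitin_componentwise[of "\<lambda>_::'i. euclidean :: 'a topology" UNIV f l F]
  by (simp add: euclidean_product_topology)

lemma open_vimage_coordinate: "open S \<Longrightarrow> open ((\<lambda>z::'i \<Rightarrow> 'a::topological_space. z i) -` S)"
  by (rule open_vimage) simp_all

instance "fun" :: (type, t0_space) t0_space
proof
  fix x y :: "'a \<Rightarrow> 'b" assume "x \<noteq> y"
  then obtain i where "x i \<noteq> y i" by auto
  then obtain U where "open U" "\<not> (x i \<in> U \<longleftrightarrow> y i \<in> U)"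
    using iffD1[OF separation_t0 \<open>x i \<noteq> y i\<close>] by (elim exE conjE)
  then show "\<exists>U. open U \<and> \<not> (x \<in> U \<longleftrightarrow> y \<in> U)"
    by (intro exI[of _ "(\<lambda>z. z i) -` U"]) (auto simp: open_vimage_coordinate)
qed

instance "fun" :: (type, t1_space) t1_space
proof
  fix x y :: "'a \<Rightarrow> 'b" assume "x \<noteq> y"
  then obtain i where "x i \<noteq> y i" by auto
  then obtain U where "open U" "x i \<in> U" "y i \<notin> U"
    using iffD1[OF separation_t1 \<open>x i \<noteq> y i\<close>] by (elim exE conjE)
  then show "\<exists>U. open U \<and> x \<in> U \<and> y \<notin> U"
    by (intro exI[of _ "(\<lambda>z. z i) -` U"]) (auto simp: open_vimage_coordinate)
qed

instance "fun" :: (type, t2_space) t2_space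
proof
  fix x y :: "'a \<Rightarrow> 'b" assume "x \<noteq> y"
  then obtain i where "x i \<noteq> y i" by auto
  then obtain U V where UV: "open U" "open V" "x i \<in> U" "y i \<in> V" "U \<inter> V = {}"
    using hausdorff[OF \<open>x i \<noteq> y i\<close>] by blast
  then show "\<exists>U V. open U \<and> open V \<and> x \<in> U \<and> y \<in> V \<and> U \<inter> V = {}"
    by (intro exI[of _ "(\<lambda>z. z i) -` U"] exI[of _ "(\<lambda>z. z i) -` V"])
      (auto simp: open_vimage_coordinate)
qed

instance "fun" :: (type, topological_ab_group_add) topological_ab_group_add
proof
  fix a b :: "'a \<Rightarrow> 'b"
  have "((\<lambda>x. fst x i + snd x i) \<longlongrightarrow> a i + b i) (nhds a \<times>\<^sub>F nhds b)" for i
  proof (rule tendsto_add)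
    show "((\<lambda>x. fst x i) \<longlongrightarrow> a i) (nhds a \<times>\<^sub>F nhds b)"
      using filterlim_fst[of "nhds a" "nhds b"] by (subst (asm) tendsto_fun_iff) simp
    show "((\<lambda>x. snd x i) \<longlongrightarrow> b i) (nhds a \<times>\<^sub>F nhds b)"
      using filterlim_snd[of "nhds b" "nhds a"] by (subst (asm) tendsto_fun_iff) simp
  qed
  then show "LIM x (nhds a \<times>\<^sub>F nhds b). fst x + snd x :> nhds (a + b)"
    by (subst tendsto_fun_iff) simp
  have "((\<lambda>x. - x i) \<longlongrightarrow> - a i) (nhds a)" for i
    using filterlim_ident[of "nhds a"] by (subst (asm) tendsto_fun_iff) (simp add: tendsto_minus)
  then show "(uminus \<longlongrightarrow> - a) (nhds a)"
    by (subst tendsto_fun_iff) simp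
qed

instance prod :: (topological_monoid_add, topological_monoid_add) topological_monoid_add
proof
  fix a b :: "'a \<times> 'b"
  have 1: "LIM x (nhds a \<times>\<^sub>F nhds b). fst x :> nhds a" "LIM x (nhds a \<times>\<^sub>F nhds b). snd x :> nhds b"
    by (rule filterlim_fst filterlim_snd)+
  have "((\<lambda>x. (fst (fst x) + fst (snd x), snd (fst x) + snd (snd x))) \<longlongrightarrow>
      (fst a + fst b, snd a + snd b)) (nhds a \<times>\<^sub>F nhds b)"
    by (rule tendsto_Pair tendsto_add tendsto_fst tendsto_snd 1)+
  then show "LIM x (nhds a \<times>\<^sub>F nhds b). fst x + snd x :> nhds (a + b)"
    unfolding plus_prod_def .
qed

instance prod :: (topological_comm_monoid_add, topological_comm_monoid_add) topological_comm_monoid_add ..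

instance prod :: (topological_group_add, topological_group_add) topological_group_add
proof
  fix a :: "'a \<times> 'b"
  have "((\<lambda>x. (- fst x, - snd x)) \<longlongrightarrow> (- fst a, - snd a)) (nhds a)"
    by (rule tendsto_Pair tendsto_minus tendsto_fst tendsto_snd filterlim_ident)+
  then show "(uminus \<longlongrightarrow> - a) (nhds a)"
    unfolding uminus_prod_def[abs_def] .
qed

instance prod :: (topological_ab_group_add, topological_ab_group_add) topological_ab_group_add ..

lemma tendsto_scaleR_lc [tendsto_intros]:
  fixes g :: "'t \<Rightarrow> 'b::locally_convex"
  assumes "(r \<longlongrightarrow> a) F" "(g \<longlongrightarrow> b) F"
  shows "((\<lambda>x. r x *\<^sub>R g x) \<longlongrightarrow> a *\<^sub>R b) F"
proof -
  have "LIM x F. (r x, g x) :> nhds a \<times>\<^sub>F nhds b"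
    using assms by (simp add: nhds_prod[symmetric] tendsto_Pair)
  from filterlim_compose[OF tendsto_scaleR_Pair this] show ?thesis by simp
qed

lemma convex_nhd_0:
  fixes U :: "'b::locally_convex set"
  assumes "open U" "0 \<in> U"
  shows "\<exists>V. open V \<and> convex V \<and> 0 \<in> V \<and> V \<subseteq> U"
proof -
  obtain V where V: "open V" "0 \<in> V" "V \<subseteq> U"
    "\<forall>x\<in>V. \<forall>y\<in>V. \<forall>u\<ge>0. \<forall>v\<ge>0. u + v = (1::real) \<longrightarrow> u *\<^sub>R x + v *\<^sub>R y \<in> V"
    using locally_convex[OF assms] by (elim exE conjE)
  have "convex V" unfolding convex_def by (rule V(4))
  with V show ?thesis by (intro exI[of _ V] conjI)
qed

lemma convex_nhd:
  fixes U :: "'b::locally_convex set"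
  assumes "open U" "x \<in> U"
  shows "\<exists>V. open V \<and> convex V \<and> x \<in> V \<and> V \<subseteq> U"
proof -
  have "open ((\<lambda>z. x + z) -` U)"
    by (rule open_vimage[OF assms(1)]) (rule continuous_on_add continuous_on_const continuous_on_id)+
  then obtain V where V: "open V" "convex V" "0 \<in> V" "V \<subseteq> (\<lambda>z. x + z) -` U"
    using convex_nhd_0[of "(\<lambda>z. x + z) -` U"] assms by auto
  let ?W = "(\<lambda>z. z - x) -` V"
  have "open ?W"
    by (rule open_vimage[OF V(1)]) (rule continuous_on_diff continuous_on_const continuous_on_id)+
  moreover have "convex ?W"
  proof (rule convexI)
    fix y z and u v :: real
    assume "y \<in> ?W" "z \<in> ?W" and uv: "0 \<le> u" "0 \<le> v" "u + v = 1"
    then have "u *\<^sub>R (y - x) + v *\<^sub>R (z - x) \<in> V"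
      using V(2) by (intro convexD) auto
    also have "u *\<^sub>R (y - x) + v *\<^sub>R (z - x) = u *\<^sub>R y + v *\<^sub>R z - (u + v) *\<^sub>R x"
      by (simp add: scaleR_right_diff_distrib scaleR_left_distrib)
    finally show "u *\<^sub>R y + v *\<^sub>R z \<in> ?W" using uv by simp
  qed
  moreover have "?W \<subseteq> U"
  proof
    fix y assume "y \<in> ?W"
    then have "y - x \<in> (\<lambda>z. x + z) -` U" using V(4) by blast
    then show "y \<in> U" by simp
  qed
  ultimately show ?thesis using V(3) by (intro exI[of _ ?W]) auto
qed

instance real :: locally_convex
proof
  fix r x :: real
  show "LIM p (nhds r \<times>\<^sub>F nhds x). fst p *\<^sub>R snd p :> nhds (r *\<^sub>R x)"
    by (intro tendsto_scaleR filterlim_fst filterlim_snd)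
next
  fix U :: "real set" assume "open U" "0 \<in> U"
  then obtain e where "e > 0" "ball 0 e \<subseteq> U" by (auto simp: open_contains_ball)
  moreover have "convex (ball (0::real) e)" by (rule convex_ball)
  ultimately show "\<exists>V. open V \<and> 0 \<in> V \<and> V \<subseteq> U \<and>
      (\<forall>x\<in>V. \<forall>y\<in>V. \<forall>u\<ge>0. \<forall>v\<ge>0. u + v = 1 \<longrightarrow> u *\<^sub>R x + v *\<^sub>R y \<in> V)"
    unfolding convex_def by (intro exI[of _ "ball 0 e"]) auto
qed

instance prod :: (locally_convex, locally_convex) locally_convex
proof
  fix r :: real and x :: "'a \<times> 'b"
  have 1: "LIM p (nhds r \<times>\<^sub>F nhds x). fst p :> nhds r" "LIM p (nhds r \<times>\<^sub>F nhds x). snd p :> nhds x"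
    by (rule filterlim_fst filterlim_snd)+
  have "((\<lambda>p. (fst p *\<^sub>R fst (snd p), fst p *\<^sub>R snd (snd p))) \<longlongrightarrow> (r *\<^sub>R fst x, r *\<^sub>R snd x)) (nhds r \<times>\<^sub>F nhds x)"
    by (rule tendsto_Pair tendsto_scaleR_lc 1 tendsto_fst tendsto_snd)+
  then show "LIM p (nhds r \<times>\<^sub>F nhds x). fst p *\<^sub>R snd p :> nhds (r *\<^sub>R x)"
    by (simp add: scaleR_prod_def)
next
  fix U :: "('a \<times> 'b) set" assume U: "open U" "0 \<in> U"
  then obtain A B where AB: "open A" "open B" "0 \<in> A" "0 \<in> B" "A \<times> B \<subseteq> U"
    by (metis open_prod_elim mem_Sigma_iff zero_prod_def)
  obtain A' where A': "open A'" "convex A'" "0 \<in> A'" "A' \<subseteq> A" using convex_nhd_0 AB by metis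
  obtain B' where B': "open B'" "convex B'" "0 \<in> B'" "B' \<subseteq> B" using convex_nhd_0 AB by metis
  have "convex (A' \<times> B')" using A' B' by (auto simp: convex_def)
  then show "\<exists>V. open V \<and> 0 \<in> V \<and> V \<subseteq> U \<and>
      (\<forall>x\<in>V. \<forall>y\<in>V. \<forall>u\<ge>0. \<forall>v\<ge>0. u + v = 1 \<longrightarrow> u *\<^sub>R x + v *\<^sub>R y \<in> V)"
    unfolding convex_def using A' B' AB
    by (intro exI[of _ "A' \<times> B'"]) (auto simp: open_Times zero_prod_def)
qed

instance "fun" :: (type, locally_convex) locally_convex
proof
  fix r :: real and x :: "'a \<Rightarrow> 'b"
  have 1: "LIM p (nhds r \<times>\<^sub>F nhds x). fst p :> nhds r" "LIM p (nhds r \<times>\<^sub>F nhds x). snd p :> nhds x"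
    by (rule filterlim_fst filterlim_snd)+
  have "((\<lambda>p. fst p *\<^sub>R snd p i) \<longlongrightarrow> r *\<^sub>R x i) (nhds r \<times>\<^sub>F nhds x)" for i
    using 1(2) unfolding tendsto_fun_iff by (intro tendsto_scaleR_lc 1(1)) blast
  then show "LIM p (nhds r \<times>\<^sub>F nhds x). fst p *\<^sub>R snd p :> nhds (r *\<^sub>R x)"
    by (subst tendsto_fun_iff) (simp add: scaleR_fun_def)
next
  fix U :: "('a \<Rightarrow> 'b) set" assume U: "open U" "0 \<in> U"
  then obtain X where X: "0 \<in> Pi\<^sub>E UNIV X" "\<And>i. open (X i)" "finite {i. X i \<noteq> UNIV}" "Pi\<^sub>E UNIV X \<subseteq> U"
    using product_topology_open_contains_basis[of "\<lambda>_. euclidean" UNIV U 0]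
    by (auto simp: open_fun_def)
  have "\<exists>V. open V \<and> convex V \<and> 0 \<in> V \<and> V \<subseteq> X i" for i
    using convex_nhd_0[of "X i"] X(1,2) by (auto simp: PiE_def Pi_def)
  then obtain V where V: "\<And>i. open (V i)" "\<And>i. convex (V i)" "\<And>i. 0 \<in> V i" "\<And>i. V i \<subseteq> X i"
    by metis
  \<comment> \<open>Keeping the full factor where \<open>X i = UNIV\<close> leaves only finitely
    many proper factors, as openness in the product topology demands.\<close>
  define W where "W i = (if X i = UNIV then UNIV else V i)" for i
  have W: "open (W i)" "convex (W i)" "0 \<in> W i" "W i \<subseteq> X i" for i
    using V by (auto simp: W_def)
  have "finite {i. W i \<noteq> UNIV}"
    by (rule finite_subset[OF _ X(3)]) (auto simp: W_def)
  then have "open (Pi\<^sub>E UNIV W)"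
    using W(1) by (intro open_PiE)
  moreover have "convex (Pi\<^sub>E UNIV W)"
    using W(2) by (auto simp: convex_def PiE_def Pi_def scaleR_fun_def)
  moreover have "0 \<in> Pi\<^sub>E UNIV W" using W(3) by auto
  moreover have "Pi\<^sub>E UNIV W \<subseteq> U" using X(4) W(4) by (auto simp: PiE_def Pi_def)
  ultimately show "\<exists>V. open V \<and> 0 \<in> V \<and> V \<subseteq> U \<and>
      (\<forall>x\<in>V. \<forall>y\<in>V. \<forall>u\<ge>0. \<forall>v\<ge>0. u + v = 1 \<longrightarrow> u *\<^sub>R x + v *\<^sub>R y \<in> V)"
    unfolding convex_def by (intro exI[of _ "Pi\<^sub>E UNIV W"]) auto
qed

subsection \<open>Directional derivatives\<close>

lemma has_dir_deriv_unique:
  fixes f :: "'e::real_vector \<Rightarrow> 'f::{real_vector,t2_space}"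
  assumes "has_dir_deriv f x h l" "has_dir_deriv f x h l'"
  shows "l = l'"
  using assms unfolding has_dir_deriv_def by (rule tendsto_unique[rotated]) simp

lemma dir_derivI:
  fixes f :: "'e::real_vector \<Rightarrow> 'f::{real_vector,t2_space}"
  assumes "has_dir_deriv f x h l"
  shows "dir_deriv f x h = l"
  unfolding dir_deriv_def using assms has_dir_deriv_unique by (intro the_equality)

lemma tendsto_line:
  fixes x h :: "'e::locally_convex"
  shows "((\<lambda>t::real. x + t *\<^sub>R h) \<longlongrightarrow> x) (at 0)"
proof -
  have "((\<lambda>t::real. x + t *\<^sub>R h) \<longlongrightarrow> x + 0 *\<^sub>R h) (at 0)"
    by (rule tendsto_add tendsto_const tendsto_scaleR_lc tendsto_ident_at)+
  then show ?thesis by simp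
qed

lemma eventually_line:
  fixes x h :: "'e::locally_convex"
  assumes "open U" "x \<in> U"
  shows "eventually (\<lambda>t::real. x + t *\<^sub>R h \<in> U) (at 0)"
  using topological_tendstoD[OF tendsto_line assms] .

text \<open>Equality is required only along the line through x in direction h. This is what later
  permits replacing a function on a hyperplane, where the two functions agree on no open
  set.\<close>

lemma has_dir_deriv_cong:
  assumes "eventually (\<lambda>t::real. f (x + t *\<^sub>R h) = g (x + t *\<^sub>R h)) (at 0)" "f x = g x"
  shows "has_dir_deriv f x h l \<longleftrightarrow> has_dir_deriv g x h l"
  unfolding has_dir_deriv_def
  by (rule tendsto_cong) (use assms in \<open>auto elim: eventually_mono\<close>)

lemma has_dir_deriv_curve:
  "has_dir_deriv f x h l \<longleftrightarrow> has_dir_deriv (\<lambda>t. f (x + t *\<^sub>R h)) 0 (1::real) l"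
  by (simp add: has_dir_deriv_def)

lemma has_dir_deriv_const: "has_dir_deriv (\<lambda>_. c) x h (0::'f::locally_convex)"
  by (simp add: has_dir_deriv_def)

lemma has_dir_deriv_0: "has_dir_deriv f x 0 (0::'f::locally_convex)"
  by (simp add: has_dir_deriv_def)

lemma has_dir_deriv_id: "has_dir_deriv (\<lambda>x. x) x h (h::'f::locally_convex)"
proof -
  have "((\<lambda>t::real. (x + t *\<^sub>R h - x) /\<^sub>R t) \<longlongrightarrow> h) (at 0)"
    by (rule tendsto_eventually) (auto simp: eventually_at_filter)
  then show ?thesis by (simp add: has_dir_deriv_def)
qed

lemma has_dir_deriv_add:
  fixes f g :: "'e::real_vector \<Rightarrow> 'f::locally_convex"
  assumes "has_dir_deriv f x h l" "has_dir_deriv g x h l'"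
  shows "has_dir_deriv (\<lambda>x. f x + g x) x h (l + l')"
  using tendsto_add[OF assms[unfolded has_dir_deriv_def]]
  by (simp add: has_dir_deriv_def algebra_simps)

lemma has_dir_deriv_cont_linear:
  fixes f :: "'e::real_vector \<Rightarrow> 'f::locally_convex" and T :: "'f \<Rightarrow> 'g::locally_convex"
  assumes "linear T" "continuous_on UNIV T" "has_dir_deriv f x h l"
  shows "has_dir_deriv (\<lambda>x. T (f x)) x h (T l)"
proof -
  have "((\<lambda>t. T ((f (x + t *\<^sub>R h) - f x) /\<^sub>R t)) \<longlongrightarrow> T l) (at 0)"
    by (rule continuous_on_tendsto_compose[OF assms(2) assms(3)[unfolded has_dir_deriv_def]]) simp_all
  then show ?thesis
    by (simp add: has_dir_deriv_def linear_diff[OF assms(1)] linear_cmul[OF assms(1)])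
qed

lemma has_dir_deriv_scaleR:
  fixes f :: "'e::real_vector \<Rightarrow> 'f::locally_convex"
  assumes "has_dir_deriv f x h l"
  shows "has_dir_deriv (\<lambda>x. c *\<^sub>R f x) x h (c *\<^sub>R l)"
proof -
  have "((\<lambda>t. c *\<^sub>R ((f (x + t *\<^sub>R h) - f x) /\<^sub>R t)) \<longlongrightarrow> c *\<^sub>R l) (at 0)"
    using assms unfolding has_dir_deriv_def by (rule tendsto_scaleR_lc[OF tendsto_const])
  moreover have "c *\<^sub>R ((f (x + t *\<^sub>R h) - f x) /\<^sub>R t) = (c *\<^sub>R f (x + t *\<^sub>R h) - c *\<^sub>R f x) /\<^sub>R t" for t
    by (simp add: scaleR_right_diff_distrib mult.commute)
  ultimately show ?thesis by (simp add: has_dir_deriv_def)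
qed

lemma has_dir_deriv_diff:
  fixes f g :: "'e::real_vector \<Rightarrow> 'f::locally_convex"
  assumes "has_dir_deriv f x h l" "has_dir_deriv g x h l'"
  shows "has_dir_deriv (\<lambda>x. f x - g x) x h (l - l')"
  using has_dir_deriv_add[OF assms(1) has_dir_deriv_scaleR[OF assms(2), of "-1"]] by simp

lemma has_dir_deriv_Pair:
  assumes "has_dir_deriv f x h l" "has_dir_deriv g x h l'"
  shows "has_dir_deriv (\<lambda>x. (f x, g x)) x h (l, l')"
  using tendsto_Pair[OF assms[unfolded has_dir_deriv_def]]
  by (simp add: has_dir_deriv_def)

lemma has_dir_deriv_fun:
  assumes "\<And>i. has_dir_deriv (\<lambda>x. f x i) x h (l i)"
  shows "has_dir_deriv f x h l"
  using assms unfolding has_dir_deriv_def by (subst tendsto_fun_iff) (simp add: scaleR_fun_def)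

lemma has_dir_deriv_tendsto:
  fixes c :: "real \<Rightarrow> 'f::locally_convex"
  assumes "has_dir_deriv c 0 1 l"
  shows "(c \<longlongrightarrow> c 0) (at 0)"
proof -
  have "((\<lambda>t. c 0 + t *\<^sub>R ((c t - c 0) /\<^sub>R t)) \<longlongrightarrow> c 0 + 0 *\<^sub>R l) (at 0)"
    using assms unfolding has_dir_deriv_def
    by (intro tendsto_add tendsto_const tendsto_scaleR_lc tendsto_ident_at) simp
  moreover have "eventually (\<lambda>t. c 0 + t *\<^sub>R ((c t - c 0) /\<^sub>R t) = c t) (at 0)"
    by (auto simp: eventually_at_filter)
  ultimately show ?thesis by (simp add: tendsto_cong)
qed

text \<open>
  The mean value theorem for open convex sets of slopes; it replaces the fundamental theorem of
  calculus, which is unavailable because the spaces are not assumed complete.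
\<close>

lemma mvt_convex:
  fixes c :: "real \<Rightarrow> 'f::locally_convex"
  assumes S: "open S" "convex S"
    and c: "\<And>t. 0 \<le> t \<Longrightarrow> t \<le> 1 \<Longrightarrow> \<exists>l\<in>S. has_dir_deriv c t 1 l"
  shows "c 1 - c 0 \<in> S"
proof -
  \<comment> \<open>The slope over a union of two adjacent intervals is a convex combination of
    their slopes, so P passes to unions; it holds on small intervals around each point by
    differentiability, and bisection makes it global.\<close>
  define P where "P a b \<longleftrightarrow> a = b \<or> (c b - c a) /\<^sub>R (b - a) \<in> S" for a b
  have trans: "P a d" if "P a b" "P b d" "a \<le> b" "b \<le> d" for a b d
  proof (cases "a = b \<or> b = d")
    case False
    then have lt: "a < b" "b < d" using that(3,4) by linarith+
    have in_S: "(c b - c a) /\<^sub>R (b - a) \<in> S" "(c d - c b) /\<^sub>R (d - b) \<in> S"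
      using that(1,2) False unfolding P_def by blast+
    have D: "b - a \<noteq> 0" "d - b \<noteq> 0" "d - a > 0" using lt by linarith+
    have "(b - a) / (d - a) + (d - b) / (d - a) = ((b - a) + (d - b)) / (d - a)"
      by (rule add_divide_distrib[symmetric])
    also have "\<dots> = 1" using D(3) by simp
    finally have "((b - a) / (d - a)) *\<^sub>R ((c b - c a) /\<^sub>R (b - a))
        + ((d - b) / (d - a)) *\<^sub>R ((c d - c b) /\<^sub>R (d - b)) \<in> S"
      using lt D(3) by (intro convexD[OF S(2) in_S]) simp_all
    moreover have scale: "(z / (d - a)) *\<^sub>R (w /\<^sub>R z) = w /\<^sub>R (d - a)" if "z \<noteq> 0" for z and w :: 'f
      using that by (simp add: divide_inverse)
    ultimately have "(c b - c a) /\<^sub>R (d - a) + (c d - c b) /\<^sub>R (d - a) \<in> S"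
      by (simp only: scale[OF D(1)] scale[OF D(2)])
    also have "(c b - c a) /\<^sub>R (d - a) + (c d - c b) /\<^sub>R (d - a) = (c d - c a) /\<^sub>R (d - a)"
      by (simp flip: scaleR_right_distrib)
    finally show ?thesis by (simp add: P_def)
  next
    case True
    then show ?thesis using that(1,2) by blast
  qed
  have "P 0 1"
  proof (rule Bolzano[of 0 1 P])
    fix x :: real assume "0 \<le> x" "x \<le> 1"
    then obtain l where l: "l \<in> S" "has_dir_deriv c x 1 l" using c by blast
    have "eventually (\<lambda>t. (c (x + t *\<^sub>R 1) - c x) /\<^sub>R t \<in> S) (at 0)"
      using topological_tendstoD[OF l(2)[unfolded has_dir_deriv_def] S(1) l(1)] .
    then obtain d where d: "d > 0" "\<And>t. t \<noteq> 0 \<Longrightarrow> \<bar>t\<bar> < d \<Longrightarrow> (c (x + t) - c x) /\<^sub>R t \<in> S"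
      by (auto simp: eventually_at dist_real_def)
    have "P a b" if ab: "a \<le> x" "x \<le> b" "b - a < d" for a b
    proof (rule trans[of a x b])
      have "(c a - c x) /\<^sub>R (a - x) = inverse (- (x - a)) *\<^sub>R (- (c x - c a))" by simp
      also have "\<dots> = (c x - c a) /\<^sub>R (x - a)" by (simp only: inverse_minus_eq scaleR_minus_left scaleR_minus_right minus_minus)
      finally show "P a x"
        using d(2)[of "a - x"] ab unfolding P_def by (cases "a = x") simp_all
      show "P x b" using d(2)[of "b - x"] ab unfolding P_def by (cases "b = x") simp_all
    qed (fact ab)+
    then show "\<exists>d>0. \<forall>a b. a \<le> x \<and> x \<le> b \<and> b - a < d \<longrightarrow> P a b"
      using d(1) by blast
  qed (simp, rule trans)
  then show ?thesis by (simp add: P_def)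
qed

subsection \<open>Iterated derivatives of smooth maps\<close>

lemma iter_deriv_append: "iter_deriv f (us @ vs) = iter_deriv (iter_deriv f vs) us"
  by (induction us) auto

text \<open>The set \<open>S\<close> is a slice such as a coordinate hyperplane, in general not
  open. An iterated derivative only sees the function along its own directions, so agreement on a
  slice containing these directions suffices.\<close>

lemma iter_deriv_cong_on:
  fixes f g :: "'e::locally_convex \<Rightarrow> 'f::{real_vector,t2_space}"
  assumes U: "open U" and eq: "\<And>x. x \<in> U \<Longrightarrow> x \<in> S \<Longrightarrow> f x = g x"
    and S: "\<And>x h t. x \<in> S \<Longrightarrow> h \<in> set hs \<Longrightarrow> x + t *\<^sub>R h \<in> S" and x: "x \<in> U" "x \<in> S"
  shows "iter_deriv f hs x = iter_deriv g hs x"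
  using S x
proof (induction hs arbitrary: x)
  case (Cons h hs)
  have eq': "iter_deriv f hs z = iter_deriv g hs z" if "z \<in> U" "z \<in> S" for z
    using Cons that by auto
  have "has_dir_deriv (iter_deriv f hs) x h l \<longleftrightarrow> has_dir_deriv (iter_deriv g hs) x h l" for l
  proof (rule has_dir_deriv_cong)
    show "eventually (\<lambda>t::real. iter_deriv f hs (x + t *\<^sub>R h) = iter_deriv g hs (x + t *\<^sub>R h)) (at 0)"
      using eventually_line[OF U Cons.prems(2)]
      by (rule eventually_mono) (use Cons.prems in \<open>auto intro!: eq'\<close>)
  qed (use eq' Cons.prems in auto)
  then have "has_dir_deriv (iter_deriv f hs) x h = has_dir_deriv (iter_deriv g hs) x h" by (rule ext)
  then show ?case by (simp add: dir_deriv_def)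
qed (use eq in auto)

lemma iter_deriv_cong:
  fixes f g :: "'e::locally_convex \<Rightarrow> 'f::{real_vector,t2_space}"
  assumes "open U" "\<And>x. x \<in> U \<Longrightarrow> f x = g x" "x \<in> U"
  shows "iter_deriv f hs x = iter_deriv g hs x"
  using assms by (intro iter_deriv_cong_on[of U UNIV]) auto

lemma smooth_on_subset: "smooth_on U f \<Longrightarrow> V \<subseteq> U \<Longrightarrow> smooth_on V f"
  unfolding smooth_on_def by (meson Sigma_mono continuous_on_subset order_refl subsetD)

lemma smooth_on_cong:
  fixes f g :: "'e::locally_convex \<Rightarrow> 'f::{real_vector,t2_space}"
  assumes "smooth_on U f" "open U" "\<And>x. x \<in> U \<Longrightarrow> f x = g x"
  shows "smooth_on U g"
proof -
  have eq: "iter_deriv g hs x = iter_deriv f hs x" if "x \<in> U" for hs x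
    using iter_deriv_cong[OF assms(2), of g f] assms(3) that by metis
  have "\<exists>l. has_dir_deriv (iter_deriv g hs) x h l" if x: "x \<in> U" for hs x h
  proof -
    obtain l where "has_dir_deriv (iter_deriv f hs) x h l"
      using assms(1) x unfolding smooth_on_def by blast
    then have "has_dir_deriv (iter_deriv g hs) x h l"
      by (subst has_dir_deriv_cong[of _ _ _ "iter_deriv f hs"])
        (auto intro!: eventually_mono[OF eventually_line[OF assms(2) x]] eq x)
    then show ?thesis by blast
  qed
  moreover have "continuous_on (U \<times> UNIV) (\<lambda>(x, h). iter_deriv g (map h [0..<k]) x)" for k
    using assms(1) unfolding smooth_on_def
    by (subst continuous_on_cong[OF refl, where g = "\<lambda>(x, h). iter_deriv f (map h [0..<k]) x"]) (auto simp: eq)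
  ultimately show ?thesis by (auto simp: smooth_on_def)
qed

lemma smooth_on_deriv:
  assumes "smooth_on U f" "x \<in> U"
  shows "has_dir_deriv (iter_deriv f hs) x h (iter_deriv f (h # hs) x)"
proof -
  obtain l where l: "has_dir_deriv (iter_deriv f hs) x h l"
    using assms unfolding smooth_on_def by blast
  then show ?thesis by (simp add: dir_derivI[OF l])
qed

text \<open>Base point and directions may all move at once. The finite list of directions is padded
  by 0 to a sequence, since joint continuity in the definition of smoothness is stated over
  sequences of directions.\<close>

lemma smooth_on_tendsto:
  fixes f :: "'e::locally_convex \<Rightarrow> 'f::{real_vector,t2_space}"
  assumes f: "smooth_on U f" "open U" "x \<in> U" and y: "(y \<longlongrightarrow> x) F"
    and ws: "list_all2 (\<lambda>w l. (w \<longlongrightarrow> l) F) ws wl"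
  shows "((\<lambda>t. iter_deriv f (map (\<lambda>w. w t) ws) (y t)) \<longlongrightarrow> iter_deriv f wl x) F"
proof -
  define k where "k = length ws"
  have len: "length wl = k" using list_all2_lengthD[OF ws] by (simp add: k_def)
  define W where "W = (\<lambda>t i. if i < k then (ws ! i) t else 0)"
  define L where "L = (\<lambda>i. if i < k then wl ! i else 0)"
  have eqW: "map (\<lambda>w. w t) ws = map (W t) [0..<k]" for t
    by (rule nth_equalityI) (auto simp: W_def k_def)
  have eqL: "wl = map L [0..<k]"
    by (rule nth_equalityI) (auto simp: L_def len)
  have "(W \<longlongrightarrow> L) F"
    unfolding tendsto_fun_iff using ws
    by (auto simp: W_def L_def list_all2_conv_all_nth k_def)
  then have yW: "((\<lambda>t. (y t, W t)) \<longlongrightarrow> (x, L)) F" by (rule tendsto_Pair[OF y])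
  have "continuous_on (U \<times> UNIV) (\<lambda>(x, h). iter_deriv f (map h [0..<k]) x)"
    using f(1) by (simp add: smooth_on_def)
  moreover have "open (U \<times> (UNIV :: (nat \<Rightarrow> 'e) set))" by (rule open_Times[OF f(2) open_UNIV])
  ultimately have "isCont (\<lambda>(x, h). iter_deriv f (map h [0..<k]) x) (x, L)"
    using f(3) by (simp add: continuous_on_eq_continuous_at)
  from isCont_tendsto_compose[OF this yW] show ?thesis
    unfolding eqW by (subst eqL) (simp add: case_prod_unfold)
qed

lemma smooth_on_tendsto_const:
  fixes f :: "'e::locally_convex \<Rightarrow> 'f::{real_vector,t2_space}"
  assumes f: "smooth_on U f" "open U" "x \<in> U" and y: "(y \<longlongrightarrow> x) F"
  shows "((\<lambda>t. iter_deriv f hs (y t)) \<longlongrightarrow> iter_deriv f hs x) F"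
  using smooth_on_tendsto[OF assms, of "map (\<lambda>h _. h) hs" hs]
  by (simp add: list_all2_conv_all_nth o_def)

lemma smooth_on_imp_continuous_on:
  fixes f :: "'e::locally_convex \<Rightarrow> 'f::{real_vector,t2_space}"
  assumes f: "smooth_on U f" "open U"
  shows "continuous_on U f"
  unfolding continuous_on_def
  using smooth_on_tendsto_const[OF f _ tendsto_ident_at, where hs = "[]"] by simp

text \<open>A derivative of \<open>iter_deriv f vs\<close> is a derivative of f of higher order in
  which the directions \<open>vs\<close> are kept constant.\<close>

lemma smooth_on_iter_deriv:
  fixes f :: "'e::locally_convex \<Rightarrow> 'f::{real_vector,t2_space}"
  assumes f: "smooth_on U f" "open U"
  shows "smooth_on U (iter_deriv f vs)"
proof -
  have "\<exists>l. has_dir_deriv (iter_deriv (iter_deriv f vs) hs) x h l" if "x \<in> U" for hs x h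
    using smooth_on_deriv[OF f(1) that, of "hs @ vs" h] unfolding iter_deriv_append by (rule exI)
  moreover have "continuous_on (U \<times> UNIV) (\<lambda>(x, h). iter_deriv (iter_deriv f vs) (map h [0..<k]) x)" for k
    unfolding continuous_on_def
  proof
    fix z :: "'e \<times> (nat \<Rightarrow> 'e)" assume "z \<in> U \<times> UNIV"
    then obtain x h where z: "z = (x, h)" and "x \<in> U" by auto
    let ?F = "at (x, h) within U \<times> UNIV"
    have fst: "(fst \<longlongrightarrow> x) ?F" and snd: "(snd \<longlongrightarrow> h) ?F"
      using tendsto_fst[OF tendsto_ident_at[of "(x, h)" "U \<times> UNIV"]]
        tendsto_snd[OF tendsto_ident_at[of "(x, h)" "U \<times> UNIV"]] by simp_all
    have "((\<lambda>z. iter_deriv f (map (\<lambda>w. w z) (map (\<lambda>i z. snd z i) [0..<k] @ map (\<lambda>v _. v) vs)) (fst z))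
       \<longlongrightarrow> iter_deriv f (map h [0..<k] @ vs) x) ?F"
      by (rule smooth_on_tendsto[OF f \<open>x \<in> U\<close> fst] list_all2_appendI)+
        (use snd[unfolded tendsto_fun_iff] in \<open>auto simp: list_all2_conv_all_nth\<close>)
    then show "((\<lambda>(x, h). iter_deriv (iter_deriv f vs) (map h [0..<k]) x) \<longlongrightarrow>
        (case z of (x, h) \<Rightarrow> iter_deriv (iter_deriv f vs) (map h [0..<k]) x)) (at z within U \<times> UNIV)"
      by (simp add: z case_prod_unfold iter_deriv_append o_def)
  qed
  ultimately show ?thesis by (auto simp: smooth_on_def)
qed

lemma smooth_on_nhd:
  fixes f :: "'e::locally_convex \<Rightarrow> 'f::{real_vector,t2_space}"
  assumes f: "smooth_on U f" "open U" "x \<in> U" and S: "open S" "iter_deriv f hs x \<in> S"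
  shows "\<exists>A. open A \<and> convex A \<and> x \<in> A \<and> A \<subseteq> U \<and> (\<forall>z\<in>A. iter_deriv f hs z \<in> S)"
proof -
  have "continuous_on U (iter_deriv f hs)"
    by (rule smooth_on_imp_continuous_on[OF smooth_on_iter_deriv[OF f(1,2)] f(2)])
  then have "open (iter_deriv f hs -` S \<inter> U)"
    using f(2) S(1) by (simp add: continuous_on_open_vimage)
  then obtain A where "open A" "convex A" "x \<in> A" "A \<subseteq> iter_deriv f hs -` S \<inter> U"
    using convex_nhd[of "iter_deriv f hs -` S \<inter> U" x] f(3) S(2) by blast
  then show ?thesis by (intro exI[of _ A]) blast
qed

text \<open>Division by r compensates the reparametrisation by s r; the increment of this curve over
  [0,1] is then the difference quotient of g, ready for \<open>mvt_convex\<close>.\<close>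

lemma has_dir_deriv_segment:
  assumes "has_dir_deriv g (z + (s * r) *\<^sub>R b) b (l :: 'f::locally_convex)" "r \<noteq> 0"
  shows "has_dir_deriv (\<lambda>s. g (z + (s * r) *\<^sub>R b) /\<^sub>R r) s (1::real) l"
proof -
  let ?x = "z + (s * r) *\<^sub>R b"
  have "filterlim (\<lambda>t. t * r) (at 0) (at (0::real))"
    using assms(2) by (auto simp: filterlim_at eventually_at_filter intro!: tendsto_eq_intros)
  from filterlim_compose[OF assms(1)[unfolded has_dir_deriv_def] this]
  have "((\<lambda>t. (g (?x + (t * r) *\<^sub>R b) - g ?x) /\<^sub>R (t * r)) \<longlongrightarrow> l) (at 0)" .
  moreover have "(g (?x + (t * r) *\<^sub>R b) - g ?x) /\<^sub>R (t * r)
     = (g (z + ((s + t *\<^sub>R 1) * r) *\<^sub>R b) /\<^sub>R r - g (z + (s * r) *\<^sub>R b) /\<^sub>R r) /\<^sub>R t" for t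
    by (simp add: scaleR_left_distrib scaleR_right_diff_distrib algebra_simps)
  ultimately show ?thesis by (simp add: has_dir_deriv_def)
qed

lemma segment_mem_convex:
  assumes "convex A" "z \<in> A" "z + w \<in> A" "0 \<le> s" "s \<le> (1::real)"
  shows "z + s *\<^sub>R w \<in> A"
proof -
  have "(1 - s) *\<^sub>R z + s *\<^sub>R (z + w) \<in> A"
    by (rule convexD[OF assms(1-3)]) (use assms(4,5) in auto)
  also have "(1 - s) *\<^sub>R z + s *\<^sub>R (z + w) = z + s *\<^sub>R w"
    by (simp add: algebra_simps)
  finally show ?thesis .
qed

text \<open>The quotient is a mean value along the segment from y to y + r b. By joint continuity
  the derivatives along this segment lie in a convex neighbourhood of the claimed limit, hence so
  does the quotient. Letting base point, increment and directions vary together makes linearity,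
  chain rule and product rule corollaries.\<close>

lemma iter_deriv_quotient:
  fixes f :: "'e::locally_convex \<Rightarrow> 'f::locally_convex"
  assumes f: "smooth_on U f" "open U" "x \<in> U"
    and lim: "(y \<longlongrightarrow> x) F" "(b \<longlongrightarrow> b0) F" "list_all2 (\<lambda>w l. (w \<longlongrightarrow> l) F) ws wl"
    and r: "(r \<longlongrightarrow> (0::real)) F" "eventually (\<lambda>t. r t \<noteq> 0) F"
  shows "((\<lambda>t. (iter_deriv f (map (\<lambda>w. w t) ws) (y t + r t *\<^sub>R b t)
      - iter_deriv f (map (\<lambda>w. w t) ws) (y t)) /\<^sub>R r t) \<longlongrightarrow> iter_deriv f (b0 # wl) x) F"
proof (rule topological_tendstoI)
  fix S' :: "'f set" assume "open S'" "iter_deriv f (b0 # wl) x \<in> S'"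
  then obtain S where S: "open S" "convex S" "iter_deriv f (b0 # wl) x \<in> S" "S \<subseteq> S'"
    using convex_nhd by blast
  define k where "k = length ws"
  have len: "length wl = k" using list_all2_lengthD[OF lim(3)] by (simp add: k_def)
  define W where "W = (\<lambda>t i. if i = 0 then b t else if i < Suc k then (ws ! (i - 1)) t else 0)"
  define L where "L = (\<lambda>i. if i = 0 then b0 else if i < Suc k then wl ! (i - 1) else 0)"
  have eqW: "b t # map (\<lambda>w. w t) ws = map (W t) [0..<Suc k]" for t
    by (rule nth_equalityI) (auto simp: W_def k_def nth_Cons' simp del: upt_Suc)
  have eqL: "b0 # wl = map L [0..<Suc k]"
    by (rule nth_equalityI) (auto simp: L_def len nth_Cons' simp del: upt_Suc)
  have W: "(W \<longlongrightarrow> L) F"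
    unfolding tendsto_fun_iff using lim(2,3)
    by (auto simp: W_def L_def list_all2_conv_all_nth k_def)
  let ?\<Phi> = "\<lambda>(x, h). iter_deriv f (map h [0..<Suc k]) x"
  have "continuous_on (U \<times> UNIV) ?\<Phi>"
    using f(1) unfolding smooth_on_def by blast
  moreover have "open (U \<times> (UNIV :: (nat \<Rightarrow> 'e) set))" by (rule open_Times[OF f(2) open_UNIV])
  ultimately have "open (?\<Phi> -` S \<inter> U \<times> UNIV)"
    using S(1) by (simp add: continuous_on_open_vimage)
  moreover have "(x, L) \<in> ?\<Phi> -` S \<inter> U \<times> UNIV"
    using S(3) f(3) by (simp only: eqL) simp
  ultimately obtain A0 B where AB: "open A0" "open B" "x \<in> A0" "L \<in> B" "A0 \<times> B \<subseteq> ?\<Phi> -` S \<inter> U \<times> UNIV"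
    by (rule open_prod_elim) (metis mem_Sigma_iff)
  obtain A where A: "open A" "convex A" "x \<in> A" "A \<subseteq> A0" using convex_nhd[OF AB(1,3)] by blast
  have yb: "((\<lambda>t. y t + r t *\<^sub>R b t) \<longlongrightarrow> x + 0 *\<^sub>R b0) F"
    by (intro tendsto_add lim(1) tendsto_scaleR_lc r(1) lim(2))
  have "eventually (\<lambda>t. y t \<in> A) F" using topological_tendstoD[OF lim(1) A(1,3)] .
  moreover have "eventually (\<lambda>t. y t + r t *\<^sub>R b t \<in> A) F"
    using topological_tendstoD[OF yb A(1)] A(3) by simp
  moreover have "eventually (\<lambda>t. W t \<in> B) F" using topological_tendstoD[OF W AB(2,4)] .
  ultimately show "\<forall>\<^sub>F t in F. (iter_deriv f (map (\<lambda>w. w t) ws) (y t + r t *\<^sub>R b t)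
      - iter_deriv f (map (\<lambda>w. w t) ws) (y t)) /\<^sub>R r t \<in> S'"
    using r(2)
  proof eventually_elim
    case (elim t)
    let ?g = "iter_deriv f (map (\<lambda>w. w t) ws)"
    have "?g (y t + (1 * r t) *\<^sub>R b t) /\<^sub>R r t - ?g (y t + (0 * r t) *\<^sub>R b t) /\<^sub>R r t \<in> S"
    proof (rule mvt_convex[OF S(1,2), of "\<lambda>s. ?g (y t + (s * r t) *\<^sub>R b t) /\<^sub>R r t"])
      fix s :: real assume s: "0 \<le> s" "s \<le> 1"
      let ?z = "y t + (s * r t) *\<^sub>R b t"
      have "?z \<in> A"
        using segment_mem_convex[OF A(2) elim(1,2) s] by simp
      then have "(?z, W t) \<in> ?\<Phi> -` S \<inter> U \<times> UNIV" using A(4) AB(5) elim(3) by blast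
      then have z: "?z \<in> U" "iter_deriv f (b t # map (\<lambda>w. w t) ws) ?z \<in> S"
        unfolding eqW by auto
      show "\<exists>l\<in>S. has_dir_deriv (\<lambda>s. ?g (y t + (s * r t) *\<^sub>R b t) /\<^sub>R r t) s 1 l"
        using has_dir_deriv_segment[OF smooth_on_deriv[OF f(1) z(1)] elim(4)] z(2) by blast
    qed
    then show ?case using S(4) by (auto simp: scaleR_right_diff_distrib)
  qed
qed

lemma iter_deriv_quotient_const:
  fixes f :: "'e::locally_convex \<Rightarrow> 'f::locally_convex"
  assumes f: "smooth_on U f" "open U" "x \<in> U"
    and lim: "(y \<longlongrightarrow> x) F" "(b \<longlongrightarrow> b0) F" and r: "(r \<longlongrightarrow> (0::real)) F" "eventually (\<lambda>t. r t \<noteq> 0) F"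
  shows "((\<lambda>t. (iter_deriv f hs (y t + r t *\<^sub>R b t) - iter_deriv f hs (y t)) /\<^sub>R r t) \<longlongrightarrow> iter_deriv f (b0 # hs) x) F"
  using iter_deriv_quotient[OF f lim _ r, of "map (\<lambda>h _. h) hs" hs]
  by (simp add: list_all2_conv_all_nth o_def)

lemma tendsto_0_at: "((\<lambda>t. t) \<longlongrightarrow> (0::real)) (at 0)" "eventually (\<lambda>t. t \<noteq> (0::real)) (at 0)"
  by (auto simp: eventually_at_filter)

text \<open>The increment t(a + b) is made in two legs. The second leg starts at the moving point x
  + t a, which is why the quotient limit is needed with a variable base point.\<close>

lemma iter_deriv_head_add:
  fixes f :: "'e::locally_convex \<Rightarrow> 'f::locally_convex"
  assumes f: "smooth_on U f" "open U" "x \<in> U"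
  shows "iter_deriv f ((a + b) # hs) x = iter_deriv f (a # hs) x + iter_deriv f (b # hs) x"
proof -
  let ?g = "iter_deriv f hs"
  have "((\<lambda>t. (?g ((x + t *\<^sub>R a) + t *\<^sub>R b) - ?g (x + t *\<^sub>R a)) /\<^sub>R t + (?g (x + t *\<^sub>R a) - ?g x) /\<^sub>R t)
     \<longlongrightarrow> iter_deriv f (b # hs) x + iter_deriv f (a # hs) x) (at 0)"
    by (intro tendsto_add iter_deriv_quotient_const[OF f tendsto_line tendsto_const tendsto_0_at]
        iter_deriv_quotient_const[OF f tendsto_const tendsto_const tendsto_0_at])
  then have "has_dir_deriv ?g x (a + b) (iter_deriv f (b # hs) x + iter_deriv f (a # hs) x)"
    by (simp add: has_dir_deriv_def algebra_simps)
  from has_dir_deriv_unique[OF smooth_on_deriv[OF f(1,3)] this] show ?thesis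
    by (simp add: add.commute)
qed

lemma iter_deriv_head_scaleR:
  fixes f :: "'e::locally_convex \<Rightarrow> 'f::locally_convex"
  assumes f: "smooth_on U f" "open U" "x \<in> U"
  shows "iter_deriv f ((c *\<^sub>R a) # hs) x = c *\<^sub>R iter_deriv f (a # hs) x"
proof (cases "c = 0")
  case True
  show ?thesis using dir_derivI[OF has_dir_deriv_0] by (simp add: True)
next
  case False
  let ?g = "iter_deriv f hs"
  have 1: "((\<lambda>t. t * c) \<longlongrightarrow> 0) (at 0)" "eventually (\<lambda>t. t * c \<noteq> 0) (at 0)"
    using False by (auto simp: eventually_at_filter intro!: tendsto_eq_intros)
  have "((\<lambda>t. c *\<^sub>R ((?g (x + (t * c) *\<^sub>R a) - ?g x) /\<^sub>R (t * c))) \<longlongrightarrow> c *\<^sub>R iter_deriv f (a # hs) x) (at 0)"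
    by (rule tendsto_scaleR_lc[OF tendsto_const iter_deriv_quotient_const[OF f tendsto_const tendsto_const 1]])
  moreover have "c *\<^sub>R (z /\<^sub>R (t * c)) = z /\<^sub>R t" for z :: 'f and t
    using False by (simp add: mult.left_commute[of c])
  ultimately have "has_dir_deriv ?g x (c *\<^sub>R a) (c *\<^sub>R iter_deriv f (a # hs) x)"
    by (simp only: has_dir_deriv_def scaleR_scaleR mult.commute)
  from has_dir_deriv_unique[OF smooth_on_deriv[OF f(1,3)] this] show ?thesis .
qed

lemma iter_deriv_add_on:
  fixes f g :: "'e::locally_convex \<Rightarrow> 'f::locally_convex"
  assumes f: "smooth_on U f" "smooth_on U g" "open U" "x \<in> U"
  shows "iter_deriv (\<lambda>x. f x + g x) hs x = iter_deriv f hs x + iter_deriv g hs x"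
  using f(4)
proof (induction hs arbitrary: x)
  case (Cons h hs)
  have "has_dir_deriv (\<lambda>x. iter_deriv f hs x + iter_deriv g hs x) x h (iter_deriv f (h # hs) x + iter_deriv g (h # hs) x)"
    by (intro has_dir_deriv_add smooth_on_deriv[OF f(1) Cons.prems] smooth_on_deriv[OF f(2) Cons.prems])
  then have "has_dir_deriv (iter_deriv (\<lambda>x. f x + g x) hs) x h (iter_deriv f (h # hs) x + iter_deriv g (h # hs) x)"
    by (subst has_dir_deriv_cong[where g = "\<lambda>x. iter_deriv f hs x + iter_deriv g hs x"])
      (auto intro!: Cons eventually_mono[OF eventually_line[OF f(3) Cons.prems]])
  then show ?case by (simp add: dir_derivI)
qed simp

lemma iter_deriv_cont_linear_on:
  fixes f :: "'e::locally_convex \<Rightarrow> 'f::locally_convex" and T :: "'f \<Rightarrow> 'g::locally_convex"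
  assumes T: "linear T" "continuous_on UNIV T" and f: "smooth_on U f" "open U" "x \<in> U"
  shows "iter_deriv (\<lambda>x. T (f x)) hs x = T (iter_deriv f hs x)"
  using f(3)
proof (induction hs arbitrary: x)
  case (Cons h hs)
  have "has_dir_deriv (\<lambda>x. T (iter_deriv f hs x)) x h (T (iter_deriv f (h # hs) x))"
    by (rule has_dir_deriv_cont_linear[OF T smooth_on_deriv[OF f(1) Cons.prems]])
  then have "has_dir_deriv (iter_deriv (\<lambda>x. T (f x)) hs) x h (T (iter_deriv f (h # hs) x))"
    by (subst has_dir_deriv_cong[where g = "\<lambda>x. T (iter_deriv f hs x)"])
      (auto intro!: Cons eventually_mono[OF eventually_line[OF f(2) Cons.prems]])
  then show ?case by (simp add: dir_derivI)
qed simp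

lemma cont_linear_scaleR: "linear (\<lambda>x::'f::locally_convex. c *\<^sub>R x)" "continuous_on UNIV (\<lambda>x::'f. c *\<^sub>R x)"
  by (auto simp: linear_iff algebra_simps continuous_on_def intro!: tendsto_scaleR_lc tendsto_ident_at)

lemma iter_deriv_scaleR_on:
  fixes f :: "'e::locally_convex \<Rightarrow> 'f::locally_convex"
  assumes "smooth_on U f" "open U" "x \<in> U"
  shows "iter_deriv (\<lambda>x. c *\<^sub>R f x) hs x = c *\<^sub>R iter_deriv f hs x"
  by (rule iter_deriv_cont_linear_on[OF cont_linear_scaleR assms])

text \<open>Additivity in the head direction holds on all of U, so it may be differentiated further
  in the outer directions \<open>us\<close>.\<close>

lemma iter_deriv_mid_add:
  fixes f :: "'e::locally_convex \<Rightarrow> 'f::locally_convex"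
  assumes f: "smooth_on U f" "open U" "x \<in> U"
  shows "iter_deriv f (us @ (a + b) # vs) x = iter_deriv f (us @ a # vs) x + iter_deriv f (us @ b # vs) x"
proof -
  have "iter_deriv f (us @ (a + b) # vs) x = iter_deriv (\<lambda>x. iter_deriv f (a # vs) x + iter_deriv f (b # vs) x) us x"
    unfolding iter_deriv_append
    by (rule iter_deriv_cong[OF f(2) _ f(3)]) (rule iter_deriv_head_add[OF f(1,2)])
  then show ?thesis
    by (simp only: iter_deriv_append iter_deriv_add_on[OF smooth_on_iter_deriv[OF f(1,2)] smooth_on_iter_deriv[OF f(1,2)] f(2,3)])
qed

lemma iter_deriv_mid_scaleR:
  fixes f :: "'e::locally_convex \<Rightarrow> 'f::locally_convex"
  assumes f: "smooth_on U f" "open U" "x \<in> U"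
  shows "iter_deriv f (us @ (c *\<^sub>R a) # vs) x = c *\<^sub>R iter_deriv f (us @ a # vs) x"
proof -
  have "iter_deriv f (us @ (c *\<^sub>R a) # vs) x = iter_deriv (\<lambda>x. c *\<^sub>R iter_deriv f (a # vs) x) us x"
    unfolding iter_deriv_append
    by (rule iter_deriv_cong[OF f(2) _ f(3)]) (rule iter_deriv_head_scaleR[OF f(1,2)])
  then show ?thesis
    by (simp only: iter_deriv_append iter_deriv_scaleR_on[OF smooth_on_iter_deriv[OF f(1,2)] f(2,3)])
qed

lemma iter_deriv_mid_diff:
  fixes f :: "'e::locally_convex \<Rightarrow> 'f::locally_convex"
  assumes f: "smooth_on U f" "open U" "x \<in> U"
  shows "iter_deriv f (us @ (a - b) # vs) x = iter_deriv f (us @ a # vs) x - iter_deriv f (us @ b # vs) x"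
  using iter_deriv_mid_add[OF f, of us a "- 1 *\<^sub>R b" vs] unfolding iter_deriv_mid_scaleR[OF f] by simp

text \<open>The second difference quotient \<open>Q\<close> is symmetric in a and b, while two
  applications of the mean value statement show that it tends to the second derivative taken in
  either prescribed order.\<close>

lemma iter_deriv_schwarz:
  fixes f :: "'e::locally_convex \<Rightarrow> 'f::locally_convex"
  assumes f: "smooth_on U f" "open U" "x \<in> U"
  shows "iter_deriv f (a # b # hs) x = iter_deriv f (b # a # hs) x"
proof -
  let ?g = "iter_deriv f hs"
  define Q where "Q a b t = (?g (x + t *\<^sub>R a + t *\<^sub>R b) - ?g (x + t *\<^sub>R a) - ?g (x + t *\<^sub>R b) + ?g x) /\<^sub>R (t * t)" for a b t
  have lim: "(Q a b \<longlongrightarrow> iter_deriv f (b # a # hs) x) (at 0)" for a b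
  proof (rule topological_tendstoI)
    fix S' :: "'f set" assume "open S'" "iter_deriv f (b # a # hs) x \<in> S'"
    then obtain S where S: "open S" "convex S" "iter_deriv f (b # a # hs) x \<in> S" "S \<subseteq> S'"
      using convex_nhd by blast
    obtain A where A: "open A" "convex A" "x \<in> A" "A \<subseteq> U" "\<forall>z\<in>A. iter_deriv f (b # a # hs) z \<in> S"
      using smooth_on_nhd[OF f S(1,3)] by blast
    have "((\<lambda>t. x + t *\<^sub>R a + t *\<^sub>R b) \<longlongrightarrow> x + 0 *\<^sub>R b) (at 0)"
      by (intro tendsto_add tendsto_line tendsto_scaleR_lc tendsto_const tendsto_ident_at)
    then have "eventually (\<lambda>t. x + t *\<^sub>R a + t *\<^sub>R b \<in> A) (at 0)"
      using topological_tendstoD[OF _ A(1)] A(3) by simp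
    moreover note eventually_line[OF A(1,3), of a] eventually_line[OF A(1,3), of b] tendsto_0_at(2)
    ultimately show "eventually (\<lambda>t. Q a b t \<in> S') (at 0)"
    proof eventually_elim
      case (elim t)
      \<comment> \<open>The difference of two opposite sides of the parallelogram, parametrised
        along t a. Its slope is again a difference quotient, now in direction b and of the
        derivative along a, so the mean value statement applies a second time.\<close>
      define c where "c s = (?g ((x + t *\<^sub>R b) + (s * t) *\<^sub>R a) /\<^sub>R t - ?g (x + (s * t) *\<^sub>R a) /\<^sub>R t) /\<^sub>R t" for s
      have "c 1 - c 0 \<in> S"
      proof (rule mvt_convex[OF S(1,2)])
        fix s :: real assume s: "0 \<le> s" "s \<le> 1"
        have in_A: "x + (s * t) *\<^sub>R a + (r * t) *\<^sub>R b \<in> A" if r: "0 \<le> r" "r \<le> 1" for r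
        proof -
          have "x + s *\<^sub>R t *\<^sub>R a \<in> A" using segment_mem_convex[OF A(2,3) elim(2) s] .
          moreover have "x + t *\<^sub>R b + s *\<^sub>R t *\<^sub>R a \<in> A"
            using segment_mem_convex[OF A(2) elim(3) _ s, of "t *\<^sub>R a"] elim(1) by (simp add: add_ac)
          ultimately show ?thesis
            using segment_mem_convex[OF A(2) _ _ r, of "x + s *\<^sub>R t *\<^sub>R a" "t *\<^sub>R b"] by (simp add: add_ac)
        qed
        have in_U: "x + t *\<^sub>R b + (s * t) *\<^sub>R a \<in> U" "x + (s * t) *\<^sub>R a \<in> U"
          using in_A[of 1] in_A[of 0] A(4) by (auto simp: add_ac)
        define l where "l = (iter_deriv f (a # hs) (x + t *\<^sub>R b + (s * t) *\<^sub>R a) - iter_deriv f (a # hs) (x + (s * t) *\<^sub>R a)) /\<^sub>R t"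
        have "has_dir_deriv c s 1 l"
          unfolding c_def l_def
          by (intro has_dir_deriv_scaleR has_dir_deriv_diff has_dir_deriv_segment smooth_on_deriv[OF f(1)] in_U elim(4))
        moreover have "l \<in> S"
        proof -
          have "iter_deriv f (a # hs) (x + (s * t) *\<^sub>R a + (1 * t) *\<^sub>R b) /\<^sub>R t
              - iter_deriv f (a # hs) (x + (s * t) *\<^sub>R a + (0 * t) *\<^sub>R b) /\<^sub>R t \<in> S"
          proof (rule mvt_convex[OF S(1,2), of "\<lambda>r. iter_deriv f (a # hs) (x + (s * t) *\<^sub>R a + (r * t) *\<^sub>R b) /\<^sub>R t"])
            fix r :: real assume r: "0 \<le> r" "r \<le> 1"
            have "x + (s * t) *\<^sub>R a + (r * t) *\<^sub>R b \<in> U" using in_A[OF r] A(4) by blast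
            from has_dir_deriv_segment[OF smooth_on_deriv[OF f(1) this, of "a # hs" b] elim(4)]
            show "\<exists>l\<in>S. has_dir_deriv (\<lambda>r. iter_deriv f (a # hs) (x + (s * t) *\<^sub>R a + (r * t) *\<^sub>R b) /\<^sub>R t) r 1 l"
              using A(5) in_A[OF r] by blast
          qed
          then show ?thesis by (simp add: l_def scaleR_right_diff_distrib add_ac)
        qed
        ultimately show "\<exists>l\<in>S. has_dir_deriv c s 1 l" by blast
      qed
      moreover have "c 1 - c 0 = Q a b t"
        unfolding c_def Q_def by (simp add: algebra_simps)
      ultimately show ?case using S(4) by auto
    qed
  qed
  have "Q a b = Q b a" by (rule ext) (simp add: Q_def algebra_simps)
  then show ?thesis using tendsto_unique[OF _ lim[of a b] lim[of b a, folded \<open>Q a b = Q b a\<close>]] by simp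
qed

lemma iter_deriv_move_front:
  fixes f :: "'e::locally_convex \<Rightarrow> 'f::locally_convex"
  assumes f: "smooth_on U f" "open U" "x \<in> U"
  shows "iter_deriv f (us @ h # vs) x = iter_deriv f (h # us @ vs) x"
  using f(3)
proof (induction us arbitrary: x)
  case (Cons u us)
  have "iter_deriv f ((u # us) @ h # vs) x = iter_deriv (iter_deriv f (us @ h # vs)) [u] x" by simp
  also have "\<dots> = iter_deriv (iter_deriv f (h # us @ vs)) [u] x"
    using Cons by (intro iter_deriv_cong[OF f(2)])
  also have "\<dots> = iter_deriv f (u # h # us @ vs) x" by simp
  also have "\<dots> = iter_deriv f (h # u # us @ vs) x"
    using Cons.prems by (rule iter_deriv_schwarz[OF f(1,2)])
  finally show ?case by simp
qed simp

lemma iter_deriv_perm: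
  fixes f :: "'e::locally_convex \<Rightarrow> 'f::locally_convex"
  assumes f: "smooth_on U f" "open U" "x \<in> U" and "mset hs = mset hs'"
  shows "iter_deriv f hs x = iter_deriv f hs' x"
  using f(3) assms(4)
proof (induction hs arbitrary: hs' x)
  case (Cons h hs)
  then have "h \<in> set hs'" by (metis list.set_intros(1) set_mset_mset)
  then obtain us vs where hs': "hs' = us @ h # vs" by (meson split_list)
  then have m: "mset hs = mset (us @ vs)" using Cons.prems by simp
  have "iter_deriv f (h # hs) x = iter_deriv (iter_deriv f hs) [h] x" by simp
  also have "\<dots> = iter_deriv (iter_deriv f (us @ vs)) [h] x"
    using Cons.IH[OF _ m] Cons.prems(1) by (intro iter_deriv_cong[OF f(2)])
  also have "\<dots> = iter_deriv f hs' x"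
    unfolding hs' iter_deriv_move_front[OF f(1,2) Cons.prems(1)] by simp
  finally show ?case .
qed simp

lemma iter_deriv_zero_dir:
  fixes f :: "'e::locally_convex \<Rightarrow> 'f::locally_convex"
  assumes "0 \<in> set hs"
  shows "iter_deriv f hs x = 0"
  using assms
proof (induction hs arbitrary: x)
  case (Cons h hs)
  show ?case
  proof (cases "h = 0")
    case True
    then show ?thesis using dir_derivI[OF has_dir_deriv_0] by simp
  next
    case False
    then have "iter_deriv f hs = (\<lambda>_. 0)" using Cons by auto
    then show ?thesis using dir_derivI[OF has_dir_deriv_const] by simp
  qed
qed simp

text \<open>The difference quotients of both sides are literally the same, so the identity persists
  where the derivatives do not exist and \<open>THE\<close> returns an unspecified value.\<close>

lemma iter_deriv_linear_comp:
  fixes f :: "'e::real_vector \<Rightarrow> 'f::{real_vector,t2_space}"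
  assumes "linear L"
  shows "iter_deriv (\<lambda>x. f (L x)) hs x = iter_deriv f (map L hs) (L x)"
proof (induction hs arbitrary: x)
  case (Cons h hs)
  have "has_dir_deriv (iter_deriv (\<lambda>x. f (L x)) hs) x h l \<longleftrightarrow> has_dir_deriv (iter_deriv f (map L hs)) (L x) (L h) l" for l
    unfolding has_dir_deriv_def by (simp add: Cons linear_add[OF assms] linear_cmul[OF assms])
  then have "has_dir_deriv (iter_deriv (\<lambda>x. f (L x)) hs) x h = has_dir_deriv (iter_deriv f (map L hs)) (L x) (L h)"
    by (rule ext)
  then show ?case by (simp add: dir_deriv_def)
qed simp

text \<open>The directions in \<open>us\<close> are at time t in both terms, so only their limits
  enter; those in \<open>vs\<close> are still to be differentiated. The induction shifts the head v
  of \<open>vs\<close> to \<open>us\<close>: by linearity in its slot the error is a derivative in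
  the direction (v t - v 0)/t. When \<open>vs\<close> is exhausted only the base point
  moves.\<close>

lemma product_rule_aux:
  fixes f :: "'e::locally_convex \<Rightarrow> 'f::locally_convex"
  assumes f: "smooth_on U f" "open U" "y 0 \<in> U" and y: "has_dir_deriv y (0::real) 1 y'"
    and us: "list_all2 (\<lambda>w l. (w \<longlongrightarrow> l) (at (0::real))) us ul"
    and vs: "list_all2 (\<lambda>w l. has_dir_deriv w (0::real) 1 l) vs vs'"
  shows "((\<lambda>t. (iter_deriv f (map (\<lambda>w. w t) us @ map (\<lambda>w. w t) vs) (y t)
        - iter_deriv f (map (\<lambda>w. w t) us @ map (\<lambda>w. w 0) vs) (y 0)) /\<^sub>R t)
      \<longlongrightarrow> iter_deriv f (y' # ul @ map (\<lambda>w. w 0) vs) (y 0)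
        + (\<Sum>i<length vs. iter_deriv f (ul @ (map (\<lambda>w. w 0) vs)[i := vs' ! i]) (y 0))) (at 0)"
  using us vs
proof (induction vs arbitrary: us ul vs')
  case Nil
  have lim: "((\<lambda>t. (y t - y 0) /\<^sub>R t) \<longlongrightarrow> y') (at 0)"
    using y by (simp add: has_dir_deriv_def)
  have "((\<lambda>t. (iter_deriv f (map (\<lambda>w. w t) us) (y 0 + t *\<^sub>R ((y t - y 0) /\<^sub>R t))
      - iter_deriv f (map (\<lambda>w. w t) us) (y 0)) /\<^sub>R t) \<longlongrightarrow> iter_deriv f (y' # ul) (y 0)) (at 0)"
    by (rule iter_deriv_quotient[OF f tendsto_const lim Nil(1) tendsto_0_at])
  then have "((\<lambda>t. (iter_deriv f (map (\<lambda>w. w t) us) (y t) - iter_deriv f (map (\<lambda>w. w t) us) (y 0)) /\<^sub>R t)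
      \<longlongrightarrow> iter_deriv f (y' # ul) (y 0)) (at 0)"
    by (rule filterlim_cong[OF refl refl, THEN iffD1, rotated]) (auto simp: eventually_at_filter)
  then show ?case using Nil by simp
next
  case (Cons v vs)
  then obtain v' vs'' where vs': "vs' = v' # vs''" by (auto simp: list_all2_Cons1)
  have v: "has_dir_deriv v 0 1 v'" and vs: "list_all2 (\<lambda>w l. has_dir_deriv w 0 1 l) vs vs''"
    using Cons.prems(2) vs' by auto
  have us_v: "list_all2 (\<lambda>w l. (w \<longlongrightarrow> l) (at 0)) (us @ [v]) (ul @ [v 0])"
    using Cons.prems(1) has_dir_deriv_tendsto[OF v] by (auto intro!: list_all2_appendI)
  let ?v0 = "map (\<lambda>w. w 0) vs"
  have 1: "((\<lambda>t. (iter_deriv f (map (\<lambda>w. w t) us @ v t # map (\<lambda>w. w t) vs) (y t)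
        - iter_deriv f (map (\<lambda>w. w t) us @ v t # ?v0) (y 0)) /\<^sub>R t)
      \<longlongrightarrow> iter_deriv f (y' # ul @ v 0 # ?v0) (y 0)
        + (\<Sum>i<length vs. iter_deriv f (ul @ v 0 # ?v0[i := vs'' ! i]) (y 0))) (at 0)"
    using Cons.IH[OF us_v vs] by simp
  have "list_all2 (\<lambda>w l. (w \<longlongrightarrow> l) (at 0)) (us @ (\<lambda>t. (v t - v 0) /\<^sub>R t) # map (\<lambda>w t. w 0) vs) (ul @ v' # ?v0)"
    using Cons.prems(1) v by (intro list_all2_appendI list_all2_Cons[THEN iffD2] conjI)
      (auto simp: has_dir_deriv_def list_all2_conv_all_nth)
  from smooth_on_tendsto[OF f tendsto_const this]
  have "((\<lambda>t. iter_deriv f (map (\<lambda>w. w t) us @ ((v t - v 0) /\<^sub>R t) # ?v0) (y 0))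
      \<longlongrightarrow> iter_deriv f (ul @ v' # ?v0) (y 0)) (at 0)"
    by (simp add: o_def)
  then have 2: "((\<lambda>t. (iter_deriv f (map (\<lambda>w. w t) us @ v t # ?v0) (y 0)
      - iter_deriv f (map (\<lambda>w. w t) us @ v 0 # ?v0) (y 0)) /\<^sub>R t)
      \<longlongrightarrow> iter_deriv f (ul @ v' # ?v0) (y 0)) (at 0)"
    by (simp only: iter_deriv_mid_scaleR[OF f] iter_deriv_mid_diff[OF f])
  have split: "iter_deriv f (y' # ul @ map (\<lambda>w. w 0) (v # vs)) (y 0)
        + (\<Sum>i<length (v # vs). iter_deriv f (ul @ (map (\<lambda>w. w 0) (v # vs))[i := vs' ! i]) (y 0))
     = iter_deriv f (y' # ul @ v 0 # ?v0) (y 0)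
        + (\<Sum>i<length vs. iter_deriv f (ul @ v 0 # ?v0[i := vs'' ! i]) (y 0)) + iter_deriv f (ul @ v' # ?v0) (y 0)"
    by (simp add: vs' sum.lessThan_Suc_shift del: sum.lessThan_Suc iter_deriv.simps)
  have quot: "(iter_deriv f (map (\<lambda>w. w t) us @ map (\<lambda>w. w t) (v # vs)) (y t)
        - iter_deriv f (map (\<lambda>w. w t) us @ map (\<lambda>w. w 0) (v # vs)) (y 0)) /\<^sub>R t
     = (iter_deriv f (map (\<lambda>w. w t) us @ v t # map (\<lambda>w. w t) vs) (y t)
        - iter_deriv f (map (\<lambda>w. w t) us @ v t # ?v0) (y 0)) /\<^sub>R t
     + (iter_deriv f (map (\<lambda>w. w t) us @ v t # ?v0) (y 0)
      - iter_deriv f (map (\<lambda>w. w t) us @ v 0 # ?v0) (y 0)) /\<^sub>R t" for t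
    by (simp flip: scaleR_right_distrib)
  show ?case
    unfolding split quot using tendsto_add[OF 1 2] .
qed

lemma iter_deriv_product_rule:
  fixes f :: "'e::locally_convex \<Rightarrow> 'f::locally_convex"
  assumes f: "smooth_on U f" "open U" "y 0 \<in> U" and y: "has_dir_deriv y (0::real) 1 y'"
    and vs: "list_all2 (\<lambda>w l. has_dir_deriv w (0::real) 1 l) vs vs'"
  shows "has_dir_deriv (\<lambda>t. iter_deriv f (map (\<lambda>w. w t) vs) (y t)) 0 1
      (iter_deriv f (y' # map (\<lambda>w. w 0) vs) (y 0)
        + (\<Sum>i<length vs. iter_deriv f ((map (\<lambda>w. w 0) vs)[i := vs' ! i]) (y 0)))"
  using product_rule_aux[OF f y _ vs, of "[]" "[]"] by (simp add: has_dir_deriv_def)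

lemma iter_deriv_chain_curve:
  fixes f :: "'e::locally_convex \<Rightarrow> 'f::locally_convex"
  assumes f: "smooth_on U f" "open U" "y 0 \<in> U" and y: "has_dir_deriv y (0::real) 1 y'"
  shows "has_dir_deriv (\<lambda>t. iter_deriv f hs (y t)) 0 1 (iter_deriv f (y' # hs) (y 0))"
  using product_rule_aux[OF f y, of "map (\<lambda>h _. h) hs" hs "[]" "[]"]
  by (simp add: has_dir_deriv_def list_all2_conv_all_nth o_def)

lemma iter_deriv_chain:
  fixes f :: "'e::locally_convex \<Rightarrow> 'f::locally_convex" and g :: "'p::real_vector \<Rightarrow> 'e"
  assumes f: "smooth_on U f" "open U" "g p \<in> U" and g: "has_dir_deriv g p h g'"
  shows "has_dir_deriv (\<lambda>p. iter_deriv f hs (g p)) p h (iter_deriv f (g' # hs) (g p))"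
  using iter_deriv_chain_curve[OF f(1,2), of "\<lambda>t. g (p + t *\<^sub>R h)"] f(3) g
  unfolding has_dir_deriv_curve[of _ p h] by simp

section \<open>Constructing smooth maps\<close>

text \<open>A candidate family D of all iterated derivatives, closed under differentiation and
  jointly continuous, certifies smoothness and computes \<open>iter_deriv\<close> at the same time.
  Each construction then only has to guess D.\<close>

lemma smooth_onI:
  fixes f :: "'e::locally_convex \<Rightarrow> 'f::locally_convex" and D :: "'e list \<Rightarrow> 'e \<Rightarrow> 'f"
  assumes U: "open U" and D0: "\<And>x. x \<in> U \<Longrightarrow> f x = D [] x"
    and D: "\<And>hs h x. x \<in> U \<Longrightarrow> has_dir_deriv (D hs) x h (D (h # hs) x)"
    and cont: "\<And>k p h. p \<in> U \<Longrightarrow> ((\<lambda>z. D (map (snd z) [0..<k]) (fst z)) \<longlongrightarrow> D (map h [0..<k]) p) (at (p, h) within U \<times> UNIV)"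
  shows "smooth_on U f" and "\<And>hs x. x \<in> U \<Longrightarrow> iter_deriv f hs x = D hs x"
proof -
  have eq: "iter_deriv f hs x = D hs x" if "x \<in> U" for hs x
    using that
  proof (induction hs arbitrary: x)
    case (Cons h hs)
    have "has_dir_deriv (iter_deriv f hs) x h (D (h # hs) x)"
      by (subst has_dir_deriv_cong[where g = "D hs"])
        (auto intro!: Cons D eventually_mono[OF eventually_line[OF U Cons.prems]])
    then show ?case by (simp add: dir_derivI)
  qed (use D0 in auto)
  have "has_dir_deriv (iter_deriv f hs) x h (D (h # hs) x)" if "x \<in> U" for hs x h
    by (subst has_dir_deriv_cong[where g = "D hs"])
      (auto intro!: eq D that eventually_mono[OF eventually_line[OF U that]])
  moreover have "continuous_on (U \<times> UNIV) (\<lambda>(x, h). iter_deriv f (map h [0..<k]) x)" for k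
  proof -
    have "continuous_on (U \<times> UNIV) (\<lambda>z. D (map (snd z) [0..<k]) (fst z))"
      unfolding continuous_on_def
    proof
      fix z :: "'e \<times> (nat \<Rightarrow> 'e)" assume "z \<in> U \<times> UNIV"
      then have "fst z \<in> U" by auto
      from cont[OF this, of k "snd z"]
      show "((\<lambda>z. D (map (snd z) [0..<k]) (fst z)) \<longlongrightarrow> D (map (snd z) [0..<k]) (fst z)) (at z within U \<times> UNIV)"
        by simp
    qed
    then show ?thesis
      by (rule continuous_on_cong[OF refl, THEN iffD1, rotated]) (auto simp: eq)
  qed
  ultimately show "smooth_on U f" unfolding smooth_on_def by blast
  show "\<And>hs x. x \<in> U \<Longrightarrow> iter_deriv f hs x = D hs x" by (rule eq)
qed

lemma tendsto_fst_within: "(fst \<longlongrightarrow> p) (at (p, h) within S)"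
  using tendsto_fst[OF tendsto_ident_at[of "(p, h)" S]] by simp

lemma tendsto_snd_within: "((\<lambda>z. snd z i) \<longlongrightarrow> h i) (at (p, h) within S)"
proof -
  have "(snd \<longlongrightarrow> h) (at (p, h) within S)"
    using tendsto_snd[OF tendsto_ident_at[of "(p, h)" S]] by simp
  then show ?thesis unfolding tendsto_fun_iff by blast
qed

lemma smooth_on_tendsto_within:
  fixes f :: "'e::locally_convex \<Rightarrow> 'f::{real_vector,t2_space}"
  assumes "smooth_on U f" "open U" "p \<in> U"
  shows "((\<lambda>z. iter_deriv f (map (snd z) js) (fst z)) \<longlongrightarrow> iter_deriv f (map h js) p) (at (p, h) within U \<times> UNIV)"
  using smooth_on_tendsto[OF assms tendsto_fst_within, of h "U \<times> UNIV" "map (\<lambda>i z. snd z i) js" "map h js"]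
  by (simp add: o_def list_all2_conv_all_nth tendsto_snd_within)

lemma smooth_on_Pair:
  fixes f :: "'e::locally_convex \<Rightarrow> 'f::locally_convex" and g :: "'e \<Rightarrow> 'g::locally_convex"
  assumes f: "smooth_on U f" and g: "smooth_on U g" and U: "open U"
  shows "smooth_on U (\<lambda>x. (f x, g x))"
    and "\<And>hs x. x \<in> U \<Longrightarrow> iter_deriv (\<lambda>x. (f x, g x)) hs x = (iter_deriv f hs x, iter_deriv g hs x)"
proof -
  let ?D = "\<lambda>hs x. (iter_deriv f hs x, iter_deriv g hs x)"
  have 1: "has_dir_deriv (?D hs) x h (?D (h # hs) x)" if "x \<in> U" for hs h x
    by (rule has_dir_deriv_Pair smooth_on_deriv[OF f that] smooth_on_deriv[OF g that])+
  have 2: "((\<lambda>z. ?D (map (snd z) [0..<k]) (fst z)) \<longlongrightarrow> ?D (map h [0..<k]) p) (at (p, h) within U \<times> UNIV)"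
    if "p \<in> U" for k p h
    by (rule tendsto_Pair smooth_on_tendsto_within[OF f U that] smooth_on_tendsto_within[OF g U that])+
  show "smooth_on U (\<lambda>x. (f x, g x))"
    by (rule smooth_onI(1)[of U _ ?D, OF U _ 1 2]) simp_all
  show "\<And>hs x. x \<in> U \<Longrightarrow> iter_deriv (\<lambda>x. (f x, g x)) hs x = (iter_deriv f hs x, iter_deriv g hs x)"
    by (rule smooth_onI(2)[of U _ ?D, OF U _ 1 2]) simp_all
qed

lemma smooth_on_fun:
  fixes f :: "'e::locally_convex \<Rightarrow> 'i \<Rightarrow> 'f::locally_convex"
  assumes f: "\<And>i. smooth_on U (\<lambda>x. f x i)" and U: "open U"
  shows "smooth_on U f"
    and "\<And>hs x. x \<in> U \<Longrightarrow> iter_deriv f hs x = (\<lambda>i. iter_deriv (\<lambda>x. f x i) hs x)"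
proof -
  let ?D = "\<lambda>hs x. (\<lambda>i. iter_deriv (\<lambda>x. f x i) hs x)"
  have 1: "has_dir_deriv (?D hs) x h (?D (h # hs) x)" if "x \<in> U" for hs h x
    by (rule has_dir_deriv_fun) (rule smooth_on_deriv[OF f that])
  have 2: "((\<lambda>z. ?D (map (snd z) [0..<k]) (fst z)) \<longlongrightarrow> ?D (map h [0..<k]) p) (at (p, h) within U \<times> UNIV)"
    if "p \<in> U" for k p h
    unfolding tendsto_fun_iff by (rule allI) (rule smooth_on_tendsto_within[OF f U that])
  show "smooth_on U f"
    by (rule smooth_onI(1)[of U _ ?D, OF U _ 1 2]) simp_all
  show "\<And>hs x. x \<in> U \<Longrightarrow> iter_deriv f hs x = (\<lambda>i. iter_deriv (\<lambda>x. f x i) hs x)"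
    by (rule smooth_onI(2)[of U _ ?D, OF U _ 1 2]) simp_all
qed

lemma smooth_on_const: "open U \<Longrightarrow> smooth_on U (\<lambda>x::'e::locally_convex. c::'f::locally_convex)"
  by (rule smooth_onI(1)[of U _ "\<lambda>hs x. if hs = [] then c else 0"]) (auto simp: has_dir_deriv_const)

lemma smooth_on_cont_linear:
  fixes T :: "'e::locally_convex \<Rightarrow> 'f::locally_convex"
  assumes T: "linear T" "continuous_on UNIV T" and U: "open U"
  shows "smooth_on U T"
proof (rule smooth_onI(1)[of U _ "\<lambda>hs x. case hs of [] \<Rightarrow> T x | [h] \<Rightarrow> T h | _ \<Rightarrow> 0", OF U])
  fix hs :: "'e list" and h x
  show "has_dir_deriv (\<lambda>x. case hs of [] \<Rightarrow> T x | [h] \<Rightarrow> T h | _ \<Rightarrow> 0) x h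
      (case h # hs of [] \<Rightarrow> T x | [h] \<Rightarrow> T h | _ \<Rightarrow> 0)"
    using has_dir_deriv_cont_linear[OF T has_dir_deriv_id]
    by (cases hs; cases "tl hs") (auto simp: has_dir_deriv_const)
next
  fix k :: nat and p :: 'e and h :: "nat \<Rightarrow> 'e"
  assume "p \<in> U"
  let ?F = "at (p, h) within U \<times> UNIV"
  have T': "((\<lambda>z. T (g z)) \<longlongrightarrow> T l) ?F" if "(g \<longlongrightarrow> l) ?F" for g l
    by (rule continuous_on_tendsto_compose[OF T(2) that]) auto
  consider "k = 0" | "k = 1" | k' where "k = Suc (Suc k')" by (cases k; cases "k - 1") auto
  then show "((\<lambda>z. case map (snd z) [0..<k] of [] \<Rightarrow> T (fst z) | [h] \<Rightarrow> T h | _ \<Rightarrow> 0) \<longlongrightarrow>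
      (case map h [0..<k] of [] \<Rightarrow> T p | [h] \<Rightarrow> T h | _ \<Rightarrow> 0)) ?F"
    by cases (simp_all add: T' tendsto_fst_within tendsto_snd_within upt_conv_Cons del: upt_Suc)
qed simp

text \<open>Faa di Bruno: the iterated derivative of a composition is a sum over set partitions of the
  list of directions.\<close>

primrec partitions :: "'x list \<Rightarrow> 'x list list list"
  where
    "partitions [] = [[]]"
  | "partitions (h # hs) = concat (map (\<lambda>\<pi>. ([h] # \<pi>) # map (\<lambda>i. \<pi>[i := h # \<pi> ! i]) [0..<length \<pi>]) (partitions hs))"

lemma partitions_map: "partitions (map h xs) = map (map (map h)) (partitions xs)"
  by (induction xs)
    (auto simp: map_concat o_def map_update intro!: arg_cong[where f = concat] map_cong)

lemma sum_list_map_concat: "sum_list (map F (concat xss)) = sum_list (map (\<lambda>xs. sum_list (map F xs)) xss)"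
  by (induction xss) auto

lemma sum_list_partitions_Cons:
  fixes F :: "'x list list \<Rightarrow> 'f::comm_monoid_add"
  shows "sum_list (map F (partitions (h # hs)))
    = sum_list (map (\<lambda>\<pi>. F ([h] # \<pi>) + (\<Sum>i<length \<pi>. F (\<pi>[i := h # \<pi> ! i]))) (partitions hs))"
  by (simp add: sum_list_map_concat o_def interv_sum_list_conv_sum_set_nat atLeast0LessThan)

lemma has_dir_deriv_sum_list:
  assumes "\<And>x. x \<in> set xs \<Longrightarrow> has_dir_deriv (\<lambda>p. F x p) p h (F' x :: 'f::locally_convex)"
  shows "has_dir_deriv (\<lambda>p. sum_list (map (\<lambda>x. F x p) xs)) p h (sum_list (map F' xs))"
  using assms by (induction xs) (auto intro!: has_dir_deriv_add has_dir_deriv_const)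

lemma tendsto_sum_list:
  assumes "\<And>x. x \<in> set xs \<Longrightarrow> ((\<lambda>z. G x z) \<longlongrightarrow> (l x :: 'f::topological_comm_monoid_add)) F"
  shows "((\<lambda>z. sum_list (map (\<lambda>x. G x z) xs)) \<longlongrightarrow> sum_list (map l xs)) F"
  using assms by (induction xs) (auto intro!: tendsto_add)

text \<open>In the product rule for one summand, moving the base point f p creates the new block
  [h], and moving the direction belonging to a block B enlarges it to h # B. These are exactly the
  partitions of h # hs arising from a partition of hs.\<close>

lemma smooth_on_compose:
  fixes g :: "'e::locally_convex \<Rightarrow> 'f::locally_convex" and f :: "'p::locally_convex \<Rightarrow> 'e"
  assumes g: "smooth_on U g" "open U" and f: "smooth_on V f" "open V" and sub: "\<And>p. p \<in> V \<Longrightarrow> f p \<in> U"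
  shows "smooth_on V (\<lambda>p. g (f p))"
proof (rule smooth_onI(1)[of V _ "\<lambda>hs p. sum_list (map (\<lambda>\<pi>. iter_deriv g (map (\<lambda>B. iter_deriv f B p) \<pi>) (f p)) (partitions hs))", OF f(2)])
  fix hs h p assume p: "p \<in> V"
  let ?E = "\<lambda>\<pi>. map (\<lambda>B. iter_deriv f B p) \<pi>"
  show "has_dir_deriv (\<lambda>p. sum_list (map (\<lambda>\<pi>. iter_deriv g (map (\<lambda>B. iter_deriv f B p) \<pi>) (f p)) (partitions hs))) p h
     (sum_list (map (\<lambda>\<pi>. iter_deriv g (?E \<pi>) (f p)) (partitions (h # hs))))"
    unfolding sum_list_partitions_Cons
  proof (rule has_dir_deriv_sum_list)
    fix \<pi>
    have f': "has_dir_deriv (\<lambda>t. iter_deriv f B (p + t *\<^sub>R h)) (0::real) 1 (iter_deriv f (h # B) p)" for B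
      using smooth_on_deriv[OF f(1) p, of B h] unfolding has_dir_deriv_curve[of _ p h] .
    have "has_dir_deriv (\<lambda>t. iter_deriv g (map (\<lambda>w. w t) (map (\<lambda>B t. iter_deriv f B (p + t *\<^sub>R h)) \<pi>)) (f (p + t *\<^sub>R h))) (0::real) 1
       (iter_deriv g (iter_deriv f [h] p # map (\<lambda>w. w 0) (map (\<lambda>B t. iter_deriv f B (p + t *\<^sub>R h)) \<pi>)) (f (p + 0 *\<^sub>R h))
        + (\<Sum>i<length (map (\<lambda>B t. iter_deriv f B (p + t *\<^sub>R h)) \<pi>). iter_deriv g ((map (\<lambda>w. w 0) (map (\<lambda>B t. iter_deriv f B (p + t *\<^sub>R h)) \<pi>))[i := map (\<lambda>B. iter_deriv f (h # B) p) \<pi> ! i]) (f (p + 0 *\<^sub>R h))))"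
      using sub[OF p] f'[of "[]"]
      by (intro iter_deriv_product_rule[OF g]) (auto simp: list_all2_conv_all_nth simp del: iter_deriv.simps(2) intro!: f')
    moreover have "map (\<lambda>w. w 0) (map (\<lambda>B t. iter_deriv f B (p + t *\<^sub>R h)) \<pi>) = ?E \<pi>"
      by simp
    moreover have "(\<Sum>i<length \<pi>. iter_deriv g ((?E \<pi>)[i := map (\<lambda>B. iter_deriv f (h # B) p) \<pi> ! i]) (f p))
        = (\<Sum>i<length \<pi>. iter_deriv g (?E (\<pi>[i := h # \<pi> ! i])) (f p))"
      by (intro sum.cong refl) (simp add: map_update del: iter_deriv.simps)
    ultimately show "has_dir_deriv (\<lambda>p. iter_deriv g (map (\<lambda>B. iter_deriv f B p) \<pi>) (f p)) p h
        (iter_deriv g (?E ([h] # \<pi>)) (f p) + (\<Sum>i<length \<pi>. iter_deriv g (?E (\<pi>[i := h # \<pi> ! i])) (f p)))"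
      unfolding has_dir_deriv_curve[of _ p h] by (simp add: o_def del: iter_deriv.simps)
  qed
next
  fix k :: nat and p :: 'p and h :: "nat \<Rightarrow> 'p" assume p: "p \<in> V"
  let ?F = "at (p, h) within V \<times> UNIV"
  have "((\<lambda>z. iter_deriv g (map (\<lambda>B. iter_deriv f (map (snd z) B) (fst z)) \<pi>) (f (fst z))) \<longlongrightarrow>
      iter_deriv g (map (\<lambda>B. iter_deriv f (map h B) p) \<pi>) (f p)) ?F" for \<pi> :: "nat list list"
  proof -
    have "((\<lambda>z. f (fst z)) \<longlongrightarrow> f p) ?F"
      using smooth_on_tendsto_within[OF f p, of "[]"] by simp
    from smooth_on_tendsto[OF g sub[OF p] this, of "map (\<lambda>B z. iter_deriv f (map (snd z) B) (fst z)) \<pi>" "map (\<lambda>B. iter_deriv f (map h B) p) \<pi>"]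
    show ?thesis by (simp add: o_def list_all2_conv_all_nth smooth_on_tendsto_within[OF f p])
  qed
  \<comment> \<open>By naturality of \<open>partitions\<close> the sum runs over the partitions of
    the fixed index list, so only its summands depend on z.\<close>
  then show "((\<lambda>z. sum_list (map (\<lambda>\<pi>. iter_deriv g (map (\<lambda>B. iter_deriv f B (fst z)) \<pi>) (f (fst z))) (partitions (map (snd z) [0..<k]))))
     \<longlongrightarrow> sum_list (map (\<lambda>\<pi>. iter_deriv g (map (\<lambda>B. iter_deriv f B p) \<pi>) (f p)) (partitions (map h [0..<k])))) ?F"
    unfolding partitions_map map_map o_def by (intro tendsto_sum_list)
qed simp

lemma smooth_on_cont_linear_comp:
  fixes f :: "'e::locally_convex \<Rightarrow> 'f::locally_convex" and T :: "'f \<Rightarrow> 'g::locally_convex"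
  assumes "linear T" "continuous_on UNIV T" "smooth_on U f" "open U"
  shows "smooth_on U (\<lambda>x. T (f x))"
  by (rule smooth_on_compose[OF smooth_on_cont_linear[OF assms(1,2) open_UNIV] open_UNIV assms(3,4)]) simp

lemma smooth_on_add:
  fixes f g :: "'e::locally_convex \<Rightarrow> 'f::locally_convex"
  assumes "smooth_on U f" "smooth_on U g" "open U"
  shows "smooth_on U (\<lambda>x. f x + g x)"
proof -
  have "linear (\<lambda>z::'f \<times> 'f. fst z + snd z)" by (simp add: linear_iff algebra_simps)
  moreover have "continuous_on UNIV (\<lambda>z::'f \<times> 'f. fst z + snd z)"
    by (rule continuous_on_add continuous_on_fst continuous_on_snd continuous_on_id)+
  ultimately show ?thesis
    using smooth_on_cont_linear_comp[OF _ _ smooth_on_Pair(1)[OF assms] assms(3), of "\<lambda>z. fst z + snd z"] by simp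
qed

subsection \<open>Germs of smooth maps in charts\<close>

text \<open>Smoothness at one point and in one chart. The neighbourhood is part of the notion
  because the values must stay in the chart domain for the chart to be inverted there.\<close>

definition smooth_near :: "('m, 'f::locally_convex) chart \<Rightarrow> ('p::locally_convex \<Rightarrow> 'm) \<Rightarrow> 'p \<Rightarrow> bool"
  where "smooth_near ch F p \<longleftrightarrow>
    (\<exists>U. open U \<and> p \<in> U \<and> (\<forall>x\<in>U. F x \<in> fst ch) \<and> smooth_on U (\<lambda>x. snd ch (F x)))"

lemma smooth_near_cong:
  assumes "smooth_near ch F p" "open V" "p \<in> V" "\<And>x. x \<in> V \<Longrightarrow> F x = F' x"
  shows "smooth_near ch F' p"
proof -
  obtain U where U: "open U" "p \<in> U" "\<forall>x\<in>U. F x \<in> fst ch" "smooth_on U (\<lambda>x. snd ch (F x))"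
    using assms(1) unfolding smooth_near_def by blast
  have "smooth_on (U \<inter> V) (\<lambda>x. snd ch (F' x))"
    by (rule smooth_on_cong[OF smooth_on_subset[OF U(4)]]) (use U assms in auto)
  moreover have "\<forall>x\<in>U \<inter> V. F' x \<in> fst ch" using U(3) assms(4) by fastforce
  ultimately show ?thesis
    unfolding smooth_near_def using U(1,2) assms(2,3) by (intro exI[of _ "U \<inter> V"]) auto
qed

lemma smooth_near_compose:
  assumes F: "smooth_near ch F x" and g: "smooth_on V g" "open V" "p \<in> V" and gp: "g p = x"
  shows "smooth_near ch (\<lambda>p. F (g p)) p"
proof -
  obtain U where U: "open U" "x \<in> U" "\<forall>x\<in>U. F x \<in> fst ch" "smooth_on U (\<lambda>x. snd ch (F x))"
    using F unfolding smooth_near_def by blast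
  have "open (g -` U \<inter> V)"
    using smooth_on_imp_continuous_on[OF g(1,2)] g(2) U(1) by (simp add: continuous_on_open_vimage)
  moreover have "smooth_on (g -` U \<inter> V) (\<lambda>p. snd ch (F (g p)))"
    by (rule smooth_on_compose[OF U(4,1) smooth_on_subset[OF g(1)]]) (use calculation in auto)
  ultimately show ?thesis
    unfolding smooth_near_def using U g gp by (intro exI[of _ "g -` U \<inter> V"]) auto
qed

lemma chart_inv_chart:
  assumes "is_chart ch" "x \<in> fst ch"
  shows "chart_inv ch (snd ch x) = x"
  using assms unfolding is_chart_def homeomorphism_def by auto

lemma chart_chart_inv:
  assumes "u \<in> snd ch ` fst ch"
  shows "snd ch (chart_inv ch u) = u" "chart_inv ch u \<in> fst ch"
  using assms by (auto intro: f_inv_into_f inv_into_into)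

lemma smooth_near_chart_inv:
  fixes ch :: "('m::t2_space, 'e::locally_convex) chart"
  assumes "is_chart ch" "x \<in> fst ch"
  shows "smooth_near ch (chart_inv ch) (snd ch x)"
proof -
  let ?U = "snd ch ` fst ch"
  have U: "open ?U" using assms(1) by (simp add: is_chart_def)
  have "smooth_on ?U (\<lambda>u::'e. u)"
    by (rule smooth_on_cont_linear[OF _ _ U]) (auto simp: linear_iff)
  then have "smooth_on ?U (\<lambda>u. snd ch (chart_inv ch u))"
    by (rule smooth_on_cong[OF _ U]) (simp add: chart_chart_inv)
  then show ?thesis
    unfolding smooth_near_def using U assms(2) by (intro exI[of _ ?U]) (auto intro: chart_chart_inv)
qed

lemma continuous_on_chart_inv:
  "is_chart ch \<Longrightarrow> continuous_on (snd ch ` fst ch) (chart_inv ch)"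
  unfolding is_chart_def homeomorphism_def by blast

lemma smooth_map_near:
  fixes M :: "('m::t2_space, 'e::locally_convex) manifold" and N :: "('n::t2_space, 'f::locally_convex) manifold"
  assumes F: "smooth_map M N S F" "open S" and c: "is_chart c" "c \<in> atlas M" and d: "is_chart d" "d \<in> atlas N"
    and p: "p \<in> fst c" "p \<in> S" "F p \<in> fst d"
  shows "smooth_near d (\<lambda>x. F (chart_inv c x)) (snd c p)"
proof -
  let ?O = "snd c ` fst c"
  have O: "open ?O" and fd: "open (fst d)" using c d by (simp_all add: is_chart_def)
  have 1: "open (chart_inv c -` S \<inter> ?O)"
    using continuous_on_chart_inv[OF c(1)] O F(2) by (simp add: continuous_on_open_vimage)
  have "continuous_on (chart_inv c -` S \<inter> ?O) (\<lambda>x. F (chart_inv c x))"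
    by (rule continuous_on_compose2[of S F])
      (use F(1) continuous_on_subset[OF continuous_on_chart_inv[OF c(1)]] in \<open>auto simp: smooth_map_def\<close>)
  then have "open ((\<lambda>x. F (chart_inv c x)) -` fst d \<inter> (chart_inv c -` S \<inter> ?O))" (is "open ?U")
    using 1 fd by (simp add: continuous_on_open_vimage)
  moreover have "smooth_on ?U (\<lambda>x. snd d (F (chart_inv c x)))"
  proof (rule smooth_on_subset)
    show "smooth_on (snd c ` (fst c \<inter> S \<inter> F -` fst d)) (\<lambda>x. snd d (F (chart_inv c x)))"
      using F(1) c(2) d(2) unfolding smooth_map_def o_def by blast
    show "?U \<subseteq> snd c ` (fst c \<inter> S \<inter> F -` fst d)"
      using chart_inv_chart[OF c(1)] by fastforce
  qed
  moreover have "snd c p \<in> ?U" using p chart_inv_chart[OF c(1) p(1)] by auto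
  ultimately show ?thesis unfolding smooth_near_def by (intro exI[of _ ?U]) auto
qed

lemma prod_chart_inv:
  assumes "is_chart c" "is_chart d" "x \<in> snd c ` fst c" "y \<in> snd d ` fst d"
  shows "chart_inv (prod_chart c d) (x, y) = (chart_inv c x, chart_inv d y)"
proof -
  have inj: "inj_on (map_prod (snd c) (snd d)) (fst c \<times> fst d)"
    using chart_inv_chart[OF assms(1)] chart_inv_chart[OF assms(2)]
    by (auto simp: inj_on_def) metis+
  have "inv_into (fst c \<times> fst d) (map_prod (snd c) (snd d))
      (map_prod (snd c) (snd d) (chart_inv c x, chart_inv d y)) = (chart_inv c x, chart_inv d y)"
    using chart_chart_inv(2)[OF assms(3)] chart_chart_inv(2)[OF assms(4)]
    by (intro inv_into_f_f[OF inj] SigmaI)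
  then show ?thesis using assms by (simp add: prod_chart_def chart_chart_inv)
qed

lemma smooth_map_prod_near:
  fixes M :: "('m::t2_space, 'e::locally_convex) manifold" and N :: "('n::t2_space, 'f::locally_convex) manifold"
    and P :: "('p::t2_space, 'h::locally_convex) manifold"
  assumes F: "smooth_map (prod_manifold M N) P UNIV F"
    and c: "is_chart c" "c \<in> atlas M" and d: "is_chart d" "d \<in> atlas N" and e: "is_chart e" "e \<in> atlas P"
    and p: "p \<in> fst c" "q \<in> fst d" "F (p, q) \<in> fst e"
  shows "smooth_near e (\<lambda>z. F (chart_inv c (fst z), chart_inv d (snd z))) (snd c p, snd d q)"
proof -
  let ?O = "(snd c ` fst c) \<times> (snd d ` fst d)"
  have O: "open ?O" and fe: "open (fst e)" using c d e by (auto simp: is_chart_def intro!: open_Times)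
  have inv: "continuous_on ?O (\<lambda>z. (chart_inv c (fst z), chart_inv d (snd z)))"
    by (rule continuous_on_Pair; rule continuous_on_compose2[OF continuous_on_chart_inv])
      (use c d in \<open>auto intro!: continuous_on_fst continuous_on_snd continuous_on_id\<close>)
  have "continuous_on UNIV F" using F by (simp add: smooth_map_def)
  then have "continuous_on ?O (\<lambda>z. F (chart_inv c (fst z), chart_inv d (snd z)))"
    by (rule continuous_on_compose2[OF _ inv]) simp
  then have U: "open ((\<lambda>z. F (chart_inv c (fst z), chart_inv d (snd z))) -` fst e \<inter> ?O)" (is "open ?U")
    using O fe by (simp add: continuous_on_open_vimage)
  moreover have "smooth_on ?U (\<lambda>z. snd e (F (chart_inv c (fst z), chart_inv d (snd z))))"
  proof (rule smooth_on_cong[OF _ U])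
    have "prod_chart c d \<in> atlas (prod_manifold M N)"
      using c(2) d(2) unfolding prod_manifold_def by (simp del: split_paired_Ex) blast
    then have "smooth_on (snd (prod_chart c d) ` (fst (prod_chart c d) \<inter> UNIV \<inter> F -` fst e)) (snd e \<circ> F \<circ> chart_inv (prod_chart c d))"
      using F e(2) unfolding smooth_map_def by blast
    then show "smooth_on ?U (snd e \<circ> F \<circ> chart_inv (prod_chart c d))"
    proof (rule smooth_on_subset)
      show "?U \<subseteq> snd (prod_chart c d) ` (fst (prod_chart c d) \<inter> UNIV \<inter> F -` fst e)"
        using chart_inv_chart[OF c(1)] chart_inv_chart[OF d(1)]
        by (fastforce simp: prod_chart_def)
    qed
    show "(snd e \<circ> F \<circ> chart_inv (prod_chart c d)) z = snd e (F (chart_inv c (fst z), chart_inv d (snd z)))" if "z \<in> ?U" for z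
      using that prod_chart_inv[OF c(1) d(1)] by (cases z) auto
  qed
  moreover have "(snd c p, snd d q) \<in> ?U"
    using p chart_inv_chart[OF c(1) p(1)] chart_inv_chart[OF d(1) p(2)] by auto
  ultimately show ?thesis unfolding smooth_near_def by (intro exI[of _ ?U]) auto
qed

lemma smooth_on_power_near:
  fixes M :: "('m::t2_space, 'e::locally_convex) manifold" and N :: "('n::t2_space, 'f::locally_convex) manifold"
  assumes F: "smooth_on_power M N n W F" "open W" "depends_below n F"
    and c: "is_chart c" "c \<in> atlas M" and d: "is_chart d" "d \<in> atlas N"
    and p: "p \<in> fst c" "p \<in> W" "F (\<lambda>_. p) \<in> fst d"
  shows "smooth_near d (\<lambda>u. F (\<lambda>i. chart_inv c (u i))) (\<lambda>_. snd c p)"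
proof -
  let ?O = "chart_inv c -` W \<inter> snd c ` fst c"
  have fd: "open (fst d)" using d by (simp add: is_chart_def)
  have "open (snd c ` fst c)" using c by (simp add: is_chart_def)
  then have O: "open ?O"
    using continuous_on_chart_inv[OF c(1)] F(2) by (simp add: continuous_on_open_vimage)
  define T where "T = {u. \<forall>i<n. u i \<in> ?O}"
  have "T = (\<Inter>i\<in>{..<n}. (\<lambda>u. u i) -` ?O)" by (auto simp: T_def)
  moreover have "open (\<Inter>i\<in>{..<n}. (\<lambda>u. u i) -` ?O)"
    by (rule open_INT) (simp, intro ballI open_vimage_coordinate O)
  ultimately have T: "open T" by simp
  \<comment> \<open>Entries from index n on are unconstrained in T, and \<open>chart_inv\<close> is
    continuous only on the coordinate domain; they are therefore replaced by the constant p, which F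
    does not notice.\<close>
  have inv: "continuous_on T (\<lambda>u i. if i < n then chart_inv c (u i) else p)"
  proof (rule continuous_on_coordinatewise_then_product)
    fix i
    show "continuous_on T (\<lambda>u. if i < n then chart_inv c (u i) else p)"
    proof (cases "i < n")
      case True
      have "continuous_on T (\<lambda>u. u i)"
        by (rule continuous_on_subset[OF continuous_on_product_coordinates]) simp
      then have "continuous_on T (\<lambda>u. chart_inv c (u i))"
        by (rule continuous_on_compose2[OF continuous_on_chart_inv[OF c(1)]]) (use True in \<open>auto simp: T_def\<close>)
      then show ?thesis using True by simp
    qed simp
  qed
  have "continuous_on {x. \<forall>i<n. x i \<in> W} F" using F(1) by (simp add: smooth_on_power_def)
  then have "continuous_on T (\<lambda>u. F (\<lambda>i. if i < n then chart_inv c (u i) else p))"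
    by (rule continuous_on_compose2[OF _ inv]) (auto simp: T_def)
  moreover have "F (\<lambda>i. if i < n then chart_inv c (u i) else p) = F (\<lambda>i. chart_inv c (u i))" for u
    using F(3) by (auto simp: depends_below_def)
  ultimately have "continuous_on T (\<lambda>u. F (\<lambda>i. chart_inv c (u i)))" by simp
  then have "open ((\<lambda>u. F (\<lambda>i. chart_inv c (u i))) -` fst d \<inter> T)" (is "open ?U")
    using T fd by (simp add: continuous_on_open_vimage)
  moreover have "smooth_on ?U (\<lambda>u. snd d (F (\<lambda>i. chart_inv c (u i))))"
  proof (rule smooth_on_subset)
    show "smooth_on {u. (\<forall>i<n. u i \<in> snd c ` (fst c \<inter> W)) \<and> F (\<lambda>i. chart_inv c (u i)) \<in> fst d}
       (\<lambda>u. snd d (F (\<lambda>i. chart_inv c (u i))))"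
      using F(1) c(2) d(2) unfolding smooth_on_power_def by (elim conjE allE[of _ "\<lambda>_. c"] allE[of _ d]) simp
    have "x \<in> snd c ` (fst c \<inter> W)" if "x \<in> ?O" for x
      using that chart_chart_inv[of x c] by (intro image_eqI[of _ _ "chart_inv c x"]) auto
    then show "?U \<subseteq> {u. (\<forall>i<n. u i \<in> snd c ` (fst c \<inter> W)) \<and> F (\<lambda>i. chart_inv c (u i)) \<in> fst d}"
      unfolding T_def by blast
  qed
  moreover have "(\<lambda>_. snd c p) \<in> ?U" using p chart_inv_chart[OF c(1) p(1)] by (auto simp: T_def)
  ultimately show ?thesis unfolding smooth_near_def by (intro exI[of _ ?U]) auto
qed

lemma smooth_on_fst: "open U \<Longrightarrow> smooth_on U (fst :: 'e::locally_convex \<times> 'f::locally_convex \<Rightarrow> 'e)"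
  by (rule smooth_on_cont_linear) (auto simp: linear_iff continuous_on_fst continuous_on_id)

lemma smooth_on_snd: "open U \<Longrightarrow> smooth_on U (snd :: 'e::locally_convex \<times> 'f::locally_convex \<Rightarrow> 'f)"
  by (rule smooth_on_cont_linear) (auto simp: linear_iff continuous_on_snd continuous_on_id)

lemma smooth_on_coordinate: "open U \<Longrightarrow> smooth_on U (\<lambda>u::'i \<Rightarrow> 'e::locally_convex. u i)"
  by (rule smooth_on_cont_linear) (auto simp: linear_iff scaleR_fun_def)

lemma smooth_on_id: "open U \<Longrightarrow> smooth_on U (\<lambda>u::'e::locally_convex. u)"
  by (rule smooth_on_cont_linear) (auto simp: linear_iff continuous_on_id)

subsection \<open>The germ of a smooth module at the neutral elements\<close>

definition single :: "nat \<Rightarrow> 'x::zero \<Rightarrow> nat \<Rightarrow> 'x"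
  where "single k v = (\<lambda>i. if i = k then v else 0)"

abbreviation unit :: "nat \<Rightarrow> nat \<Rightarrow> real"
  where "unit k \<equiv> single k 1"

lemma add_scaleR_single: "x + t *\<^sub>R single k v = x(k := x k + t *\<^sub>R v)"
  by (auto simp: single_def scaleR_fun_def fun_eq_iff)

lemma single_linear:
  "single k (a + b) = single k a + single k b" "single k (c *\<^sub>R a) = c *\<^sub>R single k a" "single k 0 = 0"
  by (auto simp: single_def scaleR_fun_def fun_eq_iff)

lemma has_dir_deriv_fun_upd:
  "has_dir_deriv (\<lambda>s. h (t(k := s))) (t k) (1::real) l \<longleftrightarrow> has_dir_deriv h t (unit k) l"
  by (simp add: has_dir_deriv_def add_scaleR_single)

lemma dir_deriv_fun_upd: "dir_deriv (\<lambda>s. h (t(k := s))) (t k) (1::real) = dir_deriv h t (unit k)"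
proof -
  have "has_dir_deriv (\<lambda>s. h (t(k := s))) (t k) (1::real) = has_dir_deriv h t (unit k)"
    by (rule ext) (rule has_dir_deriv_fun_upd)
  then show ?thesis by (simp add: dir_deriv_def)
qed

lemma iter_partial_eq: "iter_partial n h = iter_deriv h (map unit [0..<n])"
proof (induction n arbitrary: h)
  case (Suc n)
  have "partial_deriv n h = iter_deriv h [unit n]"
    by (rule ext) (simp add: partial_deriv_def dir_deriv_fun_upd)
  then show ?case by (simp add: Suc iter_deriv_append)
qed simp

text \<open>Slot k depends on the single parameter \<open>t (\<kappa> k)\<close>, and each parameter
  is differentiated at most once. The velocity in one slot is thus constant under variation of the
  others, so no second derivatives of the curves appear.\<close>

lemma iter_deriv_slots:
  fixes f :: "(nat \<Rightarrow> 'e::locally_convex) \<Rightarrow> 'f::locally_convex" and y :: "nat \<Rightarrow> real \<Rightarrow> 'e"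
  assumes f: "smooth_on W f" "open W" and y: "\<And>k. k < n \<Longrightarrow> smooth_on (I k) (y k)"
    and \<kappa>: "inj_on \<kappa> {..<n}"
    and Y: "\<And>t. Y t = (\<lambda>k. if k < n then y k (t (\<kappa> k)) else b k)"
    and U: "open U" "\<And>t. t \<in> U \<Longrightarrow> Y t \<in> W" "\<And>t k. t \<in> U \<Longrightarrow> k < n \<Longrightarrow> t (\<kappa> k) \<in> I k"
    and ks: "distinct ks" "set ks \<subseteq> {..<n}" and t: "t \<in> U"
  shows "iter_deriv (\<lambda>t. f (Y t)) (map (\<lambda>k. unit (\<kappa> k)) ks) t
    = iter_deriv f (map (\<lambda>k. single k (iter_deriv (y k) [1] (t (\<kappa> k)))) ks) (Y t)"
  using ks t
proof (induction ks arbitrary: t)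
  case (Cons k ks)
  let ?v = "\<lambda>t k. single k (iter_deriv (y k) [1] (t (\<kappa> k)))"
  have k: "k < n" "k \<notin> set ks" "set ks \<subseteq> {..<n}" "distinct ks" using Cons.prems by auto
  have neq: "\<kappa> k' \<noteq> \<kappa> k" if "k' < n" "k' \<noteq> k" for k'
    using inj_onD[OF \<kappa>, of k' k] k(1) that by auto
  have "has_dir_deriv Y t (unit (\<kappa> k)) (?v t k)"
  proof (rule has_dir_deriv_fun)
    fix i
    consider "i = k" | "i \<noteq> k" "i < n" | "\<not> i < n" by blast
    then show "has_dir_deriv (\<lambda>t. Y t i) t (unit (\<kappa> k)) (?v t k i)"
    proof cases
      case 1
      have "has_dir_deriv (iter_deriv (y k) []) (t (\<kappa> k)) 1 (iter_deriv (y k) [1] (t (\<kappa> k)))"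
        by (rule smooth_on_deriv[OF y[OF k(1)] U(3)[OF Cons.prems(3) k(1)]])
      then show ?thesis
        using k(1) 1 unfolding Y by (simp add: has_dir_deriv_def single_def scaleR_fun_def)
    next
      case 2
      then show ?thesis unfolding Y using neq[OF 2(2,1)]
        by (simp add: has_dir_deriv_def single_def scaleR_fun_def)
    next
      case 3
      then show ?thesis unfolding Y using k(1) by (auto simp: has_dir_deriv_def single_def)
    qed
  qed
  then have "has_dir_deriv (\<lambda>s. iter_deriv f (map (?v t) ks) (Y s)) t (unit (\<kappa> k))
      (iter_deriv f (map (?v t) (k # ks)) (Y t))"
    unfolding list.map using iter_deriv_chain[OF f, of Y t] U(2)[OF Cons.prems(3)] by blast
  moreover have "eventually (\<lambda>s::real. iter_deriv (\<lambda>t. f (Y t)) (map (\<lambda>k. unit (\<kappa> k)) ks) (t + s *\<^sub>R unit (\<kappa> k))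
      = iter_deriv f (map (?v t) ks) (Y (t + s *\<^sub>R unit (\<kappa> k)))) (at 0)"
    using eventually_line[OF U(1) Cons.prems(3), of "unit (\<kappa> k)"]
  proof eventually_elim
    case (elim s)
    have "map (?v (t + s *\<^sub>R unit (\<kappa> k))) ks = map (?v t) ks"
      using k(2,3) neq by (intro map_cong refl) (auto simp: add_scaleR_single)
    then show ?case by (simp only: Cons.IH[OF k(4,3) elim])
  qed
  ultimately have "has_dir_deriv (iter_deriv (\<lambda>t. f (Y t)) (map (\<lambda>k. unit (\<kappa> k)) ks)) t (unit (\<kappa> k))
      (iter_deriv f (map (?v t) (k # ks)) (Y t))"
    using has_dir_deriv_cong[where f = "iter_deriv (\<lambda>t. f (Y t)) (map (\<lambda>k. unit (\<kappa> k)) ks)"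
        and g = "\<lambda>s. iter_deriv f (map (?v t) ks) (Y s)"]
      Cons.IH[OF k(4,3) Cons.prems(3)] by blast
  then show ?case by (simp add: dir_derivI)
qed simp

locale lie_module =
  fixes G :: "('g::{group_mult,t2_space}, 'e::locally_convex) manifold"
    and A :: "('a::{ab_group_add,t2_space}, 'b::locally_convex) manifold"
    and act :: "'g \<Rightarrow> 'a \<Rightarrow> 'a"
  assumes lie_group: "lie_group G" and smooth_module: "smooth_module G A act"
begin

abbreviation gch :: "('g, 'e) chart" where "gch \<equiv> chart_at G 1"
abbreviation ach :: "('a, 'b) chart" where "ach \<equiv> chart_at A 0"
definition e\<^sub>0 :: 'e where "e\<^sub>0 = snd gch 1"
definition b\<^sub>0 :: 'b where "b\<^sub>0 = snd ach 0"

lemma gch: "is_chart gch" "gch \<in> atlas G" "1 \<in> fst gch"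
  using lie_group unfolding lie_group_def smooth_manifold_def by blast+

lemma ach: "is_chart ach" "ach \<in> atlas A" "0 \<in> fst ach"
  using smooth_module unfolding smooth_module_def abelian_lie_group_def smooth_manifold_def by blast+

lemma act_simps: "act 1 a = a" "act (g * h) a = act g (act h a)" "act g (a + b) = act g a + act g b"
  using smooth_module unfolding smooth_module_def by blast+

lemma act_0: "act g 0 = 0"
  using act_simps(3)[of g 0 0] by simp

lemma inverse_1: "inverse (1::'g) = 1"
  using group_mult_left_inverse[of "1::'g"] by simp

text \<open>Germs with value at the neutral element. There all structure maps are smooth in the
  preferred charts at 1 and 0, so these germs are closed under the group operations and the action
  without change of charts.\<close>

definition germ\<^sub>G :: "('p::locally_convex \<Rightarrow> 'g) \<Rightarrow> 'p \<Rightarrow> bool"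
  where "germ\<^sub>G h p \<longleftrightarrow> h p = 1 \<and> smooth_near gch h p"

definition germ\<^sub>A :: "('p::locally_convex \<Rightarrow> 'a) \<Rightarrow> 'p \<Rightarrow> bool"
  where "germ\<^sub>A h p \<longleftrightarrow> h p = 0 \<and> smooth_near ach h p"

lemma germ\<^sub>GE:
  assumes "germ\<^sub>G h p"
  obtains V where "open V" "p \<in> V" "\<And>x. x \<in> V \<Longrightarrow> h x \<in> fst gch" "smooth_on V (\<lambda>x. snd gch (h x))" "h p = 1"
  using assms unfolding germ\<^sub>G_def smooth_near_def by blast

lemma germ\<^sub>AE:
  assumes "germ\<^sub>A h p"
  obtains V where "open V" "p \<in> V" "\<And>x. x \<in> V \<Longrightarrow> h x \<in> fst ach" "smooth_on V (\<lambda>x. snd ach (h x))" "h p = 0"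
  using assms unfolding germ\<^sub>A_def smooth_near_def by blast

lemma germ\<^sub>A_cong:
  "germ\<^sub>A h p \<Longrightarrow> open V \<Longrightarrow> p \<in> V \<Longrightarrow> (\<And>x. x \<in> V \<Longrightarrow> h x = h' x) \<Longrightarrow> germ\<^sub>A h' p"
  unfolding germ\<^sub>A_def using smooth_near_cong by metis

lemma germ\<^sub>G_compose:
  "germ\<^sub>G h x \<Longrightarrow> smooth_on V g \<Longrightarrow> open V \<Longrightarrow> p \<in> V \<Longrightarrow> g p = x \<Longrightarrow> germ\<^sub>G (\<lambda>p. h (g p)) p"
  unfolding germ\<^sub>G_def using smooth_near_compose by blast

lemma germ\<^sub>A_compose:
  "germ\<^sub>A h x \<Longrightarrow> smooth_on V g \<Longrightarrow> open V \<Longrightarrow> p \<in> V \<Longrightarrow> g p = x \<Longrightarrow> germ\<^sub>A (\<lambda>p. h (g p)) p"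
  unfolding germ\<^sub>A_def using smooth_near_compose by blast

lemma germ\<^sub>A_0: "germ\<^sub>A (\<lambda>_. 0) p"
  unfolding germ\<^sub>A_def smooth_near_def using ach(3) by (auto intro!: exI[of _ UNIV] smooth_on_const)

lemma near_mult: "smooth_near gch (\<lambda>z. chart_inv gch (fst z) * chart_inv gch (snd z)) (e\<^sub>0, e\<^sub>0)"
  using smooth_map_prod_near[of G G G "\<lambda>(g, h). g * h", OF _ gch(1,2) gch(1,2) gch(1,2) gch(3,3)] lie_group gch(3)
  unfolding lie_group_def e\<^sub>0_def by simp

lemma near_inverse: "smooth_near gch (\<lambda>x. inverse (chart_inv gch x)) e\<^sub>0"
  using smooth_map_near[of G G UNIV inverse, OF _ _ gch(1,2) gch(1,2) gch(3)] lie_group gch(3)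
  unfolding lie_group_def e\<^sub>0_def by (simp add: inverse_1)

lemma near_add: "smooth_near ach (\<lambda>z. chart_inv ach (fst z) + chart_inv ach (snd z)) (b\<^sub>0, b\<^sub>0)"
  using smooth_map_prod_near[of A A A "\<lambda>(g, h). g + h", OF _ ach(1,2) ach(1,2) ach(1,2) ach(3,3)] smooth_module ach(3)
  unfolding smooth_module_def abelian_lie_group_def b\<^sub>0_def by simp

lemma near_uminus: "smooth_near ach (\<lambda>x. - chart_inv ach x) b\<^sub>0"
  using smooth_map_near[of A A UNIV uminus, OF _ _ ach(1,2) ach(1,2) ach(3)] smooth_module ach(3)
  unfolding smooth_module_def abelian_lie_group_def b\<^sub>0_def by simp

lemma near_act: "smooth_near ach (\<lambda>z. act (chart_inv gch (fst z)) (chart_inv ach (snd z))) (e\<^sub>0, b\<^sub>0)"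
  using smooth_map_prod_near[of G A A "\<lambda>(g, a). act g a", OF _ gch(1,2) ach(1,2) ach(1,2) gch(3) ach(3)] smooth_module ach(3)
  unfolding smooth_module_def e\<^sub>0_def b\<^sub>0_def by (simp add: act_simps)

lemma chart_inv_e\<^sub>0: "chart_inv gch e\<^sub>0 = 1" and chart_inv_b\<^sub>0: "chart_inv ach b\<^sub>0 = 0"
  unfolding e\<^sub>0_def b\<^sub>0_def using chart_inv_chart[OF gch(1,3)] chart_inv_chart[OF ach(1,3)] by simp_all

lemma germ\<^sub>G_chart_inv: "germ\<^sub>G (chart_inv gch) e\<^sub>0"
  unfolding germ\<^sub>G_def using smooth_near_chart_inv[OF gch(1,3)] chart_inv_e\<^sub>0 by (simp add: e\<^sub>0_def)

lemma germ\<^sub>G_mult: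
  assumes "germ\<^sub>G h p" "germ\<^sub>G k p"
  shows "germ\<^sub>G (\<lambda>x. h x * k x) p"
proof -
  from assms(1) obtain V where V: "open V" "p \<in> V" "\<And>x. x \<in> V \<Longrightarrow> h x \<in> fst gch" "smooth_on V (\<lambda>x. snd gch (h x))" "h p = 1"
    by (rule germ\<^sub>GE) blast
  from assms(2) obtain W where W: "open W" "p \<in> W" "\<And>x. x \<in> W \<Longrightarrow> k x \<in> fst gch" "smooth_on W (\<lambda>x. snd gch (k x))" "k p = 1"
    by (rule germ\<^sub>GE) blast
  have VW: "open (V \<inter> W)" "p \<in> V \<inter> W" using V W by auto
  have "smooth_on (V \<inter> W) (\<lambda>x. (snd gch (h x), snd gch (k x)))"
    by (rule smooth_on_Pair(1)[OF smooth_on_subset[OF V(4)] smooth_on_subset[OF W(4)] VW(1)]) auto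
  from smooth_near_compose[OF near_mult this VW]
  have "smooth_near gch (\<lambda>x. chart_inv gch (snd gch (h x)) * chart_inv gch (snd gch (k x))) p"
    using V(5) W(5) by (simp add: e\<^sub>0_def)
  then have "smooth_near gch (\<lambda>x. h x * k x) p"
    by (rule smooth_near_cong[OF _ VW]) (use V(3) W(3) in \<open>simp add: chart_inv_chart[OF gch(1)]\<close>)
  then show ?thesis using V(5) W(5) by (simp add: germ\<^sub>G_def)
qed

lemma germ\<^sub>A_add:
  assumes "germ\<^sub>A h p" "germ\<^sub>A k p"
  shows "germ\<^sub>A (\<lambda>x. h x + k x) p"
proof -
  from assms(1) obtain V where V: "open V" "p \<in> V" "\<And>x. x \<in> V \<Longrightarrow> h x \<in> fst ach" "smooth_on V (\<lambda>x. snd ach (h x))" "h p = 0"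
    by (rule germ\<^sub>AE) blast
  from assms(2) obtain W where W: "open W" "p \<in> W" "\<And>x. x \<in> W \<Longrightarrow> k x \<in> fst ach" "smooth_on W (\<lambda>x. snd ach (k x))" "k p = 0"
    by (rule germ\<^sub>AE) blast
  have VW: "open (V \<inter> W)" "p \<in> V \<inter> W" using V W by auto
  have "smooth_on (V \<inter> W) (\<lambda>x. (snd ach (h x), snd ach (k x)))"
    by (rule smooth_on_Pair(1)[OF smooth_on_subset[OF V(4)] smooth_on_subset[OF W(4)] VW(1)]) auto
  from smooth_near_compose[OF near_add this VW]
  have "smooth_near ach (\<lambda>x. chart_inv ach (snd ach (h x)) + chart_inv ach (snd ach (k x))) p"
    using V(5) W(5) by (simp add: b\<^sub>0_def)
  then have "smooth_near ach (\<lambda>x. h x + k x) p"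
    by (rule smooth_near_cong[OF _ VW]) (use V(3) W(3) in \<open>simp add: chart_inv_chart[OF ach(1)]\<close>)
  then show ?thesis using V(5) W(5) by (simp add: germ\<^sub>A_def)
qed

lemma germ\<^sub>A_act:
  assumes "germ\<^sub>G h p" "germ\<^sub>A k p"
  shows "germ\<^sub>A (\<lambda>x. act (h x) (k x)) p"
proof -
  from assms(1) obtain V where V: "open V" "p \<in> V" "\<And>x. x \<in> V \<Longrightarrow> h x \<in> fst gch" "smooth_on V (\<lambda>x. snd gch (h x))" "h p = 1"
    by (rule germ\<^sub>GE) blast
  from assms(2) obtain W where W: "open W" "p \<in> W" "\<And>x. x \<in> W \<Longrightarrow> k x \<in> fst ach" "smooth_on W (\<lambda>x. snd ach (k x))" "k p = 0"
    by (rule germ\<^sub>AE) blast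
  have VW: "open (V \<inter> W)" "p \<in> V \<inter> W" using V W by auto
  have "smooth_on (V \<inter> W) (\<lambda>x. (snd gch (h x), snd ach (k x)))"
    by (rule smooth_on_Pair(1)[OF smooth_on_subset[OF V(4)] smooth_on_subset[OF W(4)] VW(1)]) auto
  from smooth_near_compose[OF near_act this VW]
  have "smooth_near ach (\<lambda>x. act (chart_inv gch (snd gch (h x))) (chart_inv ach (snd ach (k x)))) p"
    using V(5) W(5) by (simp add: b\<^sub>0_def e\<^sub>0_def)
  then have "smooth_near ach (\<lambda>x. act (h x) (k x)) p"
    by (rule smooth_near_cong[OF _ VW])
      (use V(3) W(3) in \<open>simp add: chart_inv_chart[OF ach(1)] chart_inv_chart[OF gch(1)]\<close>)
  then show ?thesis using V(5) W(5) by (simp add: germ\<^sub>A_def act_0)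
qed

lemma germ\<^sub>G_inverse:
  assumes "germ\<^sub>G h p"
  shows "germ\<^sub>G (\<lambda>x. inverse (h x)) p"
proof -
  from assms obtain V where V: "open V" "p \<in> V" "\<And>x. x \<in> V \<Longrightarrow> h x \<in> fst gch" "smooth_on V (\<lambda>x. snd gch (h x))" "h p = 1"
    by (rule germ\<^sub>GE) blast
  from smooth_near_compose[OF near_inverse V(4,1,2)]
  have "smooth_near gch (\<lambda>x. inverse (chart_inv gch (snd gch (h x)))) p"
    using V(5) by (simp add: e\<^sub>0_def)
  then have "smooth_near gch (\<lambda>x. inverse (h x)) p"
    by (rule smooth_near_cong[OF _ V(1,2)]) (use V(3) in \<open>simp add: chart_inv_chart[OF gch(1)]\<close>)
  then show ?thesis using V(5) by (simp add: germ\<^sub>G_def inverse_1)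
qed

lemma germ\<^sub>A_uminus:
  assumes "germ\<^sub>A h p"
  shows "germ\<^sub>A (\<lambda>x. - h x) p"
proof -
  from assms obtain V where V: "open V" "p \<in> V" "\<And>x. x \<in> V \<Longrightarrow> h x \<in> fst ach" "smooth_on V (\<lambda>x. snd ach (h x))" "h p = 0"
    by (rule germ\<^sub>AE) blast
  from smooth_near_compose[OF near_uminus V(4,1,2)]
  have "smooth_near ach (\<lambda>x. - (chart_inv ach (snd ach (h x)))) p"
    using V(5) by (simp add: b\<^sub>0_def)
  then have "smooth_near ach (\<lambda>x. - h x) p"
    by (rule smooth_near_cong[OF _ V(1,2)]) (use V(3) in \<open>simp add: chart_inv_chart[OF ach(1)]\<close>)
  then show ?thesis using V(5) by (simp add: germ\<^sub>A_def)
qed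

lemma germ\<^sub>A_diff: "germ\<^sub>A h p \<Longrightarrow> germ\<^sub>A k p \<Longrightarrow> germ\<^sub>A (\<lambda>x. h x - k x) p"
  using germ\<^sub>A_add[OF _ germ\<^sub>A_uminus, of h p k] by simp

lemma germ\<^sub>A_sum: "(\<And>i. i \<in> I \<Longrightarrow> germ\<^sub>A (h i) p) \<Longrightarrow> germ\<^sub>A (\<lambda>x. \<Sum>i\<in>I. h i x) p"
  by (induction I rule: infinite_finite_induct) (simp_all add: germ\<^sub>A_0 germ\<^sub>A_add)

lemma germ\<^sub>A_alt_sign: "germ\<^sub>A h p \<Longrightarrow> germ\<^sub>A (\<lambda>x. alt_sign k (h x)) p"
  unfolding alt_sign_def by (cases "even k") (simp_all add: germ\<^sub>A_uminus)

text \<open>Unlike \<open>group_cochains\<close>, this asks for smoothness only in the preferred charts at \<open>1\<close> and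
  \<open>0\<close>, and is therefore easily seen to be preserved by \<open>group_diff\<close>.\<close>

definition loc_cochains :: "nat \<Rightarrow> ((nat \<Rightarrow> 'g) \<Rightarrow> 'a) set"
  where "loc_cochains n = {f. depends_below n f \<and> (\<forall>g. (\<exists>i<n. g i = 1) \<longrightarrow> f g = 0) \<and>
    germ\<^sub>A (\<lambda>u. f (\<lambda>i. chart_inv gch (u i))) (\<lambda>_. e\<^sub>0)}"

text \<open>For n > 0 normalisation forces f(1,...,1) = 0, so near that point f takes values in the
  chart of A at 0. A 0-cochain is an arbitrary element of A and may lie outside this chart.\<close>

lemma group_cochains_subset:
  assumes "n > 0"
  shows "group_cochains G A n \<subseteq> loc_cochains n"
proof
  fix f assume f: "f \<in> group_cochains G A n"
  then obtain W where W: "open W" "1 \<in> W" "smooth_on_power G A n W f" unfolding group_cochains_def by blast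
  have dep: "depends_below n f" and norm: "\<forall>g. (\<exists>i<n. g i = 1) \<longrightarrow> f g = 0"
    using f unfolding group_cochains_def by blast+
  have 0: "f (\<lambda>_. 1) = 0" using norm assms by auto
  have "smooth_near ach (\<lambda>u. f (\<lambda>i. chart_inv gch (u i))) (\<lambda>_. e\<^sub>0)"
    unfolding e\<^sub>0_def
    by (rule smooth_on_power_near[OF W(3,1) dep gch(1,2) ach(1,2) gch(3) W(2)]) (simp add: 0 ach)
  then show "f \<in> loc_cochains n"
    unfolding loc_cochains_def germ\<^sub>A_def using dep norm 0 by (simp add: chart_inv_e\<^sub>0)
qed

lemma germ\<^sub>A_cochain:
  assumes f: "f \<in> loc_cochains n" and h: "\<And>i. i < n \<Longrightarrow> germ\<^sub>G (h i) p"
  shows "germ\<^sub>A (\<lambda>x. f (\<lambda>i. h i x)) p"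
proof -
  have dep: "depends_below n f" and f': "germ\<^sub>A (\<lambda>u. f (\<lambda>i. chart_inv gch (u i))) (\<lambda>_. e\<^sub>0)"
    using f unfolding loc_cochains_def by blast+
  let ?P = "\<lambda>i V. i < n \<longrightarrow> open V \<and> p \<in> V \<and> (\<forall>x\<in>V. h i x \<in> fst gch) \<and> smooth_on V (\<lambda>x. snd gch (h i x))"
  have "\<forall>i. \<exists>V. ?P i V"
    using h unfolding germ\<^sub>G_def smooth_near_def by simp
  then have "\<exists>V. \<forall>i. ?P i (V i)" by (rule choice)
  then obtain V where V': "\<forall>i. ?P i (V i)" by (elim exE)
  have V: "\<And>i. i < n \<Longrightarrow> open (V i)" "\<And>i. i < n \<Longrightarrow> p \<in> V i"
      "\<And>i x. i < n \<Longrightarrow> x \<in> V i \<Longrightarrow> h i x \<in> fst gch" "\<And>i. i < n \<Longrightarrow> smooth_on (V i) (\<lambda>x. snd gch (h i x))"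
    using V' by simp_all
  have V5: "\<And>i. i < n \<Longrightarrow> h i p = 1" using h unfolding germ\<^sub>G_def by simp
  define U where "U = (\<Inter>i\<in>{..<n}. V i)"
  have U: "open U" "p \<in> U" unfolding U_def using V(1,2) by (auto intro!: open_INT)
  define g where "g = (\<lambda>x i. if i < n then snd gch (h i x) else e\<^sub>0)"
  have "smooth_on U g"
  proof (rule smooth_on_fun(1)[OF _ U(1)])
    fix i
    show "smooth_on U (\<lambda>x. g x i)"
      unfolding g_def
      by (cases "i < n") (auto simp: U_def intro: smooth_on_subset[OF V(4)] smooth_on_const[OF U(1), unfolded U_def])
  qed
  moreover have "g p = (\<lambda>_. e\<^sub>0)" using V5 by (auto simp: g_def e\<^sub>0_def)
  ultimately have "germ\<^sub>A (\<lambda>x. f (\<lambda>i. chart_inv gch (g x i))) p"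
    by (intro germ\<^sub>A_compose[OF f' _ U])
  then show ?thesis
  proof (rule germ\<^sub>A_cong[OF _ U])
    fix x assume "x \<in> U"
    then show "f (\<lambda>i. chart_inv gch (g x i)) = f (\<lambda>i. h i x)"
      using dep V(3) unfolding depends_below_def
      by (auto simp: g_def U_def chart_inv_chart[OF gch(1)])
  qed
qed

end

subsection \<open>Mixed derivatives\<close>

lemma linear_fun_upd_0: "linear (\<lambda>t::nat \<Rightarrow> real. t(k := 0))"
  by (auto simp: linear_iff scaleR_fun_def fun_eq_iff)

lemma continuous_on_reindex:
  "continuous_on UNIV (\<lambda>t::'i \<Rightarrow> 'e::locally_convex. (\<lambda>i. if P i then t (\<kappa> i) else 0))"
proof (rule continuous_on_coordinatewise_then_product)
  fix i show "continuous_on UNIV (\<lambda>t::'i \<Rightarrow> 'e. if P i then t (\<kappa> i) else 0)" by (cases "P i") simp_all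
qed

lemma linear_reindex:
  "linear (\<lambda>t::'i \<Rightarrow> 'e::locally_convex. (\<lambda>i. if P i then t (\<kappa> i) else 0))"
  by (auto simp: linear_iff scaleR_fun_def fun_eq_iff)

lemma smooth_on_reindex:
  "smooth_on UNIV (\<lambda>t::'i \<Rightarrow> 'e::locally_convex. (\<lambda>i. if P i then t (\<kappa> i) else 0))"
  by (rule smooth_on_cont_linear[OF linear_reindex continuous_on_reindex open_UNIV])

lemma smooth_on_fun_upd_0: "smooth_on UNIV (\<lambda>t::nat \<Rightarrow> real. t(k := 0))"
proof -
  have "(\<lambda>t::nat \<Rightarrow> real. t(k := 0)) = (\<lambda>t i. if i \<noteq> k then t i else 0)" by (auto simp: fun_eq_iff)
  then show ?thesis using smooth_on_reindex[of "\<lambda>i. i \<noteq> k" "\<lambda>i. i"] by simp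
qed

lemma iter_deriv_const: "hs \<noteq> [] \<Longrightarrow> iter_deriv (\<lambda>_. c::'f::locally_convex) hs x = 0"
proof (induction hs arbitrary: x)
  case (Cons h hs)
  then have "iter_deriv (\<lambda>_. c) hs = (\<lambda>_. if hs = [] then c else 0)" by (cases "hs = []") auto
  then show ?case by (simp add: dir_derivI[OF has_dir_deriv_const])
qed simp

lemma zero_fun_apply: "(0 :: 'i \<Rightarrow> 'x::zero) i = 0" by simp

text \<open>Composition with the projection t(k := 0) leaves F unchanged and turns the direction
  \<open>unit k\<close> into 0.\<close>

lemma iter_deriv_indep:
  fixes F :: "(nat \<Rightarrow> real) \<Rightarrow> 'f::locally_convex"
  assumes "\<And>t. F (t(k := 0)) = F t" "unit k \<in> set hs"
  shows "iter_deriv F hs t = 0"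
proof -
  have "iter_deriv F hs t = iter_deriv (\<lambda>t. F (t(k := 0))) hs t" using assms(1) by simp
  also have "\<dots> = iter_deriv F (map (\<lambda>t. t(k := 0)) hs) (t(k := 0))"
    by (rule iter_deriv_linear_comp[OF linear_fun_upd_0])
  also have "\<dots> = 0"
  proof (rule iter_deriv_zero_dir)
    have "(unit k)(k := 0) = 0" by (auto simp: single_def)
    then show "0 \<in> set (map (\<lambda>t. t(k := 0)) hs)" using assms(2) by (metis (no_types) image_eqI set_map)
  qed
  finally show ?thesis .
qed

text \<open>Permuting the coordinates permutes the unit directions, and by symmetry of iterated
  derivatives their order is immaterial.\<close>

lemma iter_deriv_transpose:
  fixes F :: "(nat \<Rightarrow> real) \<Rightarrow> 'f::locally_convex"
  assumes F: "smooth_on U F" "open U" "0 \<in> U" and i: "i < n" "j < n"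
  shows "iter_deriv (\<lambda>t. F (t \<circ> Transposition.transpose i j)) (map unit [0..<n]) 0 = iter_deriv F (map unit [0..<n]) 0"
proof -
  let ?\<tau> = "Transposition.transpose i j"
  have lin: "linear (\<lambda>t::nat \<Rightarrow> real. t \<circ> ?\<tau>)"
    by (auto simp: linear_iff scaleR_fun_def fun_eq_iff)
  have "(?\<tau> x = k) = (x = ?\<tau> k)" for x k
    using transpose_involutory[of i j x] transpose_involutory[of i j k] by metis
  then have "unit k \<circ> ?\<tau> = unit (?\<tau> k)" for k
    by (simp add: single_def fun_eq_iff)
  then have eq: "map (\<lambda>t. t \<circ> ?\<tau>) (map unit [0..<n]) = map unit (map ?\<tau> [0..<n])" by simp
  have perm: "?\<tau> permutes {0..<n}" using i by (intro permutes_swap_id) auto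
  have "mset (map ?\<tau> [0..<n]) = mset [0..<n]"
  proof (rule set_eq_iff_mset_eq_distinct[THEN iffD1])
    show "distinct (map ?\<tau> [0..<n])" by (simp add: distinct_map)
    show "set (map ?\<tau> [0..<n]) = set [0..<n]" using permutes_image[OF perm] by simp
  qed simp
  then have ms: "mset (map unit (map ?\<tau> [0..<n])) = mset (map unit [0..<n])" by (simp only: mset_map[of unit])
  have "iter_deriv (\<lambda>t. F (t \<circ> ?\<tau>)) (map unit [0..<n]) 0 = iter_deriv F (map (\<lambda>t. t \<circ> ?\<tau>) (map unit [0..<n])) (0 \<circ> ?\<tau>)"
    by (rule iter_deriv_linear_comp[OF lin])
  also have "0 \<circ> ?\<tau> = 0" by (simp add: fun_eq_iff)
  finally show ?thesis unfolding eq iter_deriv_perm[OF F ms] .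
qed

section \<open>Derivatives of cochains along curves\<close>

context lie_module
begin

definition velocity :: "(real \<Rightarrow> 'g) \<Rightarrow> 'e \<Rightarrow> bool"
  where "velocity \<gamma> v \<longleftrightarrow> germ\<^sub>G \<gamma> 0 \<and> has_dir_deriv (\<lambda>s. snd gch (\<gamma> s)) 0 1 v"

text \<open>The multilinear map T: slot i is differentiated once, in the direction v i, in the
  charts at 1 and 0. The alternation of T is the image of f under D_n.\<close>

definition cochain_deriv :: "nat \<Rightarrow> ((nat \<Rightarrow> 'g) \<Rightarrow> 'a) \<Rightarrow> (nat \<Rightarrow> 'e) \<Rightarrow> 'b"
  where "cochain_deriv n f v = iter_deriv (\<lambda>u. snd ach (f (\<lambda>i. chart_inv gch (u i))))
    (map (\<lambda>i. single i (v i)) [0..<n]) (\<lambda>_. e\<^sub>0)"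

lemma germ\<^sub>G_coordinate:
  assumes "germ\<^sub>G \<gamma> (0::real)"
  shows "germ\<^sub>G (\<lambda>t::nat \<Rightarrow> real. \<gamma> (t k)) 0"
  by (rule germ\<^sub>G_compose[OF assms smooth_on_coordinate[OF open_UNIV]]) simp_all

lemma germ\<^sub>A_fun_upd_0:
  assumes "germ\<^sub>A h (0 :: nat \<Rightarrow> real)"
  shows "germ\<^sub>A (\<lambda>t. h (t(k := 0))) 0"
  by (rule germ\<^sub>A_compose[OF assms smooth_on_fun_upd_0]) (simp_all add: fun_eq_iff)

text \<open>Each slot contributes only the initial velocity of its curve, which is why \<tau> does
  not depend on the choice of curves. The injection \<kappa> allows slots and parameters to be
  numbered differently, as happens for the terms of the group differential, where a cochain of n
  arguments meets n + 1 parameters.\<close>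

lemma cochain_deriv_curves:
  assumes f: "f \<in> loc_cochains n" and \<kappa>: "inj_on \<kappa> {..<n}" and \<gamma>: "\<And>k. k < n \<Longrightarrow> velocity (\<gamma> k) (v k)"
  shows "iter_deriv (\<lambda>t. snd ach (f (\<lambda>k. \<gamma> k (t (\<kappa> k))))) (map (\<lambda>k. unit (\<kappa> k)) [0..<n]) 0 = cochain_deriv n f v"
proof -
  have dep: "depends_below n f" and f': "germ\<^sub>A (\<lambda>u. f (\<lambda>i. chart_inv gch (u i))) (\<lambda>_. e\<^sub>0)"
    using f unfolding loc_cochains_def by blast+
  let ?F = "\<lambda>u. snd ach (f (\<lambda>i. chart_inv gch (u i)))"
  from f' obtain W where W: "open W" "(\<lambda>_. e\<^sub>0) \<in> W" "smooth_on W ?F" by (rule germ\<^sub>AE) blast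
  let ?P = "\<lambda>i V. i < n \<longrightarrow> open V \<and> 0 \<in> V \<and> (\<forall>x\<in>V. \<gamma> i x \<in> fst gch) \<and> smooth_on V (\<lambda>x. snd gch (\<gamma> i x))"
  have "\<forall>i. \<exists>V. ?P i V"
    using \<gamma> unfolding velocity_def germ\<^sub>G_def smooth_near_def by simp
  then have "\<exists>V. \<forall>i. ?P i (V i)" by (rule choice)
  then obtain I where I': "\<forall>i. ?P i (I i)" by (elim exE)
  have I: "\<And>i. i < n \<Longrightarrow> open (I i)" "\<And>i. i < n \<Longrightarrow> 0 \<in> I i"
      "\<And>i x. i < n \<Longrightarrow> x \<in> I i \<Longrightarrow> \<gamma> i x \<in> fst gch" "\<And>i. i < n \<Longrightarrow> smooth_on (I i) (\<lambda>x. snd gch (\<gamma> i x))"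
    using I' by simp_all
  define Y where "Y = (\<lambda>(t::nat \<Rightarrow> real) k. if k < n then snd gch (\<gamma> k (t (\<kappa> k))) else e\<^sub>0)"
  define T where "T = (\<Inter>k\<in>{..<n}. (\<lambda>t::nat \<Rightarrow> real. t (\<kappa> k)) -` I k)"
  have T: "open T"
    unfolding T_def by (rule open_INT) (simp, intro ballI open_vimage_coordinate I(1), simp)
  have Y: "smooth_on T Y"
  proof (rule smooth_on_fun(1)[OF _ T])
    fix k
    show "smooth_on T (\<lambda>t. Y t k)"
    proof (cases "k < n")
      case True
      have "smooth_on T (\<lambda>t. snd gch (\<gamma> k (t (\<kappa> k))))"
        by (rule smooth_on_compose[OF I(4,1)[OF True] smooth_on_coordinate[OF T] T]) (use True in \<open>simp add: T_def\<close>)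
      then show ?thesis using True by (simp add: Y_def)
    qed (simp add: Y_def smooth_on_const T)
  qed
  let ?U = "Y -` W \<inter> T"
  have U: "open ?U"
    using smooth_on_imp_continuous_on[OF Y T] T W(1) by (simp add: continuous_on_open_vimage)
  have Y0: "Y 0 = (\<lambda>_. e\<^sub>0)"
    using \<gamma> by (auto simp: Y_def velocity_def germ\<^sub>G_def e\<^sub>0_def)
  have U0: "0 \<in> ?U" using Y0 W(2) I(2) by (simp add: T_def)
  have vel: "iter_deriv (\<lambda>s. snd gch (\<gamma> k s)) [1] 0 = v k" if "k < n" for k
    using \<gamma>[OF that] unfolding velocity_def by (simp add: dir_derivI)
  have "iter_deriv (\<lambda>t. snd ach (f (\<lambda>k. \<gamma> k (t (\<kappa> k))))) (map (\<lambda>k. unit (\<kappa> k)) [0..<n]) 0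
      = iter_deriv (\<lambda>t. ?F (Y t)) (map (\<lambda>k. unit (\<kappa> k)) [0..<n]) 0"
  proof (rule iter_deriv_cong[OF U _ U0])
    fix t assume "t \<in> ?U"
    then have "f (\<lambda>k. \<gamma> k (t (\<kappa> k))) = f (\<lambda>i. chart_inv gch (Y t i))"
      using dep I(3) unfolding depends_below_def
      by (auto simp: Y_def T_def chart_inv_chart[OF gch(1)])
    then show "snd ach (f (\<lambda>k. \<gamma> k (t (\<kappa> k)))) = ?F (Y t)" by simp
  qed
  also have "\<dots> = iter_deriv ?F (map (\<lambda>k. single k (iter_deriv (\<lambda>s. snd gch (\<gamma> k s)) [1] ((0::nat \<Rightarrow> real) (\<kappa> k)))) [0..<n]) (Y 0)"
    by (rule iter_deriv_slots[OF W(3,1) I(4) \<kappa> _ U _ _ _ _ U0, where b = "\<lambda>_. e\<^sub>0"]) (auto simp: Y_def T_def)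
  also have "\<dots> = cochain_deriv n f v"
    unfolding Y0 zero_fun_apply cochain_deriv_def
    by (rule arg_cong[where f = "\<lambda>l. iter_deriv ?F l (\<lambda>_. e\<^sub>0)"]) (simp add: vel del: iter_deriv.simps)
  finally show ?thesis .
qed

text \<open>The logarithmic derivative in t_m subtracts the value at the current time, which brings
  the curve to 0 and hence into the preferred chart at 0. The outer derivatives stay on the
  hyperplane t_m = 0, where the current value is the value at t(m := 0); there a single chart
  expression serves all points.\<close>

lemma mixed_deriv_Suc:
  "mixed_deriv A (Suc m) h = iter_deriv (\<lambda>t. snd ach (h t - h (t(m := 0)))) (map unit [0..<Suc m]) 0"
proof -
  have "log_deriv A (\<lambda>s. h (t(m := s))) (t m) = iter_deriv (\<lambda>t. snd ach (h t - h (t(m := 0)))) [unit m] t" if "t m = 0" for t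
  proof -
    have "t(m := 0) = t" using that by auto
    then have "log_deriv A (\<lambda>s. h (t(m := s))) (t m) = dir_deriv (\<lambda>s. snd ach (h (t(m := s)) - h ((t(m := s))(m := 0)))) (t m) 1"
      using that by (simp add: log_deriv_def tangent_map_def vector_manifold_def o_def)
    then show ?thesis
      by (simp only: iter_deriv.simps dir_deriv_fun_upd[of "\<lambda>t. snd ach (h t - h (t(m := 0)))" t m, symmetric])
  qed
  then have "iter_deriv (\<lambda>t. log_deriv A (\<lambda>s. h (t(m := s))) (t m)) (map unit [0..<m]) 0
     = iter_deriv (iter_deriv (\<lambda>t. snd ach (h t - h (t(m := 0)))) [unit m]) (map unit [0..<m]) 0"
    by (intro iter_deriv_cong_on[of UNIV "{t. t m = 0}"]) (auto simp: single_def scaleR_fun_def)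
  then show ?thesis
    by (simp add: mixed_deriv_def iter_partial_eq iter_deriv_append zero_fun_def)
qed

text \<open>In the chart at 0 the addition of A is a smooth map \<alpha> that restricts to the
  identity on each of the two axes through the base point. Its derivative there is therefore (a, b)
  \<mapsto> a + b. At other points this can fail, hence the restriction to common zeros of h and
  k.\<close>

lemma deriv_add_at_zero:
  assumes h: "germ\<^sub>A h p" and k: "germ\<^sub>A k p"
  obtains U where "open U" "p \<in> U" "smooth_on U (\<lambda>x. snd ach (h x))" "smooth_on U (\<lambda>x. snd ach (k x))"
    "\<And>x d. x \<in> U \<Longrightarrow> h x = 0 \<Longrightarrow> k x = 0 \<Longrightarrow> iter_deriv (\<lambda>x. snd ach (h x + k x)) [d] x
        = iter_deriv (\<lambda>x. snd ach (h x)) [d] x + iter_deriv (\<lambda>x. snd ach (k x)) [d] x"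
proof -
  from h obtain V where V: "open V" "p \<in> V" "\<And>x. x \<in> V \<Longrightarrow> h x \<in> fst ach" "smooth_on V (\<lambda>x. snd ach (h x))" "h p = 0"
    by (rule germ\<^sub>AE) blast
  from k obtain W where W: "open W" "p \<in> W" "\<And>x. x \<in> W \<Longrightarrow> k x \<in> fst ach" "smooth_on W (\<lambda>x. snd ach (k x))" "k p = 0"
    by (rule germ\<^sub>AE) blast
  define \<alpha> where "\<alpha> = (\<lambda>z. snd ach (chart_inv ach (fst z) + chart_inv ach (snd z)))"
  obtain N where N: "open N" "(b\<^sub>0, b\<^sub>0) \<in> N" "smooth_on N \<alpha>"
    using near_add unfolding smooth_near_def \<alpha>_def by blast
  let ?O = "snd ach ` fst ach"
  have O: "open ?O" "b\<^sub>0 \<in> ?O" using ach unfolding is_chart_def b\<^sub>0_def by blast+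
  have fst_deriv: "iter_deriv \<alpha> [(a, 0)] (b\<^sub>0, b\<^sub>0) = a" for a
  proof -
    have "has_dir_deriv (\<lambda>z. fst z) (b\<^sub>0, b\<^sub>0) (a, 0::'b) a"
      using has_dir_deriv_id[of b\<^sub>0 a] by (simp add: has_dir_deriv_def)
    then have "has_dir_deriv \<alpha> (b\<^sub>0, b\<^sub>0) (a, 0) a"
    proof (subst has_dir_deriv_cong[where g = fst])
      show "\<forall>\<^sub>F t in at 0. \<alpha> ((b\<^sub>0, b\<^sub>0) + t *\<^sub>R (a, 0)) = fst ((b\<^sub>0, b\<^sub>0) + t *\<^sub>R (a, 0))"
        using eventually_line[OF O, of a] by (rule eventually_mono) (simp add: \<alpha>_def chart_inv_b\<^sub>0 chart_chart_inv)
      show "\<alpha> (b\<^sub>0, b\<^sub>0) = fst (b\<^sub>0, b\<^sub>0)" by (simp add: \<alpha>_def chart_inv_b\<^sub>0) (simp add: b\<^sub>0_def)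
    qed
    then show ?thesis by (simp add: dir_derivI)
  qed
  have snd_deriv: "iter_deriv \<alpha> [(0, a)] (b\<^sub>0, b\<^sub>0) = a" for a
  proof -
    have "has_dir_deriv (\<lambda>z. snd z) (b\<^sub>0, b\<^sub>0) (0::'b, a) a"
      using has_dir_deriv_id[of b\<^sub>0 a] by (simp add: has_dir_deriv_def)
    then have "has_dir_deriv \<alpha> (b\<^sub>0, b\<^sub>0) (0, a) a"
    proof (subst has_dir_deriv_cong[where g = snd])
      show "\<forall>\<^sub>F t in at 0. \<alpha> ((b\<^sub>0, b\<^sub>0) + t *\<^sub>R (0, a)) = snd ((b\<^sub>0, b\<^sub>0) + t *\<^sub>R (0, a))"
        using eventually_line[OF O, of a] by (rule eventually_mono) (simp add: \<alpha>_def chart_inv_b\<^sub>0 chart_chart_inv)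
      show "\<alpha> (b\<^sub>0, b\<^sub>0) = snd (b\<^sub>0, b\<^sub>0)" by (simp add: \<alpha>_def chart_inv_b\<^sub>0) (simp add: b\<^sub>0_def)
    qed
    then show ?thesis by (simp add: dir_derivI)
  qed
  have VW: "open (V \<inter> W)" "p \<in> V \<inter> W" using V W by auto
  let ?H = "\<lambda>x. (snd ach (h x), snd ach (k x))"
  show thesis
  proof (rule that[OF VW smooth_on_subset[OF V(4)] smooth_on_subset[OF W(4)]])
    fix x d assume x: "x \<in> V \<inter> W" and zero: "h x = 0" "k x = 0"
    have Hx: "?H x = (b\<^sub>0, b\<^sub>0)" by (simp add: zero b\<^sub>0_def)
    let ?h' = "iter_deriv (\<lambda>x. snd ach (h x)) [d] x" and ?k' = "iter_deriv (\<lambda>x. snd ach (k x)) [d] x"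
    have hd: "has_dir_deriv (iter_deriv (\<lambda>x. snd ach (h x)) []) x d ?h'"
      using x by (intro smooth_on_deriv[OF V(4)]) auto
    have kd: "has_dir_deriv (iter_deriv (\<lambda>x. snd ach (k x)) []) x d ?k'"
      using x by (intro smooth_on_deriv[OF W(4)]) auto
    have "has_dir_deriv ?H x d (?h', ?k')"
      using has_dir_deriv_Pair[OF hd kd] by (simp del: iter_deriv.simps(2))
    then have "has_dir_deriv (\<lambda>x. iter_deriv \<alpha> [] (?H x)) x d (iter_deriv \<alpha> [(?h', ?k')] (?H x))"
      using iter_deriv_chain[OF N(3,1), of ?H x d "(?h', ?k')" "[]"] N(2) Hx by simp
    also have "iter_deriv \<alpha> [(?h', ?k')] (?H x) = iter_deriv \<alpha> [(?h', 0) + (0, ?k')] (b\<^sub>0, b\<^sub>0)"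
      unfolding Hx by simp
    also have "\<dots> = ?h' + ?k'"
      unfolding iter_deriv_head_add[OF N(3,1,2)] fst_deriv snd_deriv ..
    finally have 1: "has_dir_deriv (\<lambda>x. \<alpha> (?H x)) x d (?h' + ?k')" by simp
    have eq: "\<alpha> (?H x) = snd ach (h x + k x)" if "x \<in> V \<inter> W" for x
      using that V(3) W(3) by (simp add: \<alpha>_def chart_inv_chart[OF ach(1)])
    have "has_dir_deriv (\<lambda>x. snd ach (h x + k x)) x d (?h' + ?k')"
      by (rule has_dir_deriv_cong[THEN iffD1, OF _ _ 1])
        (use eq x in \<open>auto intro!: eventually_mono[OF eventually_line[OF VW(1) x]]\<close>)
    then show "iter_deriv (\<lambda>x. snd ach (h x + k x)) [d] x = ?h' + ?k'" by (simp add: dir_derivI)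
  qed auto
qed

text \<open>After subtraction of the values at t_m = 0 both summands vanish on the hyperplane t_m =
  0, which is where the innermost derivative is evaluated.\<close>

lemma mixed_deriv_add:
  assumes h: "germ\<^sub>A h 0" and k: "germ\<^sub>A k 0"
  shows "mixed_deriv A (Suc m) (\<lambda>t. h t + k t) = mixed_deriv A (Suc m) h + mixed_deriv A (Suc m) k"
proof -
  let ?h = "\<lambda>t. h t - h (t(m := 0))" and ?k = "\<lambda>t. k t - k (t(m := 0))"
  have h': "germ\<^sub>A ?h 0" by (rule germ\<^sub>A_diff[OF h germ\<^sub>A_fun_upd_0[OF h]])
  have k': "germ\<^sub>A ?k 0" by (rule germ\<^sub>A_diff[OF k germ\<^sub>A_fun_upd_0[OF k]])
  let ?us = "map unit [0..<m]"
  obtain U where U: "open U" "0 \<in> U"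
    "smooth_on U (\<lambda>t. snd ach (?h t))" "smooth_on U (\<lambda>t. snd ach (?k t))"
    "\<And>x d. x \<in> U \<Longrightarrow> ?h x = 0 \<Longrightarrow> ?k x = 0 \<Longrightarrow> iter_deriv (\<lambda>x. snd ach (?h x + ?k x)) [d] x
        = iter_deriv (\<lambda>x. snd ach (?h x)) [d] x + iter_deriv (\<lambda>x. snd ach (?k x)) [d] x"
    using deriv_add_at_zero[OF h' k'] by blast
  have upd: "t(m := 0) = t" if "t m = 0" for t :: "nat \<Rightarrow> real" using that by auto
  have "iter_deriv (iter_deriv (\<lambda>t. snd ach (?h t + ?k t)) [unit m]) ?us 0
    = iter_deriv (\<lambda>t. iter_deriv (\<lambda>x. snd ach (?h x)) [unit m] t + iter_deriv (\<lambda>x. snd ach (?k x)) [unit m] t) ?us 0"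
    by (rule iter_deriv_cong_on[OF U(1), of "{t. t m = 0}"])
      (simp only: U(5) upd diff_self mem_Collect_eq, auto simp: single_def scaleR_fun_def U(2))
  also have "\<dots> = iter_deriv (iter_deriv (\<lambda>x. snd ach (?h x)) [unit m]) ?us 0 + iter_deriv (iter_deriv (\<lambda>x. snd ach (?k x)) [unit m]) ?us 0"
    by (rule iter_deriv_add_on[OF smooth_on_iter_deriv[OF U(3,1)] smooth_on_iter_deriv[OF U(4,1)] U(1,2)])
  finally have "iter_deriv (\<lambda>t. snd ach (?h t + ?k t)) (?us @ [unit m]) 0
     = iter_deriv (\<lambda>t. snd ach (?h t)) (?us @ [unit m]) 0 + iter_deriv (\<lambda>t. snd ach (?k t)) (?us @ [unit m]) 0"
    unfolding iter_deriv_append .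
  then show ?thesis
    unfolding mixed_deriv_Suc by (simp add: algebra_simps)
qed

lemma mixed_deriv_indep:
  assumes "k \<le> m" "\<And>t. h (t(k := 0)) = h t"
  shows "mixed_deriv A (Suc m) h = 0"
  unfolding mixed_deriv_Suc
proof (rule iter_deriv_indep[of _ k])
  fix t :: "nat \<Rightarrow> real"
  have "h ((t(k := 0))(m := 0)) = h (t(m := 0))"
    using assms(2)[of "t(m := 0)"] assms(2)[of t] by (cases "k = m") (auto simp: fun_upd_twist)
  then show "snd ach (h (t(k := 0)) - h ((t(k := 0))(m := 0))) = snd ach (h t - h (t(m := 0)))"
    by (simp add: assms(2))
qed (use assms(1) in \<open>auto simp del: upt_Suc\<close>)

lemma mixed_deriv_uminus:
  assumes "germ\<^sub>A h 0"
  shows "mixed_deriv A (Suc m) (\<lambda>t. - h t) = - mixed_deriv A (Suc m) h"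
  using mixed_deriv_add[OF assms germ\<^sub>A_uminus[OF assms], of m] mixed_deriv_indep[of 0 m "\<lambda>_. 0"]
  by (simp add: eq_neg_iff_add_eq_0 add.commute)

lemma mixed_deriv_diff:
  assumes "germ\<^sub>A h 0" "germ\<^sub>A k 0"
  shows "mixed_deriv A (Suc m) (\<lambda>t. h t - k t) = mixed_deriv A (Suc m) h - mixed_deriv A (Suc m) k"
  using mixed_deriv_add[OF assms(1) germ\<^sub>A_uminus[OF assms(2)], of m] mixed_deriv_uminus[OF assms(2)] by simp

lemma mixed_deriv_sum:
  assumes "\<And>i. i \<in> I \<Longrightarrow> germ\<^sub>A (h i) 0"
  shows "mixed_deriv A (Suc m) (\<lambda>t. \<Sum>i\<in>I. h i t) = (\<Sum>i\<in>I. mixed_deriv A (Suc m) (h i))"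
  using assms
  by (induction I rule: infinite_finite_induct)
    (simp_all add: mixed_deriv_indep[of 0 m "\<lambda>_. 0"] mixed_deriv_add germ\<^sub>A_sum)

lemma mixed_deriv_alt_sign:
  assumes "germ\<^sub>A h 0"
  shows "mixed_deriv A (Suc m) (\<lambda>t. alt_sign k (h t)) = alt_sign k (mixed_deriv A (Suc m) h)"
  unfolding alt_sign_def by (simp add: mixed_deriv_uminus[OF assms])

text \<open>The last parameter m plays a special role in \<open>mixed_deriv\<close>, so symmetry
  needs an argument when the swap involves it. Subtracting from h its value at t_i = 0 does not
  change the mixed derivative, and the function normalised in both t_i and t_m is treated
  symmetrically.\<close>

lemma mixed_deriv_transpose:
  assumes h: "germ\<^sub>A h 0" and i: "Suc i \<le> m"
  shows "mixed_deriv A (Suc m) (\<lambda>t. h (t \<circ> Transposition.transpose i (Suc i))) = mixed_deriv A (Suc m) h"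
proof -
  let ?\<tau> = "Transposition.transpose i (Suc i)"
  have upd: "(t(k := 0)) \<circ> ?\<tau> = (t \<circ> ?\<tau>)(?\<tau> k := 0)" for t :: "nat \<Rightarrow> real" and k
  proof
    fix x
    have "(?\<tau> x = k) = (x = ?\<tau> k)"
      using transpose_involutory[of i "Suc i" x] transpose_involutory[of i "Suc i" k] by metis
    then show "((t(k := 0)) \<circ> ?\<tau>) x = ((t \<circ> ?\<tau>)(?\<tau> k := 0)) x" by simp
  qed
  have sm: "\<exists>U. smooth_on U (\<lambda>t. snd ach (k t)) \<and> open U \<and> 0 \<in> U" if k: "germ\<^sub>A k 0" for k
    using k unfolding germ\<^sub>A_def smooth_near_def by blast
  have h\<tau>: "germ\<^sub>A (\<lambda>t. h (t \<circ> ?\<tau>)) 0"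
  proof (rule germ\<^sub>A_compose[OF h _ open_UNIV UNIV_I])
    show "smooth_on UNIV (\<lambda>t::nat \<Rightarrow> real. t \<circ> ?\<tau>)"
      using smooth_on_reindex[of "\<lambda>_. True" ?\<tau>] by (simp add: o_def)
  qed (simp add: fun_eq_iff)
  show ?thesis
  proof (cases "Suc i = m")
    case False
    then have fix_m: "?\<tau> m = m" using i by (simp add: transpose_def)
    let ?F = "\<lambda>t. snd ach (h t - h (t(m := 0)))"
    obtain U where U: "smooth_on U ?F" "open U" "0 \<in> U"
      using sm[OF germ\<^sub>A_diff[OF h germ\<^sub>A_fun_upd_0[OF h]]] by blast
    have "mixed_deriv A (Suc m) (\<lambda>t. h (t \<circ> ?\<tau>)) = iter_deriv (\<lambda>t. ?F (t \<circ> ?\<tau>)) (map unit [0..<Suc m]) 0"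
      unfolding mixed_deriv_Suc upd fix_m ..
    also have "\<dots> = mixed_deriv A (Suc m) h"
      unfolding mixed_deriv_Suc using i by (intro iter_deriv_transpose[OF U]) auto
    finally show ?thesis .
  next
    case True
    have red: "mixed_deriv A (Suc m) k = mixed_deriv A (Suc m) (\<lambda>t. k t - k (t(i := 0)))" if k: "germ\<^sub>A k 0" for k
      using mixed_deriv_diff[OF k germ\<^sub>A_fun_upd_0[OF k, of i], of m] mixed_deriv_indep[of i m "\<lambda>t. k (t(i := 0))"] i by simp
    have \<tau>: "?\<tau> m = i" "?\<tau> i = m" using True by (auto simp: transpose_def)
    let ?k = "\<lambda>t. h t - h (t(i := 0))"
    have k: "germ\<^sub>A ?k 0" by (rule germ\<^sub>A_diff[OF h germ\<^sub>A_fun_upd_0[OF h]])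
    let ?F = "\<lambda>t. snd ach (?k t - ?k (t(m := 0)))"
    obtain U where U: "smooth_on U ?F" "open U" "0 \<in> U"
      using sm[OF germ\<^sub>A_diff[OF k germ\<^sub>A_fun_upd_0[OF k]]] by blast
    have swap: "h ((t \<circ> ?\<tau>)(i := 0, m := 0)) = h ((t \<circ> ?\<tau>)(m := 0, i := 0))" for t :: "nat \<Rightarrow> real"
      using True by (simp add: fun_upd_twist)
    have "mixed_deriv A (Suc m) (\<lambda>t. h (t \<circ> ?\<tau>)) = mixed_deriv A (Suc m) (\<lambda>t. h (t \<circ> ?\<tau>) - h ((t(i := 0)) \<circ> ?\<tau>))"
      by (rule red[OF h\<tau>])
    also have "\<dots> = iter_deriv (\<lambda>t. ?F (t \<circ> ?\<tau>)) (map unit [0..<Suc m]) 0"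
      unfolding mixed_deriv_Suc upd \<tau> swap by (simp add: algebra_simps)
    also have "\<dots> = mixed_deriv A (Suc m) ?k"
      unfolding mixed_deriv_Suc using i by (intro iter_deriv_transpose[OF U]) auto
    also have "\<dots> = mixed_deriv A (Suc m) h" by (rule red[OF h, symmetric])
    finally show ?thesis .
  qed
qed

text \<open>The last curve starts at 1, so by normalisation the subtracted value at t_m = 0 is
  0.\<close>

lemma mixed_deriv_cochain:
  assumes f: "f \<in> loc_cochains (Suc m)" and \<gamma>: "\<And>k. k \<le> m \<Longrightarrow> velocity (\<gamma> k) (v k)"
  shows "mixed_deriv A (Suc m) (\<lambda>t. f (\<lambda>k. \<gamma> k (t k))) = cochain_deriv (Suc m) f v"
proof -
  have "\<gamma> m 0 = 1" using \<gamma>[of m] unfolding velocity_def germ\<^sub>G_def by simp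
  moreover have "\<forall>g. (\<exists>i<Suc m. g i = 1) \<longrightarrow> f g = 0" using f unfolding loc_cochains_def by blast
  ultimately have "f (\<lambda>k. \<gamma> k ((t(m := 0)) k)) = 0" for t
    by (elim allE impE) (auto intro!: exI[of _ m])
  then show ?thesis
    using cochain_deriv_curves[OF f, of id \<gamma> v] \<gamma> unfolding mixed_deriv_Suc by simp
qed

end

section \<open>Evaluating D_n through curves\<close>

lemma is_chart_vector: "is_chart (UNIV, id :: 'e::topological_space \<Rightarrow> 'e)"
  unfolding is_chart_def by (auto simp: homeomorphism_def id_def continuous_on_id)

lemma vector_manifold_simps [simp]:
  "atlas vector_manifold = {(UNIV, id)}" "chart_at vector_manifold x = (UNIV, id)"
  by (simp_all add: vector_manifold_def)

lemma eq_uminus_imp_zero: "(x::'f::real_vector) = - x \<Longrightarrow> x = 0"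
proof -
  assume "x = - x"
  then have "2 *\<^sub>R x = 0" by (simp add: scaleR_2 eq_neg_iff_add_eq_0)
  then show "x = 0" by simp
qed

context lie_module
begin

text \<open>The parameter t_k enters slot k through \<gamma>_k and slot k + 1 through its inverse.
  Splitting each direction into these two occurrences, any contribution that uses a second
  occurrence leaves some slot at the value 1 and is killed by normalisation.\<close>

lemma mixed_deriv_Phi:
  assumes f: "f \<in> loc_cochains (Suc m)" and \<gamma>: "\<And>k. k \<le> m \<Longrightarrow> germ\<^sub>G (\<gamma> k) (0::real)"
  shows "mixed_deriv A (Suc m) (\<lambda>t. Phi act f (case_nat 1 (\<lambda>i. \<gamma> i (t i))))
    = mixed_deriv A (Suc m) (\<lambda>t. f (\<lambda>i. \<gamma> i (t i)))"
proof -
  have dep: "depends_below (Suc m) f" and norm: "\<forall>g. (\<exists>i<Suc m. g i = 1) \<longrightarrow> f g = 0"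
    using f unfolding loc_cochains_def by blast+
  have \<gamma>0: "\<gamma> k 0 = 1" if "k \<le> m" for k using \<gamma>[OF that] by (simp add: germ\<^sub>G_def)
  define n where "n = Suc m"
  text \<open>The parameter \<open>t\<^sub>k\<close> occurs in two slots; the index \<open>n + k\<close> gives its second occurrence
    a parameter of its own.\<close>
  define a where "a = (\<lambda>t k. if k = 0 then \<gamma> 0 (t 0) else inverse (\<gamma> (k - 1) (t (n + k - 1))) * \<gamma> k (t k))"
  define K where "K t = f (a t)" for t :: "nat \<Rightarrow> real"
  have "germ\<^sub>G (\<lambda>t. a t k) 0" if "k < Suc m" for k
    unfolding a_def using that
    by (cases "k = 0") (auto intro!: germ\<^sub>G_mult germ\<^sub>G_inverse germ\<^sub>G_coordinate \<gamma>)
  from germ\<^sub>A_cochain[OF f this] have K: "germ\<^sub>A K 0" unfolding K_def[abs_def] .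
  define F where "F = (\<lambda>t. snd ach (K t - K (t(m := 0))))"
  obtain U where U: "smooth_on U F" "open U" "0 \<in> U"
    using germ\<^sub>A_diff[OF K germ\<^sub>A_fun_upd_0[OF K, of m]] unfolding germ\<^sub>A_def smooth_near_def F_def by blast
  \<comment> \<open>\<open>L1\<close> identifies the two copies of each parameter and gives \<Phi>;
    \<open>L0\<close> sets the second copies to 0, where the inverse factors become 1, and gives f
    itself.\<close>
  define L1 where "L1 = (\<lambda>(t::nat \<Rightarrow> real) i. if i < n + m then t (if i < n then i else i - n) else 0)"
  define L0 where "L0 = (\<lambda>(t::nat \<Rightarrow> real) i. if i < n then t i else 0)"
  have lin1: "linear L1" unfolding L1_def by (rule linear_reindex)
  have lin0: "linear L0" unfolding L0_def by (rule linear_reindex)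
  have K1: "Phi act f (case_nat 1 (\<lambda>i. \<gamma> i (t i))) = K (L1 t)" for t
  proof -
    have "inverse (case_nat 1 (\<lambda>i. \<gamma> i (t i)) k) * case_nat 1 (\<lambda>i. \<gamma> i (t i)) (Suc k) = a (L1 t) k" if "k < Suc m" for k
      using that by (cases k) (auto simp: a_def L1_def n_def inverse_1)
    then show ?thesis
      unfolding Phi_def K_def using dep by (simp add: act_simps depends_below_def)
  qed
  have K0: "f (\<lambda>i. \<gamma> i (t i)) = K (L0 t)" for t
  proof -
    have "\<gamma> k (t k) = a (L0 t) k" if "k < Suc m" for k
      using that by (cases k) (auto simp: a_def L0_def n_def inverse_1 \<gamma>0)
    then show ?thesis unfolding K_def using dep by (simp add: depends_below_def)
  qed
  have upd1: "L1 (t(m := 0)) = (L1 t)(m := 0)" and upd0: "L0 (t(m := 0)) = (L0 t)(m := 0)" for t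
    by (auto simp: L1_def L0_def n_def fun_eq_iff)
  have L1_unit: "L1 (unit j) = unit j + (if j < m then unit (n + j) else 0)" if "j < n" for j
    using that by (auto simp: L1_def single_def n_def fun_eq_iff)
  have L0_unit: "L0 (unit j) = unit j" if "j < n" for j
    using that by (auto simp: L0_def single_def n_def fun_eq_iff)
  \<comment> \<open>The second occurrences are removed in increasing order of the index. The order
    matters: to see that slot j is idle, the direction of index j - 1 must already have lost its
    second occurrence, which lives in slot j.\<close>
  have step: "iter_deriv F (map unit [0..<j] @ map (\<lambda>i. L1 (unit i)) [j..<n]) 0
     = iter_deriv F (map unit [0..<Suc j] @ map (\<lambda>i. L1 (unit i)) [Suc j..<n]) 0" if j: "j < n" for j
  proof -
    let ?us = "map unit [0..<j]" and ?vs = "map (\<lambda>i. L1 (unit i)) [Suc j..<n]"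
    let ?w = "if j < m then unit (n + j) else 0 :: nat \<Rightarrow> real"
    have zero: "iter_deriv F (?us @ ?w # ?vs) 0 = 0"
    proof (cases "j < m")
      case False
      then show ?thesis by (intro iter_deriv_zero_dir) simp
    next
      case True
      \<comment> \<open>On this slice both factors of slot j equal 1, hence K = 0; none of the
        remaining directions leaves it.\<close>
      let ?S = "{t :: nat \<Rightarrow> real. t j = 0 \<and> (0 < j \<longrightarrow> t (n + j - 1) = 0)}"
      have K_zero: "K t = 0" if "t \<in> ?S" for t
      proof -
        have "a t j = 1" using that True \<gamma>0 by (auto simp: a_def inverse_1)
        then show ?thesis unfolding K_def using norm True by (meson less_SucI)
      qed
      have "iter_deriv F (?us @ ?w # ?vs) 0 = iter_deriv (\<lambda>_. b\<^sub>0) (?us @ ?w # ?vs) 0"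
      proof (rule iter_deriv_cong_on[OF open_UNIV, of ?S])
        fix t assume t: "t \<in> ?S"
        then have "t(m := 0) \<in> ?S" using True by (auto simp: n_def)
        then show "F t = b\<^sub>0" using t by (simp add: F_def K_zero b\<^sub>0_def)
      next
        fix t h and s :: real assume t: "t \<in> ?S" and "h \<in> set (?us @ ?w # ?vs)"
        then consider i where "i < j" "h = unit i" | "h = unit (n + j)"
          | i where "j < i" "i < n" "h = L1 (unit i)"
          using True by (auto simp: Suc_le_eq)
        then have "h j = 0 \<and> (0 < j \<longrightarrow> h (n + j - 1) = 0)"
        proof cases
          case 3
          then show ?thesis unfolding 3(3) L1_unit[OF 3(2)] using j by (auto simp: single_def n_def)
        qed (use j in \<open>auto simp: single_def n_def\<close>)
        then show "t + s *\<^sub>R h \<in> ?S" using t by (simp add: scaleR_fun_def)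
      qed auto
      then show ?thesis by (simp add: iter_deriv_const)
    qed
    have "iter_deriv F (?us @ map (\<lambda>i. L1 (unit i)) [j..<n]) 0 = iter_deriv F (?us @ (unit j + ?w) # ?vs) 0"
      using j by (simp add: upt_conv_Cons L1_unit)
    also have "\<dots> = iter_deriv F (?us @ unit j # ?vs) 0"
      unfolding iter_deriv_mid_add[OF U] zero by simp
    finally show ?thesis by simp
  qed
  have "iter_deriv F (map (\<lambda>i. L1 (unit i)) [0..<n]) 0
      = iter_deriv F (map unit [0..<j] @ map (\<lambda>i. L1 (unit i)) [j..<n]) 0" if "j \<le> n" for j
    using that
  proof (induction j)
    case (Suc j)
    show ?case
      by (rule trans[OF Suc.IH[OF Suc_leD[OF Suc.prems]] step[OF Suc_le_lessD[OF Suc.prems]]])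
  qed simp
  from this[of n] have main: "iter_deriv F (map (\<lambda>i. L1 (unit i)) [0..<n]) 0 = iter_deriv F (map unit [0..<n]) 0"
    by simp
  have L_0: "L1 0 = 0" "L0 0 = 0" using lin1 lin0 by (simp_all add: linear_0)
  have "mixed_deriv A (Suc m) (\<lambda>t. Phi act f (case_nat 1 (\<lambda>i. \<gamma> i (t i)))) = iter_deriv (\<lambda>t. F (L1 t)) (map unit [0..<n]) 0"
    unfolding mixed_deriv_Suc K1 upd1 F_def n_def ..
  also have "\<dots> = iter_deriv F (map (\<lambda>i. L1 (unit i)) [0..<n]) 0"
    unfolding iter_deriv_linear_comp[OF lin1] L_0 by (simp add: o_def)
  also have "\<dots> = iter_deriv F (map unit [0..<n]) 0" by (rule main)
  also have "\<dots> = iter_deriv (\<lambda>t. F (L0 t)) (map unit [0..<n]) 0"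
    unfolding iter_deriv_linear_comp[OF lin0] L_0
    by (rule arg_cong[where f = "\<lambda>l. iter_deriv F l 0"]) (simp add: L0_unit)
  also have "\<dots> = mixed_deriv A (Suc m) (\<lambda>t. f (\<lambda>i. \<gamma> i (t i)))"
    unfolding mixed_deriv_Suc K0 upd0 F_def n_def ..
  finally show ?thesis .
qed

lemma curve_with_velocity_imp:
  assumes "curve_with_velocity G 1 v \<gamma>"
  shows "velocity \<gamma> v"
proof -
  obtain \<epsilon> where \<epsilon>: "\<epsilon> > 0" "smooth_map vector_manifold G {-\<epsilon><..<\<epsilon>} \<gamma>" and \<gamma>0: "\<gamma> 0 = 1"
    and v: "tangent_map vector_manifold G \<gamma> 0 1 = v"
    using assms unfolding curve_with_velocity_def by blast
  have near: "smooth_near gch \<gamma> 0"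
    using smooth_map_near[OF \<epsilon>(2) _ is_chart_vector _ gch(1,2), of 0] \<epsilon>(1) gch(3) \<gamma>0 by simp
  then obtain U where U: "open U" "0 \<in> U" "smooth_on U (\<lambda>s. snd gch (\<gamma> s))"
    unfolding smooth_near_def by blast
  have "dir_deriv (\<lambda>s. snd gch (\<gamma> s)) 0 1 = v"
    using v unfolding tangent_map_def by (simp add: \<gamma>0 o_def)
  then have "has_dir_deriv (\<lambda>s. snd gch (\<gamma> s)) 0 1 v"
    using smooth_on_deriv[OF U(3,2), of "[]" 1] by simp
  then show ?thesis unfolding velocity_def germ\<^sub>G_def using near \<gamma>0 by blast
qed

text \<open>The straight line in the chart at 1. Existence matters because without a curve the
  condition inside \<open>tau\<close> would be vacuous and \<open>THE\<close> would not determine a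
  value.\<close>

lemma exists_curve_with_velocity: "\<exists>\<gamma>. curve_with_velocity G 1 v \<gamma>"
proof -
  define \<gamma> where "\<gamma> s = chart_inv gch (e\<^sub>0 + s *\<^sub>R v)" for s :: real
  let ?O = "snd gch ` fst gch"
  have O: "open ?O" "e\<^sub>0 \<in> ?O" using gch unfolding is_chart_def e\<^sub>0_def by blast+
  have lin: "linear (\<lambda>s::real. s *\<^sub>R v)" by (simp add: linear_iff scaleR_left_distrib)
  have "continuous_on UNIV (\<lambda>s::real. s *\<^sub>R v)"
    unfolding continuous_on_def by (intro ballI tendsto_scaleR_lc tendsto_ident_at tendsto_const)
  then have aff: "smooth_on S (\<lambda>s::real. e\<^sub>0 + s *\<^sub>R v)" if "open S" for S
    by (intro smooth_on_add smooth_on_const smooth_on_cont_linear lin that)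
  let ?V = "(\<lambda>s::real. e\<^sub>0 + s *\<^sub>R v) -` ?O"
  have "open ?V"
    by (rule open_vimage[OF O(1) smooth_on_imp_continuous_on[OF aff open_UNIV]]) simp
  moreover have "0 \<in> ?V" using O(2) by simp
  ultimately obtain \<epsilon> where \<epsilon>: "\<epsilon> > 0" "ball 0 \<epsilon> \<subseteq> ?V"
    unfolding open_contains_ball by blast
  let ?S = "{-\<epsilon><..<\<epsilon>}"
  have in_O: "e\<^sub>0 + s *\<^sub>R v \<in> ?O" if "s \<in> ?S" for s
    using subsetD[OF \<epsilon>(2), of s] that by (simp add: dist_real_def abs_less_iff)
  have cont: "continuous_on ?S \<gamma>"
    unfolding \<gamma>_def
    by (rule continuous_on_compose2[OF continuous_on_chart_inv[OF gch(1)] smooth_on_imp_continuous_on[OF aff]])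
      (use in_O in auto)
  have "smooth_on (?S \<inter> \<gamma> -` fst d) (\<lambda>s. snd d (\<gamma> s))" if d: "d \<in> atlas G" for d
  proof -
    have d': "is_chart d" using lie_group d unfolding lie_group_def smooth_manifold_def by blast
    have Q: "snd gch ` (fst gch \<inter> fst d) = chart_inv gch -` fst d \<inter> ?O"
      using chart_inv_chart[OF gch(1)] by (fastforce simp: image_iff)
    have "open (chart_inv gch -` fst d \<inter> ?O)"
      using continuous_on_chart_inv[OF gch(1)] O(1) d' by (simp add: continuous_on_open_vimage is_chart_def)
    moreover have "smooth_on (chart_inv gch -` fst d \<inter> ?O) (\<lambda>x. snd d (chart_inv gch x))"
      using lie_group gch(2) d unfolding lie_group_def smooth_manifold_def Q[symmetric] o_def by blast
    moreover have op: "open (?S \<inter> \<gamma> -` fst d)"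
      using cont d' by (simp add: continuous_on_open_vimage is_chart_def Int_commute)
    ultimately show ?thesis
      unfolding \<gamma>_def using in_O by (intro smooth_on_compose[OF _ _ aff[OF op[unfolded \<gamma>_def]]]) (auto simp: \<gamma>_def)
  qed
  then have "smooth_map vector_manifold G ?S \<gamma>"
    unfolding smooth_map_def using cont by (simp add: o_def)
  moreover have \<gamma>0: "\<gamma> 0 = 1" by (simp add: \<gamma>_def chart_inv_e\<^sub>0)
  moreover have "tangent_map vector_manifold G \<gamma> 0 1 = v"
  proof -
    have "has_dir_deriv (\<lambda>s. snd gch (\<gamma> s)) 0 1 v"
    proof (rule has_dir_deriv_cong[THEN iffD2])
      show "has_dir_deriv (\<lambda>s::real. e\<^sub>0 + s *\<^sub>R v) 0 1 v"
        using has_dir_deriv_id[of e\<^sub>0 v] unfolding has_dir_deriv_curve[of _ e\<^sub>0] .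
      show "\<forall>\<^sub>F t in at 0. snd gch (\<gamma> (0 + t *\<^sub>R 1)) = e\<^sub>0 + (0 + t *\<^sub>R 1) *\<^sub>R v"
        using eventually_line[OF O, of v] by (rule eventually_mono) (simp add: \<gamma>_def chart_chart_inv)
    qed (simp add: \<gamma>0 e\<^sub>0_def)
    then show ?thesis unfolding tangent_map_def by (simp add: \<gamma>0 o_def dir_derivI)
  qed
  ultimately show ?thesis unfolding curve_with_velocity_def using \<epsilon>(1) by blast
qed

lemma exists_velocity: "\<exists>\<gamma>. \<forall>i. velocity (\<gamma> i) (v i)"
  by (rule choice) (use exists_curve_with_velocity curve_with_velocity_imp in blast)

lemma Dmap_eq:
  assumes f: "f \<in> loc_cochains n" and n: "n > 0"
  shows "Dmap G A act n f v = (\<Sum>\<sigma> | \<sigma> permutes {..<n}. of_int (sign \<sigma>) *\<^sub>R cochain_deriv n f (v \<circ> \<sigma>))"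
proof -
  obtain m where m: "n = Suc m" using n by (cases n) auto
  have eq: "(\<Sum>\<sigma> | \<sigma> permutes {..<n}. of_int (sign \<sigma>) *\<^sub>R mixed_deriv A n (\<lambda>t. Phi act f (case_nat 1 (\<lambda>i. \<gamma> (\<sigma> i) (t i)))))
      = (\<Sum>\<sigma> | \<sigma> permutes {..<n}. of_int (sign \<sigma>) *\<^sub>R cochain_deriv n f (v \<circ> \<sigma>))"
    if \<gamma>: "\<forall>i<n. curve_with_velocity G 1 (v i) (\<gamma> i)" for \<gamma>
  proof (rule sum.cong[OF refl])
    fix \<sigma> assume "\<sigma> \<in> {\<sigma>. \<sigma> permutes {..<n}}"
    then have \<sigma>: "\<sigma> k < n" if "k \<le> m" for k using permutes_in_image[of \<sigma> "{..<n}" k] that m by auto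
    have vel: "velocity (\<gamma> (\<sigma> k)) ((v \<circ> \<sigma>) k)" if "k \<le> m" for k
      using \<gamma> \<sigma>[OF that] curve_with_velocity_imp by simp
    have "mixed_deriv A n (\<lambda>t. Phi act f (case_nat 1 (\<lambda>i. \<gamma> (\<sigma> i) (t i)))) = mixed_deriv A n (\<lambda>t. f (\<lambda>i. \<gamma> (\<sigma> i) (t i)))"
      unfolding m using vel by (intro mixed_deriv_Phi f[unfolded m]) (simp add: velocity_def)
    also have "\<dots> = cochain_deriv n f (v \<circ> \<sigma>)"
      unfolding m by (rule mixed_deriv_cochain[OF f[unfolded m] vel])
    finally show "of_int (sign \<sigma>) *\<^sub>R mixed_deriv A n (\<lambda>t. Phi act f (case_nat 1 (\<lambda>i. \<gamma> (\<sigma> i) (t i))))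
        = of_int (sign \<sigma>) *\<^sub>R cochain_deriv n f (v \<circ> \<sigma>)" by simp
  qed
  have "\<exists>\<gamma>. \<forall>i. curve_with_velocity G 1 (v i) (\<gamma> i)"
    by (rule choice) (rule allI, rule exists_curve_with_velocity)
  then obtain \<gamma> where \<gamma>: "\<forall>i<n. curve_with_velocity G 1 (v i) (\<gamma> i)" by blast
  show ?thesis
    unfolding Dmap_def tau_def
  proof (rule the_equality)
    fix w
    assume w: "\<forall>\<gamma>. (\<forall>i<n. curve_with_velocity G 1 (v i) (\<gamma> i)) \<longrightarrow> w = (\<Sum>\<sigma> | \<sigma> permutes {..<n}.
      of_int (sign \<sigma>) *\<^sub>R mixed_deriv A n (\<lambda>t. Phi act f (case_nat 1 (\<lambda>i. \<gamma> (\<sigma> i) (t i)))))"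
    from w[THEN spec, THEN mp, OF \<gamma>]
    show "w = (\<Sum>\<sigma> | \<sigma> permutes {..<n}. of_int (sign \<sigma>) *\<^sub>R cochain_deriv n f (v \<circ> \<sigma>))"
      by (simp only: eq[OF \<gamma>])
  qed (use eq[symmetric] in blast)
qed

section \<open>D_n f as a continuous alternating form, additive in f\<close>

lemma loc_cochains_add:
  assumes "f \<in> loc_cochains n" "g \<in> loc_cochains n"
  shows "f + g \<in> loc_cochains n"
  using assms unfolding loc_cochains_def depends_below_def
  by (auto intro: germ\<^sub>A_add) metis

text \<open>Additivity cannot be read off the chart expression defining
  \<open>cochain_deriv\<close>, since the chart of A is not additive; it is imported from the mixed
  derivatives along curves.\<close>

lemma cochain_deriv_add:
  assumes f: "f \<in> loc_cochains n" and g: "g \<in> loc_cochains n" and n: "n > 0"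
  shows "cochain_deriv n (f + g) v = cochain_deriv n f v + cochain_deriv n g v"
proof -
  obtain m where m: "n = Suc m" using n by (cases n) auto
  obtain \<gamma> where \<gamma>: "\<And>i. velocity (\<gamma> i) (v i)" using exists_velocity by blast
  have germ: "germ\<^sub>A (\<lambda>t::nat \<Rightarrow> real. h (\<lambda>k. \<gamma> k (t k))) 0" if "h \<in> loc_cochains n" for h
    using \<gamma> by (intro germ\<^sub>A_cochain[OF that, of "\<lambda>k t. \<gamma> k (t k)"] germ\<^sub>G_coordinate) (simp add: velocity_def)
  have eq: "mixed_deriv A n (\<lambda>t. h (\<lambda>k. \<gamma> k (t k))) = cochain_deriv n h v" if "h \<in> loc_cochains n" for h
    using that unfolding m by (rule mixed_deriv_cochain) (rule \<gamma>)
  have "mixed_deriv A n (\<lambda>t. f (\<lambda>k. \<gamma> k (t k)) + g (\<lambda>k. \<gamma> k (t k)))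
     = mixed_deriv A n (\<lambda>t. f (\<lambda>k. \<gamma> k (t k))) + mixed_deriv A n (\<lambda>t. g (\<lambda>k. \<gamma> k (t k)))"
    unfolding m by (rule mixed_deriv_add[OF germ[OF f] germ[OF g]])
  then show ?thesis
    using eq[OF f] eq[OF g] eq[OF loc_cochains_add[OF f g]] by simp
qed

lemma Dmap_add:
  assumes f: "f \<in> loc_cochains n" and g: "g \<in> loc_cochains n" and n: "n > 0"
  shows "Dmap G A act n (f + g) = Dmap G A act n f + Dmap G A act n g"
  by (rule ext) (simp add: Dmap_eq[OF _ n] f g loc_cochains_add cochain_deriv_add[OF f g n] scaleR_right_distrib sum.distrib)

lemma cochain_deriv_smooth:
  assumes f: "f \<in> loc_cochains n"
  obtains W where "smooth_on W (\<lambda>u. snd ach (f (\<lambda>i. chart_inv gch (u i))))" "open W" "(\<lambda>_. e\<^sub>0) \<in> W"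
  using f unfolding loc_cochains_def germ\<^sub>A_def smooth_near_def by blast

lemma cochain_deriv_linear:
  assumes f: "f \<in> loc_cochains n" and j: "j < n"
  shows "linear (\<lambda>v. cochain_deriv n f (y(j := v)))"
proof -
  obtain W where W: "smooth_on W (\<lambda>u. snd ach (f (\<lambda>i. chart_inv gch (u i))))" "open W" "(\<lambda>_. e\<^sub>0) \<in> W"
    by (rule cochain_deriv_smooth[OF f])
  have split: "map (\<lambda>i. single i ((y(j := v)) i)) [0..<n]
    = map (\<lambda>i. single i (y i)) [0..<j] @ single j v # map (\<lambda>i. single i (y i)) [Suc j..<n]" for v
  proof -
    have "[0..<n] = [0..<j] @ j # [Suc j..<n]"
      using j by (metis less_imp_le_nat upt_add_eq_append upt_conv_Cons le_add_diff_inverse zero_le add_0)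
    then show ?thesis by simp
  qed
  show ?thesis
    unfolding linear_iff cochain_deriv_def split
    by (simp only: single_linear iter_deriv_mid_add[OF W] iter_deriv_mid_scaleR[OF W] simp_thms)
qed

lemma cochain_deriv_depends:
  "(\<And>i. i < n \<Longrightarrow> x i = y i) \<Longrightarrow> cochain_deriv n f x = cochain_deriv n f y"
  unfolding cochain_deriv_def by (rule arg_cong[where f = "\<lambda>l. iter_deriv _ l _"]) simp

lemma continuous_on_cochain_deriv:
  assumes f: "f \<in> loc_cochains n"
  shows "continuous_on UNIV (cochain_deriv n f)"
proof -
  obtain W where W: "smooth_on W (\<lambda>u. snd ach (f (\<lambda>i. chart_inv gch (u i))))" "open W" "(\<lambda>_. e\<^sub>0) \<in> W"
    by (rule cochain_deriv_smooth[OF f])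
  show ?thesis
    unfolding continuous_on_def
  proof
    fix v :: "nat \<Rightarrow> 'e"
    have coord: "((\<lambda>x. x i) \<longlongrightarrow> v i) (at v)" for i
      using tendsto_ident_at[of v UNIV] unfolding tendsto_fun_iff by blast
    have "((\<lambda>x. single i (x i)) \<longlongrightarrow> single i (v i)) (at v)" for i
      unfolding tendsto_fun_iff single_def using coord[of i] by auto
    then have "list_all2 (\<lambda>w l. (w \<longlongrightarrow> l) (at v)) (map (\<lambda>i x. single i (x i)) [0..<n]) (map (\<lambda>i. single i (v i)) [0..<n])"
      by (simp add: list_all2_conv_all_nth)
    from smooth_on_tendsto[OF W tendsto_const this]
    show "(cochain_deriv n f \<longlongrightarrow> cochain_deriv n f v) (at v)"
      by (simp add: cochain_deriv_def[abs_def] o_def)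
  qed
qed

lemma Dmap_in_lie_cochains:
  assumes f: "f \<in> loc_cochains n" and n: "n > 0"
  shows "Dmap G A act n f \<in> lie_cochains n"
proof -
  let ?T = "cochain_deriv n f"
  have D: "Dmap G A act n f = (\<lambda>v. \<Sum>\<sigma> | \<sigma> permutes {..<n}. of_int (sign \<sigma>) *\<^sub>R ?T (v \<circ> \<sigma>))"
    by (rule ext) (rule Dmap_eq[OF f n])
  have img: "\<sigma> i < n" if "\<sigma> permutes {..<n}" "i < n" for \<sigma> i
    using permutes_in_image[OF that(1), of i] that(2) by simp
  have "depends_below n (Dmap G A act n f)"
    unfolding D depends_below_def
    by (auto intro!: sum.cong arg_cong[where f = "\<lambda>y. _ *\<^sub>R y"] cochain_deriv_depends simp: img)
  moreover have "linear (\<lambda>v. Dmap G A act n f (x(i := v)))" if i: "i < n" for i x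
  proof -
    have "linear (\<lambda>v. of_int (sign \<sigma>) *\<^sub>R ?T (x(i := v) \<circ> \<sigma>))" if \<sigma>: "\<sigma> permutes {..<n}" for \<sigma>
    proof -
      define j where "j = inv_into UNIV \<sigma> i"
      have j: "j < n" unfolding j_def using permutes_inv[OF \<sigma>] i img by blast
      have "x(i := v) \<circ> \<sigma> = (x \<circ> \<sigma>)(j := v)" for v
        unfolding j_def by (rule ext) (use permutes_inverses[OF \<sigma>] in \<open>metis (no_types, lifting) comp_apply fun_upd_apply\<close>)
      then show ?thesis
        using cochain_deriv_linear[OF f j, of "x \<circ> \<sigma>"] by (simp add: linear_iff scaleR_right_distrib)
    qed
    then show ?thesis
      unfolding D by (simp add: linear_iff sum.distrib scaleR_right.sum)
  qed
  moreover have "Dmap G A act n f x = 0" if ij: "i < n" "j < n" "i \<noteq> j" "x i = x j" for x i j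
  proof -
    let ?\<tau> = "Transposition.transpose i j"
    have \<tau>: "?\<tau> permutes {..<n}" using ij by (intro permutes_swap_id) auto
    have x\<tau>: "x \<circ> ?\<tau> = x" using ij(4) by (auto simp: fun_eq_iff Transposition.transpose_def)
    \<comment> \<open>Since x is fixed by the transposition, reindexing the permutations by it on
      the left only flips the signs, so the value equals its own negative.\<close>
    have "Dmap G A act n f x = (\<Sum>\<sigma> | \<sigma> permutes {..<n}. of_int (sign (?\<tau> \<circ> \<sigma>)) *\<^sub>R ?T (x \<circ> (?\<tau> \<circ> \<sigma>)))"
      unfolding D by (rule setum_permutations_compose_left[OF \<tau>])
    also have "\<dots> = (\<Sum>\<sigma> | \<sigma> permutes {..<n}. - (of_int (sign \<sigma>) *\<^sub>R ?T (x \<circ> \<sigma>)))"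
    proof (rule sum.cong[OF refl])
      fix \<sigma> assume "\<sigma> \<in> {\<sigma>. \<sigma> permutes {..<n}}"
      then have "permutation \<sigma>" by (auto simp: permutation_permutes)
      then have "sign (?\<tau> \<circ> \<sigma>) = - sign \<sigma>"
        using ij(3) by (simp add: sign_compose permutation_swap_id sign_swap_id)
      then show "of_int (sign (?\<tau> \<circ> \<sigma>)) *\<^sub>R ?T (x \<circ> (?\<tau> \<circ> \<sigma>)) = - (of_int (sign \<sigma>) *\<^sub>R ?T (x \<circ> \<sigma>))"
        by (simp add: o_assoc x\<tau>)
    qed
    also have "\<dots> = - Dmap G A act n f x" unfolding D by (rule sum_negf)
    finally show ?thesis by (rule eq_uminus_imp_zero)
  qed
  moreover have "continuous_on UNIV (Dmap G A act n f)"
  proof -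
    have perm: "continuous_on UNIV (\<lambda>v::nat \<Rightarrow> 'e. v \<circ> \<sigma>)" for \<sigma> :: "nat \<Rightarrow> nat"
      by (rule continuous_on_coordinatewise_then_product) simp
    have "continuous_on UNIV (\<lambda>v. ?T (v \<circ> \<sigma>))" for \<sigma> :: "nat \<Rightarrow> nat"
      by (rule continuous_on_compose2[OF continuous_on_cochain_deriv[OF f] perm]) simp
    then have "continuous_on UNIV (\<lambda>v. c *\<^sub>R ?T (v \<circ> \<sigma>))" for c :: real and \<sigma> :: "nat \<Rightarrow> nat"
      unfolding continuous_on_def by (intro ballI tendsto_scaleR_lc[OF tendsto_const]) simp
    then show ?thesis unfolding D continuous_on_def by (intro ballI tendsto_sum) blast
  qed
  ultimately show ?thesis unfolding lie_cochains_def by blast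
qed

end

subsection \<open>The Lie bracket and the derived action\<close>

lemma dir_deriv_affine:
  fixes F :: "'e::real_vector \<Rightarrow> 'f::{real_vector,t2_space}"
  assumes "\<And>t. g (u + t *\<^sub>R h) = F (y + t *\<^sub>R k)"
  shows "dir_deriv g u h = dir_deriv F y k"
proof -
  have "has_dir_deriv g u h = has_dir_deriv F y k"
    using assms[of 0] by (simp add: has_dir_deriv_def assms fun_eq_iff)
  then show ?thesis by (simp add: dir_deriv_def)
qed

text \<open>
  The calculus behind the appearance of the Lie bracket: \<open>\<mu>\<close> is a local multiplication with unit
  \<open>e\<close>, and \<open>E\<close> vanishes (up to a constant) on the diagonal, so that its second mixed derivative
  along \<open>(xy, yx)\<close> only sees the difference of the mixed derivatives of \<open>xy\<close> and \<open>yx\<close>.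
\<close>

lemma commutator_deriv:
  fixes \<mu> :: "'e::locally_convex \<times> 'e \<Rightarrow> 'e" and E :: "'e \<times> 'e \<Rightarrow> 'f::locally_convex"
  assumes \<mu>: "smooth_on N \<mu>" "open N" "(e, e) \<in> N"
    and unit: "open Q" "e \<in> Q" "\<And>u. u \<in> Q \<Longrightarrow> \<mu> (u, e) = u" "\<And>u. u \<in> Q \<Longrightarrow> \<mu> (e, u) = u"
    and E: "smooth_on V E" "open V" "(e, e) \<in> V" "\<And>p. p \<in> Q \<Longrightarrow> E (p, p) = c"
    and y: "y\<^sub>0 0 = e" "has_dir_deriv y\<^sub>0 0 (1::real) v\<^sub>0" "y\<^sub>1 0 = e" "has_dir_deriv y\<^sub>1 0 (1::real) v\<^sub>1"
  shows "\<exists>\<Phi>. eventually (\<lambda>a. has_dir_deriv (\<lambda>b. E (\<mu> (y\<^sub>0 a, y\<^sub>1 b), \<mu> (y\<^sub>1 b, y\<^sub>0 a))) 0 1 (\<Phi> a)) (at 0) \<and>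
      has_dir_deriv (\<lambda>b. E (\<mu> (y\<^sub>0 0, y\<^sub>1 b), \<mu> (y\<^sub>1 b, y\<^sub>0 0))) 0 1 (\<Phi> 0) \<and>
      has_dir_deriv \<Phi> 0 1 (iter_deriv E
        [(iter_deriv \<mu> [(v\<^sub>0, 0), (0, v\<^sub>1)] (e, e) - iter_deriv \<mu> [(v\<^sub>1, 0), (0, v\<^sub>0)] (e, e), 0)] (e, e))"
proof -
  \<comment> \<open>For fixed a, the velocities at b = 0 of the products xy and yx, where x = y_0(a)
    and y = y_1(b). Both products start at y_0(a).\<close>
  define \<xi> where "\<xi> a = iter_deriv \<mu> [(0, v\<^sub>1)] (y\<^sub>0 a, e)" for a
  define \<eta> where "\<eta> a = iter_deriv \<mu> [(v\<^sub>1, 0)] (e, y\<^sub>0 a)" for a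
  define \<Phi> where "\<Phi> a = iter_deriv E [(\<xi> a - \<eta> a, 0)] (y\<^sub>0 a, y\<^sub>0 a)" for a
  have deriv: "has_dir_deriv (\<lambda>b. E (\<mu> (y\<^sub>0 a, y\<^sub>1 b), \<mu> (y\<^sub>1 b, y\<^sub>0 a))) 0 1 (\<Phi> a)"
    if a: "(y\<^sub>0 a, e) \<in> N" "(e, y\<^sub>0 a) \<in> N" "y\<^sub>0 a \<in> Q" "(y\<^sub>0 a, y\<^sub>0 a) \<in> V" for a
  proof -
    have "has_dir_deriv (\<lambda>b. (y\<^sub>0 a, y\<^sub>1 b)) 0 1 (0, v\<^sub>1)"
      by (rule has_dir_deriv_Pair[OF has_dir_deriv_const y(4)])
    then have 1: "has_dir_deriv (\<lambda>b. \<mu> (y\<^sub>0 a, y\<^sub>1 b)) 0 1 (\<xi> a)"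
      using iter_deriv_chain_curve[OF \<mu>(1,2), of "\<lambda>b. (y\<^sub>0 a, y\<^sub>1 b)" "(0, v\<^sub>1)" "[]"] a(1) y(3) by (simp add: \<xi>_def)
    have "has_dir_deriv (\<lambda>b. (y\<^sub>1 b, y\<^sub>0 a)) 0 1 (v\<^sub>1, 0)"
      by (rule has_dir_deriv_Pair[OF y(4) has_dir_deriv_const])
    then have 2: "has_dir_deriv (\<lambda>b. \<mu> (y\<^sub>1 b, y\<^sub>0 a)) 0 1 (\<eta> a)"
      using iter_deriv_chain_curve[OF \<mu>(1,2), of "\<lambda>b. (y\<^sub>1 b, y\<^sub>0 a)" "(v\<^sub>1, 0)" "[]"] a(2) y(3) by (simp add: \<eta>_def)
    have at0: "\<mu> (y\<^sub>0 a, y\<^sub>1 0) = y\<^sub>0 a" "\<mu> (y\<^sub>1 0, y\<^sub>0 a) = y\<^sub>0 a" using unit(3,4)[OF a(3)] y(3) by simp_all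
    \<comment> \<open>E is constant on the diagonal, so its derivative in the diagonal direction
      (\<eta>, \<eta>) vanishes and the direction (\<xi>, \<eta>) may be replaced by (\<xi> -
      \<eta>, 0).\<close>
    have diag: "iter_deriv E [(\<eta> a, \<eta> a)] (y\<^sub>0 a, y\<^sub>0 a) = iter_deriv (\<lambda>_. c) [(\<eta> a, \<eta> a)] (y\<^sub>0 a, y\<^sub>0 a)"
    proof (rule iter_deriv_cong_on[of "Q \<times> Q" "{z. fst z = snd z}"])
      show "open (Q \<times> Q)" by (rule open_Times[OF unit(1) unit(1)])
    qed (use E(4) a(3) in auto)
    have "iter_deriv E [(\<xi> a, \<eta> a)] (y\<^sub>0 a, y\<^sub>0 a) = iter_deriv E [(\<xi> a - \<eta> a, 0) + (\<eta> a, \<eta> a)] (y\<^sub>0 a, y\<^sub>0 a)"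
      by simp
    also have "\<dots> = \<Phi> a + iter_deriv E [(\<eta> a, \<eta> a)] (y\<^sub>0 a, y\<^sub>0 a)"
      unfolding \<Phi>_def by (rule iter_deriv_head_add[OF E(1,2) a(4)])
    also have "\<dots> = \<Phi> a"
      unfolding diag by (simp add: iter_deriv_const del: iter_deriv.simps)
    finally have eq: "iter_deriv E [(\<xi> a, \<eta> a)] (y\<^sub>0 a, y\<^sub>0 a) = \<Phi> a" .
    have "has_dir_deriv (\<lambda>b. iter_deriv E [] (\<mu> (y\<^sub>0 a, y\<^sub>1 b), \<mu> (y\<^sub>1 b, y\<^sub>0 a))) 0 1
        (iter_deriv E [(\<xi> a, \<eta> a)] (\<mu> (y\<^sub>0 a, y\<^sub>1 0), \<mu> (y\<^sub>1 0, y\<^sub>0 a)))"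
      by (rule iter_deriv_chain_curve[OF E(1,2) _ has_dir_deriv_Pair[OF 1 2]]) (simp add: at0 a(4))
    then show ?thesis unfolding at0 eq by simp
  qed
  have y0: "(y\<^sub>0 \<longlongrightarrow> e) (at 0)" using has_dir_deriv_tendsto[OF y(2)] y(1) by simp
  have "eventually (\<lambda>a. (y\<^sub>0 a, e) \<in> N) (at 0)"
    by (rule topological_tendstoD[OF tendsto_Pair[OF y0 tendsto_const] \<mu>(2,3)])
  moreover have "eventually (\<lambda>a. (e, y\<^sub>0 a) \<in> N) (at 0)"
    by (rule topological_tendstoD[OF tendsto_Pair[OF tendsto_const y0] \<mu>(2,3)])
  moreover have "eventually (\<lambda>a. y\<^sub>0 a \<in> Q) (at 0)"
    by (rule topological_tendstoD[OF y0 unit(1,2)])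
  moreover have "eventually (\<lambda>a. (y\<^sub>0 a, y\<^sub>0 a) \<in> V) (at 0)"
    by (rule topological_tendstoD[OF tendsto_Pair[OF y0 y0] E(2,3)])
  ultimately have ev: "eventually (\<lambda>a. has_dir_deriv (\<lambda>b. E (\<mu> (y\<^sub>0 a, y\<^sub>1 b), \<mu> (y\<^sub>1 b, y\<^sub>0 a))) 0 1 (\<Phi> a)) (at 0)"
    by eventually_elim (rule deriv)
  have d\<xi>: "has_dir_deriv \<xi> 0 1 (iter_deriv \<mu> [(v\<^sub>0, 0), (0, v\<^sub>1)] (e, e))"
    unfolding \<xi>_def
    using iter_deriv_chain_curve[OF \<mu>(1,2) _ has_dir_deriv_Pair[OF y(2) has_dir_deriv_const], of e "[(0, v\<^sub>1)]"] \<mu>(3) y(1) by simp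
  have "has_dir_deriv \<eta> 0 1 (iter_deriv \<mu> [(0, v\<^sub>0), (v\<^sub>1, 0)] (e, e))"
    unfolding \<eta>_def
    using iter_deriv_chain_curve[OF \<mu>(1,2) _ has_dir_deriv_Pair[OF has_dir_deriv_const y(2)], of e "[(v\<^sub>1, 0)]"] \<mu>(3) y(1) by simp
  then have d\<eta>: "has_dir_deriv \<eta> 0 1 (iter_deriv \<mu> [(v\<^sub>1, 0), (0, v\<^sub>0)] (e, e))"
    unfolding iter_deriv_schwarz[OF \<mu>, of "(0, v\<^sub>0)"] .
  let ?B = "iter_deriv \<mu> [(v\<^sub>0, 0), (0, v\<^sub>1)] (e, e) - iter_deriv \<mu> [(v\<^sub>1, 0), (0, v\<^sub>0)] (e, e)"
  have "\<xi> 0 = v\<^sub>1"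
  proof -
    have "has_dir_deriv \<mu> (e, e) (0, v\<^sub>1) v\<^sub>1"
    proof (rule has_dir_deriv_cong[THEN iffD2, of _ _ _ snd])
      show "\<forall>\<^sub>F t in at 0. \<mu> ((e, e) + t *\<^sub>R (0, v\<^sub>1)) = snd ((e, e) + t *\<^sub>R (0, v\<^sub>1))"
        using eventually_line[OF unit(1,2), of v\<^sub>1] by (rule eventually_mono) (simp add: unit(4))
      show "has_dir_deriv snd (e, e) (0, v\<^sub>1) v\<^sub>1"
        using has_dir_deriv_id[of e v\<^sub>1] by (simp add: has_dir_deriv_def)
    qed (simp add: unit)
    then show ?thesis by (simp add: \<xi>_def y(1) dir_derivI)
  qed
  moreover have "\<eta> 0 = v\<^sub>1"
  proof -
    have "has_dir_deriv \<mu> (e, e) (v\<^sub>1, 0) v\<^sub>1"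
    proof (rule has_dir_deriv_cong[THEN iffD2, of _ _ _ fst])
      show "\<forall>\<^sub>F t in at 0. \<mu> ((e, e) + t *\<^sub>R (v\<^sub>1, 0)) = fst ((e, e) + t *\<^sub>R (v\<^sub>1, 0))"
        using eventually_line[OF unit(1,2), of v\<^sub>1] by (rule eventually_mono) (simp add: unit(3))
      show "has_dir_deriv fst (e, e) (v\<^sub>1, 0) v\<^sub>1"
        using has_dir_deriv_id[of e v\<^sub>1] by (simp add: has_dir_deriv_def)
    qed (simp add: unit)
    then show ?thesis by (simp add: \<eta>_def y(1) dir_derivI)
  qed
  \<comment> \<open>At a = 0 one factor is the unit and both products move with velocity v_1. Hence
    in the product rule for \<Phi> the term with second derivatives of E has direction 0 and drops
    out; only the derivative of \<xi> - \<eta> is left.\<close>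
  ultimately have \<xi>\<eta>: "\<xi> 0 - \<eta> 0 = 0" by simp
  have "has_dir_deriv (\<lambda>a. (\<xi> a - \<eta> a, 0 :: 'e)) 0 1 (?B, 0)"
    by (rule has_dir_deriv_Pair[OF has_dir_deriv_diff[OF d\<xi> d\<eta>] has_dir_deriv_const])
  then have "list_all2 (\<lambda>w l. has_dir_deriv w 0 1 l) [\<lambda>a. (\<xi> a - \<eta> a, 0 :: 'e)] [(?B, 0)]" by simp
  from iter_deriv_product_rule[OF E(1,2) _ has_dir_deriv_Pair[OF y(2) y(2)] this]
  have "has_dir_deriv \<Phi> 0 1 (iter_deriv E [(v\<^sub>0, v\<^sub>0), (\<xi> 0 - \<eta> 0, 0)] (e, e) + iter_deriv E [(?B, 0)] (e, e))"
    using E(3) by (simp add: \<Phi>_def[abs_def] y(1) del: iter_deriv.simps)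
  moreover have "iter_deriv E [(v\<^sub>0, v\<^sub>0), (\<xi> 0 - \<eta> 0, 0)] (e, e) = 0"
    by (rule iter_deriv_zero_dir) (simp add: \<xi>\<eta> zero_prod_def)
  ultimately have d\<Phi>: "has_dir_deriv \<Phi> 0 1 (iter_deriv E [(?B, 0)] (e, e))" by simp
  have "has_dir_deriv (\<lambda>b. E (\<mu> (y\<^sub>0 0, y\<^sub>1 b), \<mu> (y\<^sub>1 b, y\<^sub>0 0))) 0 1 (\<Phi> 0)"
    by (rule deriv) (simp_all add: y(1) \<mu> unit E)
  with ev d\<Phi> show ?thesis by blast
qed

context lie_module
begin

definition chart_act :: "'e \<times> 'b \<Rightarrow> 'b"
  where "chart_act = (\<lambda>z. snd ach (act (chart_inv gch (fst z)) (chart_inv ach (snd z))))"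

definition chart_mult :: "'e \<times> 'e \<Rightarrow> 'e"
  where "chart_mult = (\<lambda>z. snd gch (chart_inv gch (fst z) * chart_inv gch (snd z)))"

lemma chart_act_smooth:
  obtains N where "smooth_on N chart_act" "open N" "(e\<^sub>0, b\<^sub>0) \<in> N"
  using near_act unfolding smooth_near_def chart_act_def by blast

lemma chart_mult_smooth:
  obtains N where "smooth_on N chart_mult" "open N" "(e\<^sub>0, e\<^sub>0) \<in> N"
    "\<And>z. z \<in> N \<Longrightarrow> chart_inv gch (fst z) * chart_inv gch (snd z) \<in> fst gch"
  using near_mult unfolding smooth_near_def chart_mult_def by blast

lemma lie_act_eq: "lie_act G A act x w = iter_deriv chart_act [(x, 0), (0, w)] (e\<^sub>0, b\<^sub>0)"
proof -
  have 1: "derived_act A act (chart_inv gch u) w = iter_deriv chart_act [(0, w)] (u, b\<^sub>0)" for u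
    unfolding derived_act_def tangent_map_def act_0 b\<^sub>0_def[symmetric] iter_deriv.simps
    by (rule dir_deriv_affine) (simp add: chart_act_def)
  have "lie_act G A act x w = dir_deriv (\<lambda>u. iter_deriv chart_act [(0, w)] (u, b\<^sub>0)) e\<^sub>0 x"
    unfolding lie_act_def tangent_map_def[of G vector_manifold] by (simp add: o_def 1 e\<^sub>0_def del: iter_deriv.simps)
  also have "\<dots> = dir_deriv (iter_deriv chart_act [(0, w)]) (e\<^sub>0, b\<^sub>0) (x, 0)"
    by (rule dir_deriv_affine) simp
  finally show ?thesis by simp
qed

lemma lie_act_linear: "linear (lie_act G A act x)"
proof -
  obtain N where N: "smooth_on N chart_act" "open N" "(e\<^sub>0, b\<^sub>0) \<in> N" by (rule chart_act_smooth)
  show ?thesis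
    unfolding linear_iff lie_act_eq
    using iter_deriv_mid_add[OF N, of "[(x, 0)]" "(0, _)" "(0, _)" "[]"] iter_deriv_mid_scaleR[OF N, of "[(x, 0)]" _ "(0, _)" "[]"]
    by (simp del: iter_deriv.simps)
qed

text \<open>In the chart the left invariant field of x is the partial derivative of the
  multiplication in its second factor, with value x at the unit. The bracket is therefore the
  antisymmetrised mixed second derivative of the multiplication, the form in which
  \<open>commutator_deriv\<close> produces it.\<close>

lemma lie_bracket_eq:
  "lie_bracket G x y = iter_deriv chart_mult [(x, 0), (0, y)] (e\<^sub>0, e\<^sub>0) - iter_deriv chart_mult [(y, 0), (0, x)] (e\<^sub>0, e\<^sub>0)"
proof -
  have field: "left_inv_field G x u = iter_deriv chart_mult [(0, x)] (u, e\<^sub>0)" for x u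
    unfolding left_inv_field_def Let_def e\<^sub>0_def[symmetric] iter_deriv.simps
    by (rule dir_deriv_affine) (simp add: chart_mult_def)
  have O: "open (snd gch ` fst gch)" "e\<^sub>0 \<in> snd gch ` fst gch"
    using gch unfolding is_chart_def e\<^sub>0_def by blast+
  have at_1: "left_inv_field G x e\<^sub>0 = x" for x
  proof -
    have "has_dir_deriv (\<lambda>w. snd gch (chart_inv gch e\<^sub>0 * chart_inv gch w)) e\<^sub>0 x x"
    proof (rule has_dir_deriv_cong[THEN iffD2, of _ _ _ "\<lambda>w. w"])
      show "\<forall>\<^sub>F t in at 0. snd gch (chart_inv gch e\<^sub>0 * chart_inv gch (e\<^sub>0 + t *\<^sub>R x)) = e\<^sub>0 + t *\<^sub>R x"
        using eventually_line[OF O, of x] by (rule eventually_mono) (simp add: chart_inv_e\<^sub>0 chart_chart_inv)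
      show "has_dir_deriv (\<lambda>w. w) e\<^sub>0 x x" by (rule has_dir_deriv_id)
    qed (simp add: chart_inv_e\<^sub>0, simp add: e\<^sub>0_def)
    then show ?thesis unfolding left_inv_field_def Let_def e\<^sub>0_def[symmetric] by (rule dir_derivI)
  qed
  have "dir_deriv (left_inv_field G y) e\<^sub>0 x = iter_deriv chart_mult [(x, 0), (0, y)] (e\<^sub>0, e\<^sub>0)" for x y
    unfolding iter_deriv.simps(2)[of chart_mult "(x, 0)"] by (rule dir_deriv_affine) (simp add: field del: iter_deriv.simps)
  then show ?thesis
    unfolding lie_bracket_def Let_def e\<^sub>0_def[symmetric] at_1 by simp
qed

lemma lie_bracket_antisym: "lie_bracket G y x = - lie_bracket G x y"
  by (simp add: lie_bracket_eq)

lemma merge_entries_fix: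
  assumes "1 \<le> i" "g i = (1::'g)"
  shows "merge_entries i g = merge_entries (Suc i) g"
  using assms by (auto simp: merge_entries_def fun_eq_iff)

text \<open>If g_i = 1, all but two terms vanish by normalisation of f, and these two cancel: the
  action term and j = 1 for i = 0, the terms j = i and j = i + 1 for 0 < i < n, the term j = n and
  the last term for i = n.\<close>

lemma loc_cochains_group_diff:
  assumes f: "f \<in> loc_cochains n" and n: "n > 0"
  shows "group_diff act n f \<in> loc_cochains (Suc n)"
proof -
  have dep: "\<And>x y. (\<And>i. i < n \<Longrightarrow> x i = y i) \<Longrightarrow> f x = f y" and norm: "\<And>g i. i < n \<Longrightarrow> g i = 1 \<Longrightarrow> f g = 0"
    using f unfolding loc_cochains_def depends_below_def by blast+
  have "depends_below (Suc n) (group_diff act n f)"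
    unfolding depends_below_def
  proof (intro allI impI)
    fix x y :: "nat \<Rightarrow> 'g" assume xy: "\<forall>i<Suc n. x i = y i"
    have "f (merge_entries j x) = f (merge_entries j y)" if "j \<in> {1..n}" for j
      by (rule dep) (use xy that in \<open>auto simp: merge_entries_def\<close>)
    then have "(\<Sum>j=1..n. alt_sign j (f (merge_entries j x))) = (\<Sum>j=1..n. alt_sign j (f (merge_entries j y)))"
      by (intro sum.cong refl arg_cong[where f = "alt_sign _"])
    moreover have "f (\<lambda>k. x (Suc k)) = f (\<lambda>k. y (Suc k))" "f x = f y"
      by (rule dep; use xy in auto)+
    ultimately show "group_diff act n f x = group_diff act n f y"
      unfolding group_diff_def using xy by simp
  qed
  moreover have "group_diff act n f g = 0" if i: "i < Suc n" "g i = 1" for g i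
  proof -
    let ?t = "\<lambda>j. alt_sign j (f (merge_entries j g))"
    have other: "?t j = 0" if "j \<in> {1..n}" "j \<noteq> i" "j \<noteq> Suc i" for j
    proof -
      have "merge_entries j g (if i < j then i else i - 1) = 1"
        using that i by (auto simp: merge_entries_def)
      then have "f (merge_entries j g) = 0"
        using that i by (intro norm[of "if i < j then i else i - 1"]) (auto split: if_splits)
      then show ?thesis by (simp add: alt_sign_def)
    qed
    consider "i = 0" | "1 \<le> i" "i < n" | "i = n" "1 \<le> i" using i(1) n by linarith
    then show ?thesis
    proof cases
      case 1
      have "(\<Sum>j=1..n. ?t j) = (\<Sum>j\<in>{1}. ?t j)"
        by (rule sum.mono_neutral_right) (use n other 1 in auto)
      also have "\<dots> = - f (\<lambda>k. g (Suc k))"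
      proof -
        have "merge_entries 1 g = (\<lambda>k. g (Suc k))"
          using 1 i(2) by (auto simp: merge_entries_def fun_eq_iff)
        then show ?thesis by (simp add: alt_sign_def)
      qed
      finally have "(\<Sum>j=1..n. ?t j) = - f (\<lambda>k. g (Suc k))" .
      then show ?thesis
        unfolding group_diff_def using 1 i(2) n by (simp add: act_simps norm[of 0] alt_sign_def)
    next
      case 2
      have "(\<Sum>j=1..n. ?t j) = (\<Sum>j\<in>{i, Suc i}. ?t j)"
        by (rule sum.mono_neutral_right) (use other 2 in auto)
      also have "\<dots> = 0"
        using merge_entries_fix[of i g] 2 i(2) by (simp add: alt_sign_def)
      finally have "(\<Sum>j=1..n. ?t j) = 0" .
      moreover have "f (\<lambda>k. g (Suc k)) = 0" by (rule norm[of "i - 1"]) (use 2 i(2) in auto)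
      moreover have "f g = 0" by (rule norm[of i]) (use 2 i(2) in auto)
      ultimately show ?thesis unfolding group_diff_def by (simp add: act_0 alt_sign_def)
    next
      case 3
      have "(\<Sum>j=1..n. ?t j) = (\<Sum>j\<in>{n}. ?t j)"
        by (rule sum.mono_neutral_right) (use other 3 in auto)
      moreover have "f (merge_entries n g) = f g"
        by (rule dep) (use 3 i(2) in \<open>auto simp: merge_entries_def\<close>)
      moreover have "f (\<lambda>k. g (Suc k)) = 0" by (rule norm[of "i - 1"]) (use 3 i(2) n in auto)
      ultimately show ?thesis unfolding group_diff_def by (simp add: act_0 alt_sign_def)
    qed
  qed
  moreover have "germ\<^sub>A (\<lambda>u. group_diff act n f (\<lambda>i. chart_inv gch (u i))) (\<lambda>_. e\<^sub>0)"
  proof -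
    have c: "germ\<^sub>G (\<lambda>u. chart_inv gch (u i)) (\<lambda>_. e\<^sub>0)" for i :: nat
      by (rule germ\<^sub>G_compose[OF germ\<^sub>G_chart_inv smooth_on_coordinate[OF open_UNIV]]) simp_all
    have m: "germ\<^sub>G (\<lambda>u. merge_entries j (\<lambda>i. chart_inv gch (u i)) k) (\<lambda>_. e\<^sub>0)" for j k
      unfolding merge_entries_def by (cases "k < j - 1"; cases "k = j - 1") (simp_all add: c germ\<^sub>G_mult)
    show ?thesis
      unfolding group_diff_def
      by (intro germ\<^sub>A_add germ\<^sub>A_sum germ\<^sub>A_alt_sign germ\<^sub>A_act c germ\<^sub>A_cochain[OF f m]
          germ\<^sub>A_cochain[OF f, of "\<lambda>i u. chart_inv gch (u (Suc i))"] germ\<^sub>A_cochain[OF f, of "\<lambda>i u. chart_inv gch (u i)"])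
  qed
  ultimately show ?thesis unfolding loc_cochains_def by blast
qed

end

lemma upt_split: "i < n \<Longrightarrow> [0..<n] = [0..<i] @ i # [Suc i..<n]"
  using upt_add_eq_append[of 0 i "n - i"] by (simp add: upt_conv_Cons)

section \<open>Mixed derivatives of the terms of the group differential\<close>

context lie_module
begin

lemma velocityE:
  assumes "velocity \<gamma> v"
  obtains I where "open I" "0 \<in> I" "\<And>s. s \<in> I \<Longrightarrow> \<gamma> s \<in> fst gch" "smooth_on I (\<lambda>s. snd gch (\<gamma> s))"
    "\<gamma> 0 = 1" "has_dir_deriv (\<lambda>s. snd gch (\<gamma> s)) 0 1 v"
  using assms unfolding velocity_def germ\<^sub>G_def smooth_near_def by blast

text \<open>The cochain factor vanishes at t_n = 0. Once differentiated in t_n, it enters the action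
  only through the derivative at 0 in the module variable, a continuous linear map that commutes
  with the derivatives in t_1, ..., t_{n-1}; differentiating this map in t_0 gives the derived
  action.\<close>

lemma mixed_deriv_act:
  assumes f: "f \<in> loc_cochains n" and n: "n > 0" and \<gamma>: "\<And>k. velocity (\<gamma> k) (v k)"
  shows "mixed_deriv A (Suc n) (\<lambda>t. act (\<gamma> 0 (t 0)) (f (\<lambda>k. \<gamma> (Suc k) (t (Suc k)))))
    = lie_act G A act (v 0) (cochain_deriv n f (\<lambda>k. v (Suc k)))"
proof -
  have norm: "\<And>g i. i < n \<Longrightarrow> g i = 1 \<Longrightarrow> f g = 0"
    using f unfolding loc_cochains_def by blast
  define p where "p t = f (\<lambda>k. \<gamma> (Suc k) (t (Suc k)))" for t :: "nat \<Rightarrow> real"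
  have "germ\<^sub>A p 0"
    unfolding p_def using \<gamma>
    by (intro germ\<^sub>A_cochain[OF f, of "\<lambda>k t. \<gamma> (Suc k) (t (Suc k))"] germ\<^sub>G_coordinate) (simp add: velocity_def)
  then obtain U where U: "open U" "0 \<in> U" "\<And>t. t \<in> U \<Longrightarrow> p t \<in> fst ach" "smooth_on U (\<lambda>t. snd ach (p t))"
    by (rule germ\<^sub>AE) blast
  obtain I where I: "open I" "0 \<in> I" "\<And>s. s \<in> I \<Longrightarrow> \<gamma> 0 s \<in> fst gch" "smooth_on I (\<lambda>s. snd gch (\<gamma> 0 s))"
    "\<gamma> 0 0 = 1" "has_dir_deriv (\<lambda>s. snd gch (\<gamma> 0 s)) 0 1 (v 0)"
    using \<gamma>[of 0] by (rule velocityE) blast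
  obtain N where N: "smooth_on N chart_act" "open N" "(e\<^sub>0, b\<^sub>0) \<in> N" by (rule chart_act_smooth)
  define x where "x s = snd gch (\<gamma> 0 s)" for s
  define P where "P t = snd ach (p t)" for t
  define H where "H t = snd ach (act (\<gamma> 0 (t 0)) (p t))" for t
  have x0: "x 0 = e\<^sub>0" by (simp add: x_def I(5) e\<^sub>0_def)
  have P: "smooth_on U P" using U(4) unfolding P_def[abs_def] .
  have p_zero: "p t = 0" if "t n = 0" for t :: "nat \<Rightarrow> real"
  proof -
    have "\<gamma> (Suc (n - 1)) (t (Suc (n - 1))) = 1"
      using that n \<gamma>[of n] by (simp add: velocity_def germ\<^sub>G_def)
    then show ?thesis unfolding p_def using n by (intro norm[of "n - 1"]) auto
  qed
  have P_zero: "P t = b\<^sub>0" if "t n = 0" for t :: "nat \<Rightarrow> real"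
    using that by (simp add: P_def b\<^sub>0_def p_zero)
  define U1 where "U1 = U \<inter> (\<lambda>t. t 0) -` I"
  have U1: "open U1" unfolding U1_def by (intro open_Int U(1) open_vimage_coordinate I(1))
  define Z where "Z t = (x (t 0), P t)" for t
  define Z2 where "Z2 t = (x (t 0), b\<^sub>0)" for t :: "nat \<Rightarrow> real"
  have sx: "smooth_on U1 (\<lambda>t. x (t 0))"
    unfolding x_def by (rule smooth_on_compose[OF I(4,1) smooth_on_coordinate[OF U1] U1]) (simp add: U1_def)
  have P1: "smooth_on U1 P" by (rule smooth_on_subset[OF P]) (simp add: U1_def)
  have Zc: "continuous_on U1 Z" "continuous_on U1 Z2"
    unfolding Z_def[abs_def] Z2_def[abs_def]
    by (rule smooth_on_imp_continuous_on[OF smooth_on_Pair(1)[OF sx _ U1] U1] P1 smooth_on_const[OF U1])+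
  define W where "W = (Z -` N \<inter> U1) \<inter> (Z2 -` N \<inter> U1)"
  have "open (Z -` N \<inter> U1)" "open (Z2 -` N \<inter> U1)"
    using Zc U1 N(2) by (simp_all add: continuous_on_open_vimage)
  then have W: "open W" unfolding W_def by (rule open_Int)
  have W0: "0 \<in> W"
    unfolding W_def Z_def Z2_def U1_def using x0 P_zero[of 0] N(3) U(2) I(2) by simp
  have H_eq: "H t = chart_act (Z t)" if "t \<in> U1" for t
    using that U(3)[of t] I(3)[of "t 0"]
    by (simp add: U1_def H_def chart_act_def Z_def x_def P_def chart_inv_chart[OF gch(1)] chart_inv_chart[OF ach(1)])
  \<comment> \<open>The derivative of the action in the module variable at the base point q, as a
    map of its direction w.\<close>
  let ?T = "\<lambda>q w. iter_deriv chart_act [(0, w)] q"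
  have T_lin: "linear (?T q)" and T_cont: "continuous_on UNIV (?T q)" if q: "q \<in> N" for q
  proof -
    show "linear (?T q)"
      unfolding linear_iff
      using iter_deriv_head_add[OF N(1,2) q, of "(0, _)" "(0, _)" "[]"] iter_deriv_head_scaleR[OF N(1,2) q, of _ "(0, _)" "[]"]
      by (simp del: iter_deriv.simps)
    show "continuous_on UNIV (?T q)"
      unfolding continuous_on_def
    proof
      fix w :: 'b
      have "list_all2 (\<lambda>w' l. (w' \<longlongrightarrow> l) (at w)) [\<lambda>w. (0 :: 'e, w)] [(0, w)]"
        using tendsto_Pair[OF tendsto_const tendsto_ident_at, of "0::'e" w UNIV] by simp
      from smooth_on_tendsto[OF N(1,2) q tendsto_const this]
      show "(?T q \<longlongrightarrow> ?T q w) (at w)" by (simp del: iter_deriv.simps)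
    qed
  qed
  have stay: "eventually (\<lambda>s. t + s *\<^sub>R h \<in> W) (at 0)" if "t \<in> W" for t h :: "nat \<Rightarrow> real"
    using eventually_line[OF W that] .
  \<comment> \<open>The innermost derivative is in t_n, on the hyperplane where p vanishes. The
    directions in \<open>ks\<close> move neither t_0 nor t_n, so the base point
    \<open>(x (t 0), b\<^sub>0)\<close> of the linear map stays fixed.\<close>
  have claim: "iter_deriv H (map unit ks @ [unit n]) t = ?T (x (t 0), b\<^sub>0) (iter_deriv P (map unit ks @ [unit n]) t)"
    if "set ks \<subseteq> {1..<n}" "t \<in> W" "t n = 0" for ks t
    using that
  proof (induction ks arbitrary: t)
    case Nil
    have t: "t \<in> U1" "t \<in> U" "Z t \<in> N" using Nil(2) by (auto simp: W_def U1_def)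
    have Zt: "Z t = (x (t 0), b\<^sub>0)" using P_zero[of t] Nil(3) by (simp add: Z_def)
    have "has_dir_deriv (\<lambda>t. x (t 0)) t (unit n) 0"
      using n by (simp add: has_dir_deriv_def single_def scaleR_fun_def)
    moreover have "has_dir_deriv P t (unit n) (iter_deriv P [unit n] t)"
      using smooth_on_deriv[OF P t(2), of "[]" "unit n"] by simp
    ultimately have "has_dir_deriv Z t (unit n) (0, iter_deriv P [unit n] t)"
      unfolding Z_def[abs_def] by (rule has_dir_deriv_Pair)
    from iter_deriv_chain[OF N(1,2) t(3) this, of "[]"]
    have "has_dir_deriv (\<lambda>t. chart_act (Z t)) t (unit n) (?T (Z t) (iter_deriv P [unit n] t))" by simp
    then have "has_dir_deriv H t (unit n) (?T (Z t) (iter_deriv P [unit n] t))"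
      by (rule has_dir_deriv_cong[THEN iffD2, rotated 2])
        (auto intro!: eventually_mono[OF eventually_line[OF U1 t(1)]] H_eq t(1))
    then show ?case unfolding Zt by (simp add: dir_derivI)
  next
    case (Cons k ks)
    let ?L = "map unit ks @ [unit n]"
    have k: "k \<noteq> 0" "k \<noteq> n" "set ks \<subseteq> {1..<n}" using Cons.prems(1) by auto
    have t: "t \<in> U" "(x (t 0), b\<^sub>0) \<in> N" using Cons.prems(2) by (auto simp: W_def U1_def Z2_def)
    let ?q = "(x (t 0), b\<^sub>0)"
    have "has_dir_deriv (\<lambda>t. ?T ?q (iter_deriv P ?L t)) t (unit k) (?T ?q (iter_deriv P (unit k # ?L) t))"
      by (rule has_dir_deriv_cont_linear[OF T_lin[OF t(2)] T_cont[OF t(2)] smooth_on_deriv[OF P t(1)]])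
    moreover have "eventually (\<lambda>s. iter_deriv H ?L (t + s *\<^sub>R unit k) = ?T ?q (iter_deriv P ?L (t + s *\<^sub>R unit k))) (at 0)"
      using stay[OF Cons.prems(2), of "unit k"]
    proof eventually_elim
      case (elim s)
      have "(t + s *\<^sub>R unit k) n = 0" "(t + s *\<^sub>R unit k) 0 = t 0"
        using k(1,2) Cons.prems(3) by (simp_all add: add_scaleR_single)
      then show ?case using Cons.IH[OF k(3) elim] by (simp only:)
    qed
    moreover have "iter_deriv H ?L t = ?T ?q (iter_deriv P ?L t)" by (rule Cons.IH[OF k(3) Cons.prems(2,3)])
    ultimately have "has_dir_deriv (iter_deriv H ?L) t (unit k) (?T ?q (iter_deriv P (unit k # ?L) t))"
      by (simp only: has_dir_deriv_cong)
    then show ?case by (simp add: dir_derivI)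
  qed
  let ?L = "map unit [1..<n] @ [unit n]"
  define w where "w = iter_deriv P ?L 0"
  \<comment> \<open>p does not contain t_0, so the entire dependence on t_0 sits in the base point
    of the action.\<close>
  have P_const: "iter_deriv P ?L (s *\<^sub>R unit 0) = w" for s
  proof -
    have "P (t(0 := 0)) = P t" for t by (simp add: P_def p_def)
    then have "iter_deriv P ?L (s *\<^sub>R unit 0) = iter_deriv (\<lambda>t. P (t(0 := 0))) ?L (s *\<^sub>R unit 0)" by simp
    also have "\<dots> = iter_deriv P (map (\<lambda>t. t(0 := 0)) ?L) ((s *\<^sub>R unit 0)(0 := 0))"
      by (rule iter_deriv_linear_comp[OF linear_fun_upd_0])
    also have "map (\<lambda>t::nat \<Rightarrow> real. t(0 := 0)) ?L = ?L"
      by (rule map_idI) (use n in \<open>auto simp: single_def fun_eq_iff\<close>)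
    also have "(s *\<^sub>R unit 0)(0 := 0) = 0" by (auto simp: single_def scaleR_fun_def fun_eq_iff)
    finally show ?thesis unfolding w_def .
  qed
  have "has_dir_deriv (\<lambda>s. (x s, b\<^sub>0)) 0 1 (v 0, 0)"
    unfolding x_def by (rule has_dir_deriv_Pair[OF I(6) has_dir_deriv_const])
  from iter_deriv_chain_curve[OF N(1,2) _ this, of "[(0, w)]"]
  have "has_dir_deriv (\<lambda>s. ?T (x s, b\<^sub>0) w) 0 1 (iter_deriv chart_act [(v 0, 0), (0, w)] (e\<^sub>0, b\<^sub>0))"
    using N(3) x0 by (simp del: iter_deriv.simps)
  moreover have "eventually (\<lambda>s. iter_deriv H ?L (0 + s *\<^sub>R unit 0) = ?T (x (0 + s *\<^sub>R 1), b\<^sub>0) w) (at 0)"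
    using stay[OF W0, of "unit 0"]
  proof eventually_elim
    case (elim s)
    have "(0 + s *\<^sub>R unit 0) n = 0" "(0 + s *\<^sub>R unit 0) 0 = s"
      using n by (simp_all add: single_def scaleR_fun_def)
    then show ?case using claim[OF _ elim, of "[1..<n]"] P_const[of s] by simp
  qed
  moreover have "iter_deriv H ?L 0 = ?T (x 0, b\<^sub>0) w"
    using claim[of "[1..<n]" 0] W0 by (simp add: w_def)
  ultimately have "has_dir_deriv (iter_deriv H ?L) 0 (unit 0) (iter_deriv chart_act [(v 0, 0), (0, w)] (e\<^sub>0, b\<^sub>0))"
    unfolding has_dir_deriv_curve[of "iter_deriv H ?L"]
    by (subst has_dir_deriv_cong[where g = "\<lambda>s. ?T (x s, b\<^sub>0) w"]) simp_all
  then have main: "iter_deriv H (unit 0 # ?L) 0 = lie_act G A act (v 0) w"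
    by (simp add: dir_derivI lie_act_eq)
  have L_eq: "?L = map (\<lambda>k. unit (Suc k)) [0..<n]"
  proof -
    have "?L = map unit [Suc 0..<Suc n]" using n by simp
    also have "\<dots> = map (\<lambda>k. unit (Suc k)) [0..<n]" by (simp only: map_Suc_upt[symmetric] map_map o_def)
    finally show ?thesis .
  qed
  have "w = cochain_deriv n f (\<lambda>k. v (Suc k))"
    unfolding w_def L_eq P_def[abs_def] p_def
    by (rule cochain_deriv_curves[OF f, of Suc "\<lambda>k. \<gamma> (Suc k)"]) (simp_all add: \<gamma>)
  moreover have "mixed_deriv A (Suc n) (\<lambda>t. act (\<gamma> 0 (t 0)) (p t)) = iter_deriv H (map unit [0..<Suc n]) 0"
    unfolding mixed_deriv_Suc H_def[abs_def] using p_zero by (simp add: act_0)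
  moreover have "map unit [0..<Suc n] = unit 0 # ?L"
    using n by (simp add: upt_conv_Cons)
  ultimately show ?thesis using main unfolding p_def by simp
qed

text \<open>The difference of the two terms is formed in A before passing to the chart, so that it
  is 0 whenever the two products in slot i coincide. By \<open>commutator_deriv\<close> its second
  derivative in t_i and t_{i+1} is then a first derivative in slot i, along the bracket, and the
  remaining parameters still enter one slot each.\<close>

lemma mixed_deriv_commutator:
  assumes f: "f \<in> loc_cochains n" and i: "i < n" and \<gamma>: "\<And>k. velocity (\<gamma> k) (v k)"
  shows "mixed_deriv A (Suc n) (\<lambda>t. f (merge_entries (Suc i) (\<lambda>k. \<gamma> k (t k))))
    - mixed_deriv A (Suc n) (\<lambda>t. f (\<lambda>k. if k < i then \<gamma> k (t k)
        else if k = i then \<gamma> (Suc i) (t (Suc i)) * \<gamma> i (t i) else \<gamma> (Suc k) (t (Suc k))))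
    = cochain_deriv n f (\<lambda>k. if k < i then v k else if k = i then lie_bracket G (v i) (v (Suc i)) else v (Suc k))"
proof -
  have norm: "\<And>g i. i < n \<Longrightarrow> g i = 1 \<Longrightarrow> f g = 0"
    using f unfolding loc_cochains_def by blast
  let ?j = "Suc i"
  define slot where "slot z t = (\<lambda>k. if k < i then \<gamma> k (t k) else if k = i then z else \<gamma> (Suc k) (t (Suc k)))"
    for z :: 'g and t :: "nat \<Rightarrow> real"
  define h where "h t = f (slot (\<gamma> i (t i) * \<gamma> ?j (t ?j)) t)" for t
  define k where "k t = f (slot (\<gamma> ?j (t ?j) * \<gamma> i (t i)) t)" for t
  have \<gamma>germ: "germ\<^sub>G (\<gamma> k) 0" and \<gamma>0: "\<gamma> k 0 = 1" for k
    using \<gamma>[of k] by (simp_all add: velocity_def germ\<^sub>G_def)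
  have slot_germ: "germ\<^sub>A (\<lambda>x. f (slot (z x) (T x))) q"
    if z: "germ\<^sub>G z q" and T: "\<And>k. germ\<^sub>G (\<lambda>x. \<gamma> k (T x k)) q" for z q and T :: "'p::locally_convex \<Rightarrow> nat \<Rightarrow> real"
    unfolding slot_def
  proof (rule germ\<^sub>A_cochain[OF f])
    fix k
    show "germ\<^sub>G (\<lambda>x. if k < i then \<gamma> k (T x k) else if k = i then z x else \<gamma> (Suc k) (T x (Suc k))) q"
      by (cases "k < i"; cases "k = i") (simp_all add: z T)
  qed
  have \<gamma>c: "germ\<^sub>G (\<lambda>t. \<gamma> k (t k)) 0" for k by (rule germ\<^sub>G_coordinate[OF \<gamma>germ])
  have hg: "germ\<^sub>A h 0" unfolding h_def[abs_def] by (rule slot_germ[OF germ\<^sub>G_mult[OF \<gamma>c \<gamma>c] \<gamma>c])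
  have kg: "germ\<^sub>A k 0" unfolding k_def[abs_def] by (rule slot_germ[OF germ\<^sub>G_mult[OF \<gamma>c \<gamma>c] \<gamma>c])
  define F where "F t = snd ach (h t - k t)" for t
  obtain U where U: "smooth_on U F" "open U" "0 \<in> U"
    using germ\<^sub>A_diff[OF hg kg] unfolding germ\<^sub>A_def smooth_near_def F_def[abs_def] by blast
  \<comment> \<open>If i + 1 = n, one factor is 1 at t_n = 0 and the two products agree; otherwise
    t_n = 0 puts 1 into the last slot of both terms.\<close>
  have hk_zero: "h (t(n := 0)) - k (t(n := 0)) = 0" for t
  proof (cases "?j = n")
    case True
    then show ?thesis by (simp add: h_def k_def \<gamma>0)
  next
    case False
    have "slot z (t(n := 0)) (n - 1) = 1" for z
      using False i \<gamma>0 by (auto simp: slot_def)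
    then have "f (slot z (t(n := 0))) = 0" for z using i by (intro norm[of "n - 1"]) auto
    then show ?thesis by (simp add: h_def k_def)
  qed
  have "mixed_deriv A (Suc n) h - mixed_deriv A (Suc n) k = mixed_deriv A (Suc n) (\<lambda>t. h t - k t)"
    by (rule mixed_deriv_diff[OF hg kg, symmetric])
  also have "\<dots> = iter_deriv F (map unit [0..<Suc n]) 0"
    unfolding mixed_deriv_Suc F_def[abs_def] hk_zero by simp
  finally have M: "mixed_deriv A (Suc n) h - mixed_deriv A (Suc n) k = iter_deriv F (map unit [0..<Suc n]) 0" .

  \<comment> \<open>The parameters form a component of the argument, so that one neighbourhood V of
    \<open>(e\<^sub>0, e\<^sub>0)\<close> serves all parameters t in an open set
    \<open>T0\<close>.\<close>
  define E where "E z = snd ach (f (slot (chart_inv gch (fst (snd z))) (fst z)) - f (slot (chart_inv gch (snd (snd z))) (fst z)))"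
    for z :: "(nat \<Rightarrow> real) \<times> ('e \<times> 'e)"
  have "germ\<^sub>A (\<lambda>z. f (slot (chart_inv gch (fst (snd z))) (fst z)) - f (slot (chart_inv gch (snd (snd z))) (fst z)))
      (0 :: nat \<Rightarrow> real, (e\<^sub>0, e\<^sub>0))"
  proof (rule germ\<^sub>A_diff; rule slot_germ)
    show "germ\<^sub>G (\<lambda>x. chart_inv gch (fst (snd x))) (0 :: nat \<Rightarrow> real, (e\<^sub>0, e\<^sub>0))"
      by (rule germ\<^sub>G_compose[OF germ\<^sub>G_chart_inv smooth_on_compose[OF smooth_on_fst[OF open_UNIV] open_UNIV smooth_on_snd[OF open_UNIV] open_UNIV]]) simp_all
    show "germ\<^sub>G (\<lambda>x. chart_inv gch (snd (snd x))) (0 :: nat \<Rightarrow> real, (e\<^sub>0, e\<^sub>0))"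
      by (rule germ\<^sub>G_compose[OF germ\<^sub>G_chart_inv smooth_on_compose[OF smooth_on_snd[OF open_UNIV] open_UNIV smooth_on_snd[OF open_UNIV] open_UNIV]]) simp_all
    show "germ\<^sub>G (\<lambda>x. \<gamma> k (fst x k)) (0 :: nat \<Rightarrow> real, (e\<^sub>0, e\<^sub>0))" for k
      by (rule germ\<^sub>G_compose[OF \<gamma>c smooth_on_fst[OF open_UNIV]]) simp_all
    then show "germ\<^sub>G (\<lambda>x. \<gamma> k (fst x k)) (0 :: nat \<Rightarrow> real, (e\<^sub>0, e\<^sub>0))" for k .
  qed
  then obtain N0 where N0: "open N0" "(0, (e\<^sub>0, e\<^sub>0)) \<in> N0" "smooth_on N0 E"
    unfolding germ\<^sub>A_def smooth_near_def E_def[abs_def] by blast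
  obtain T0 V where T0V: "open T0" "open V" "(0, (e\<^sub>0, e\<^sub>0)) \<in> T0 \<times> V" "T0 \<times> V \<subseteq> N0"
    using open_prod_elim[OF N0(1,2)] by blast
  have T0: "0 \<in> T0" and V: "(e\<^sub>0, e\<^sub>0) \<in> V" using T0V(3) by simp_all
  have Et: "smooth_on V (\<lambda>z. E (t, z))" if "t \<in> T0" for t
    by (rule smooth_on_compose[OF N0(3,1) smooth_on_Pair(1)[OF smooth_on_const[OF T0V(2)] smooth_on_id[OF T0V(2)] T0V(2)] T0V(2)])
      (use that T0V(4) in blast)
  obtain N where N: "smooth_on N chart_mult" "open N" "(e\<^sub>0, e\<^sub>0) \<in> N"
    "\<And>z. z \<in> N \<Longrightarrow> chart_inv gch (fst z) * chart_inv gch (snd z) \<in> fst gch"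
    by (rule chart_mult_smooth) blast
  let ?O = "snd gch ` fst gch"
  have O: "open ?O" "e\<^sub>0 \<in> ?O" using gch unfolding is_chart_def e\<^sub>0_def by blast+
  have unit: "chart_mult (u, e\<^sub>0) = u" "chart_mult (e\<^sub>0, u) = u" if "u \<in> ?O" for u
    unfolding chart_mult_def using chart_chart_inv[OF that] by (simp_all add: chart_inv_e\<^sub>0)
  obtain I0 where I0: "open I0" "0 \<in> I0" "\<And>s. s \<in> I0 \<Longrightarrow> \<gamma> i s \<in> fst gch" "smooth_on I0 (\<lambda>s. snd gch (\<gamma> i s))"
    "\<gamma> i 0 = 1" "has_dir_deriv (\<lambda>s. snd gch (\<gamma> i s)) 0 1 (v i)"
    using \<gamma>[of i] by (rule velocityE) blast
  obtain I1 where I1: "open I1" "0 \<in> I1" "\<And>s. s \<in> I1 \<Longrightarrow> \<gamma> ?j s \<in> fst gch" "smooth_on I1 (\<lambda>s. snd gch (\<gamma> ?j s))"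
    "\<gamma> ?j 0 = 1" "has_dir_deriv (\<lambda>s. snd gch (\<gamma> ?j s)) 0 1 (v ?j)"
    using \<gamma>[of ?j] by (rule velocityE) blast
  let ?y0 = "\<lambda>s. snd gch (\<gamma> i s)" and ?y1 = "\<lambda>s. snd gch (\<gamma> ?j s)"
  define B where "B = lie_bracket G (v i) (v ?j)"
  obtain \<zeta> where "velocity \<zeta> B" using exists_curve_with_velocity[of B] curve_with_velocity_imp[of B] by blast
  then obtain I2 where I2: "open I2" "0 \<in> I2" "\<And>s. s \<in> I2 \<Longrightarrow> \<zeta> s \<in> fst gch" "smooth_on I2 (\<lambda>s. snd gch (\<zeta> s))"
    "\<zeta> 0 = 1" "has_dir_deriv (\<lambda>s. snd gch (\<zeta> s)) 0 1 B"
    by (rule velocityE) blast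
  \<comment> \<open>Slot i now carries one curve with the bracket as velocity, run by the parameter
    t_{i+1}; the parameter t_i has disappeared.\<close>
  define Gf where "Gf t = snd ach (f (slot (\<zeta> (t ?j)) t))" for t
  have slot_indep: "slot z (t + a *\<^sub>R unit i + b *\<^sub>R unit ?j) = slot z t" for z t a b
    by (auto simp: slot_def add_scaleR_single fun_eq_iff)
  \<comment> \<open>Both sides equal the derivative of E in the direction (B, 0). The identity is
    needed for all t near 0 with t_i = t_{i+1} = 0, because the other parameters are still to be
    differentiated.\<close>
  have slice: "iter_deriv F [unit i, unit ?j] t = iter_deriv Gf [unit ?j] t"
    if t: "t \<in> T0" and t0: "t i = 0" "t ?j = 0" for t
  proof -
    let ?E = "\<lambda>z. E (t, z)"
    have F_eq: "F (t + a *\<^sub>R unit i + b *\<^sub>R unit ?j) = ?E (chart_mult (?y0 a, ?y1 b), chart_mult (?y1 b, ?y0 a))"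
      if a: "a \<in> I0" and b: "b \<in> I1" and ab: "(?y0 a, ?y1 b) \<in> N" "(?y1 b, ?y0 a) \<in> N" for a b
    proof -
      have "chart_inv gch (chart_mult (?y0 a, ?y1 b)) = \<gamma> i a * \<gamma> ?j b"
        "chart_inv gch (chart_mult (?y1 b, ?y0 a)) = \<gamma> ?j b * \<gamma> i a"
        using N(4)[OF ab(1)] N(4)[OF ab(2)] I0(3)[OF a] I1(3)[OF b]
        by (simp_all add: chart_mult_def chart_inv_chart[OF gch(1)])
      moreover have "(t + a *\<^sub>R unit i + b *\<^sub>R unit ?j) i = a" "(t + a *\<^sub>R unit i + b *\<^sub>R unit ?j) ?j = b"
        using t0 by (simp_all add: add_scaleR_single)
      ultimately show ?thesis
        unfolding F_def h_def k_def E_def slot_indep by (simp only: fst_conv snd_conv)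
    qed
    have "\<exists>\<Phi>. eventually (\<lambda>a. has_dir_deriv (\<lambda>b. ?E (chart_mult (?y0 a, ?y1 b), chart_mult (?y1 b, ?y0 a))) 0 1 (\<Phi> a)) (at 0) \<and>
      has_dir_deriv (\<lambda>b. ?E (chart_mult (?y0 0, ?y1 b), chart_mult (?y1 b, ?y0 0))) 0 1 (\<Phi> 0) \<and>
      has_dir_deriv \<Phi> 0 1 (iter_deriv ?E
        [(iter_deriv chart_mult [(v i, 0), (0, v ?j)] (e\<^sub>0, e\<^sub>0) - iter_deriv chart_mult [(v ?j, 0), (0, v i)] (e\<^sub>0, e\<^sub>0), 0)] (e\<^sub>0, e\<^sub>0))"
      by (rule commutator_deriv[OF N(1-3) O unit Et[OF t] T0V(2) V _ _ I0(6) _ I1(6), where c = b\<^sub>0])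
        (simp_all add: E_def I0(5) I1(5), simp_all add: b\<^sub>0_def e\<^sub>0_def)
    then obtain \<Phi> where \<Phi>: "eventually (\<lambda>a. has_dir_deriv (\<lambda>b. ?E (chart_mult (?y0 a, ?y1 b), chart_mult (?y1 b, ?y0 a))) 0 1 (\<Phi> a)) (at 0)"
      "has_dir_deriv (\<lambda>b. ?E (chart_mult (?y0 0, ?y1 b), chart_mult (?y1 b, ?y0 0))) 0 1 (\<Phi> 0)"
      "has_dir_deriv \<Phi> 0 1 (iter_deriv ?E [(B, 0)] (e\<^sub>0, e\<^sub>0))"
      unfolding B_def lie_bracket_eq by blast
    have y00: "?y0 0 = e\<^sub>0" "?y1 0 = e\<^sub>0" by (simp_all add: I0(5) I1(5) e\<^sub>0_def)
    have lim0: "(?y0 \<longlongrightarrow> e\<^sub>0) (at 0)" using has_dir_deriv_tendsto[OF I0(6)] unfolding y00 .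
    have lim1: "(?y1 \<longlongrightarrow> e\<^sub>0) (at 0)" using has_dir_deriv_tendsto[OF I1(6)] unfolding y00 .
    have inner: "iter_deriv F [unit ?j] (t + a *\<^sub>R unit i) = \<Phi> a"
      if a: "a \<in> I0" "(?y0 a, e\<^sub>0) \<in> N" "(e\<^sub>0, ?y0 a) \<in> N"
        and d: "has_dir_deriv (\<lambda>b. ?E (chart_mult (?y0 a, ?y1 b), chart_mult (?y1 b, ?y0 a))) 0 1 (\<Phi> a)" for a
    proof -
      have "eventually (\<lambda>b. (?y0 a, ?y1 b) \<in> N) (at 0)"
        by (rule topological_tendstoD[OF tendsto_Pair[OF tendsto_const lim1] N(2) a(2)])
      moreover have "eventually (\<lambda>b. (?y1 b, ?y0 a) \<in> N) (at 0)"
        by (rule topological_tendstoD[OF tendsto_Pair[OF lim1 tendsto_const] N(2) a(3)])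
      moreover have "eventually (\<lambda>b. b \<in> I1) (at 0)"
        by (rule topological_tendstoD[OF tendsto_ident_at I1(1,2)])
      ultimately have "eventually (\<lambda>b. F (t + a *\<^sub>R unit i + (0 + b *\<^sub>R 1) *\<^sub>R unit ?j)
          = ?E (chart_mult (?y0 a, ?y1 (0 + b *\<^sub>R 1)), chart_mult (?y1 (0 + b *\<^sub>R 1), ?y0 a))) (at 0)"
        by eventually_elim (simp add: F_eq[OF a(1)])
      moreover have "F (t + a *\<^sub>R unit i + 0 *\<^sub>R unit ?j) = ?E (chart_mult (?y0 a, ?y1 0), chart_mult (?y1 0, ?y0 a))"
        by (rule F_eq[OF a(1) I1(2)]) (use a(2,3) y00 in simp_all)
      ultimately have "has_dir_deriv (\<lambda>b. F (t + a *\<^sub>R unit i + b *\<^sub>R unit ?j)) 0 1 (\<Phi> a)"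
        by - (rule has_dir_deriv_cong[THEN iffD2, OF _ _ d])
      then have "has_dir_deriv F (t + a *\<^sub>R unit i) (unit ?j) (\<Phi> a)"
        unfolding has_dir_deriv_curve[of F] .
      then show ?thesis by (simp add: dir_derivI)
    qed
    have "eventually (\<lambda>a. (?y0 a, e\<^sub>0) \<in> N) (at 0)"
      by (rule topological_tendstoD[OF tendsto_Pair[OF lim0 tendsto_const] N(2,3)])
    moreover have "eventually (\<lambda>a. (e\<^sub>0, ?y0 a) \<in> N) (at 0)"
      by (rule topological_tendstoD[OF tendsto_Pair[OF tendsto_const lim0] N(2,3)])
    moreover have "eventually (\<lambda>a. a \<in> I0) (at 0)"
      by (rule topological_tendstoD[OF tendsto_ident_at I0(1,2)])
    ultimately have "eventually (\<lambda>a. iter_deriv F [unit ?j] (t + (0 + a *\<^sub>R 1) *\<^sub>R unit i) = \<Phi> (0 + a *\<^sub>R 1)) (at 0)"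
      using \<Phi>(1) by eventually_elim (simp add: inner del: iter_deriv.simps)
    moreover have "iter_deriv F [unit ?j] (t + 0 *\<^sub>R unit i) = \<Phi> 0"
      by (rule inner[OF I0(2) _ _ \<Phi>(2)]) (use N(3) y00 in simp_all)
    ultimately have "has_dir_deriv (\<lambda>a. iter_deriv F [unit ?j] (t + a *\<^sub>R unit i)) 0 1 (iter_deriv ?E [(B, 0)] (e\<^sub>0, e\<^sub>0))"
      by - (rule has_dir_deriv_cong[THEN iffD2, OF _ _ \<Phi>(3)])
    then have "has_dir_deriv (iter_deriv F [unit ?j]) t (unit i) (iter_deriv ?E [(B, 0)] (e\<^sub>0, e\<^sub>0))"
      unfolding has_dir_deriv_curve[of "iter_deriv F [unit ?j]"] .
    then have lhs: "iter_deriv F [unit i, unit ?j] t = iter_deriv ?E [(B, 0)] (e\<^sub>0, e\<^sub>0)"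
      using dir_derivI by (simp only: iter_deriv.simps)
    have "has_dir_deriv (\<lambda>b. (snd gch (\<zeta> b), e\<^sub>0)) 0 1 (B, 0)"
      by (rule has_dir_deriv_Pair[OF I2(6) has_dir_deriv_const])
    from iter_deriv_chain_curve[OF Et[OF t] T0V(2) _ this, of "[]"]
    have dE: "has_dir_deriv (\<lambda>b. ?E (snd gch (\<zeta> b), e\<^sub>0)) 0 1 (iter_deriv ?E [(B, 0)] (e\<^sub>0, e\<^sub>0))"
      using V by (simp add: I2(5) flip: e\<^sub>0_def)
    have Gf_eq: "Gf (t + b *\<^sub>R unit ?j) = ?E (snd gch (\<zeta> b), e\<^sub>0)" if "b \<in> I2" for b
    proof -
      have "slot 1 t i = 1" by (simp add: slot_def)
      then have "f (slot 1 t) = 0" by (rule norm[OF i])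
      moreover have "(t + b *\<^sub>R unit ?j) ?j = b" using t0(2) by (simp add: add_scaleR_single)
      moreover have "slot z (t + b *\<^sub>R unit ?j) = slot z t" for z
        using slot_indep[of z t 0 b] by simp
      ultimately show ?thesis
        using I2(3)[OF that] by (simp only: Gf_def E_def fst_conv snd_conv chart_inv_e\<^sub>0 chart_inv_chart[OF gch(1)] diff_0_right)
    qed
    have "eventually (\<lambda>b. b \<in> I2) (at 0)"
      by (rule topological_tendstoD[OF tendsto_ident_at I2(1,2)])
    then have "eventually (\<lambda>b. Gf (t + (0 + b *\<^sub>R 1) *\<^sub>R unit ?j) = ?E (snd gch (\<zeta> (0 + b *\<^sub>R 1)), e\<^sub>0)) (at 0)"
      by eventually_elim (simp add: Gf_eq)
    with Gf_eq[OF I2(2)] have "has_dir_deriv (\<lambda>b. Gf (t + b *\<^sub>R unit ?j)) 0 1 (iter_deriv ?E [(B, 0)] (e\<^sub>0, e\<^sub>0))"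
      by - (rule has_dir_deriv_cong[THEN iffD2, OF _ _ dE])
    then have "has_dir_deriv Gf t (unit ?j) (iter_deriv ?E [(B, 0)] (e\<^sub>0, e\<^sub>0))"
      unfolding has_dir_deriv_curve[of Gf] .
    then have "iter_deriv Gf [unit ?j] t = iter_deriv ?E [(B, 0)] (e\<^sub>0, e\<^sub>0)"
      using dir_derivI by (simp only: iter_deriv.simps)
    with lhs show ?thesis by simp
  qed
  define R where "R = [0..<i] @ [Suc ?j..<Suc n]"
  have split: "[0..<Suc n] = [0..<i] @ i # ?j # [Suc ?j..<Suc n]"
    using i upt_split[of i "Suc n"] upt_conv_Cons[of ?j "Suc n"] by simp
  \<comment> \<open>Reordering makes t_i and t_{i+1} innermost; the directions in \<open>R\<close>
    preserve the slice t_i = t_{i+1} = 0, on which the double derivative has just been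
    rewritten.\<close>
  have "iter_deriv F (map unit [0..<Suc n]) 0 = iter_deriv F (map unit R @ [unit i, unit ?j]) 0"
    by (rule iter_deriv_perm[OF U]) (simp only: split R_def, simp)
  also have "\<dots> = iter_deriv Gf (map unit R @ [unit ?j]) 0"
    unfolding iter_deriv_append
  proof (rule iter_deriv_cong_on[OF T0V(1), of "{t. t i = 0 \<and> t ?j = 0}"])
    fix t :: "nat \<Rightarrow> real" and hh and s :: real
    assume t: "t \<in> {t. t i = 0 \<and> t ?j = 0}" and "hh \<in> set (map unit R)"
    then obtain r where "r \<in> set R" "hh = unit r" by auto
    then have "hh i = 0" "hh ?j = 0" by (auto simp: R_def single_def)
    then show "t + s *\<^sub>R hh \<in> {t. t i = 0 \<and> t ?j = 0}" using t by (simp add: scaleR_fun_def)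
  qed (use slice T0 in simp_all)
  also have "\<dots> = iter_deriv Gf (map (\<lambda>k. unit (if k < i then k else Suc k)) [0..<n]) 0"
  proof -
    have "germ\<^sub>A (\<lambda>t. f (slot (\<zeta> (t ?j)) t)) 0"
      using \<open>velocity \<zeta> B\<close> by (intro slot_germ \<gamma>c germ\<^sub>G_coordinate) (simp add: velocity_def)
    then obtain U' where U': "smooth_on U' Gf" "open U'" "0 \<in> U'"
      unfolding germ\<^sub>A_def smooth_near_def Gf_def[abs_def] by blast
    have "map (\<lambda>k. unit (if k < i then k else Suc k)) [0..<n]
      = map unit [0..<i] @ unit ?j # map (\<lambda>k. unit (Suc k)) [?j..<n]"
      unfolding upt_split[OF i] by simp
    also have "map (\<lambda>k. unit (Suc k)) [?j..<n] = map unit [Suc ?j..<Suc n]"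
      by (simp only: map_Suc_upt[symmetric] map_map o_def)
    finally show ?thesis
      by (intro iter_deriv_perm[OF U']) (simp add: R_def del: upt_Suc)
  qed
  also have "\<dots> = cochain_deriv n f (\<lambda>k. if k < i then v k else if k = i then B else v (Suc k))"
  proof -
    have "Gf = (\<lambda>t. snd ach (f (\<lambda>k. (if k < i then \<gamma> k else if k = i then \<zeta> else \<gamma> (Suc k)) (t (if k < i then k else Suc k)))))"
      unfolding Gf_def slot_def by (intro ext arg_cong[where f = "\<lambda>g. snd ach (f g)"]) auto
    moreover have "inj_on (\<lambda>k. if k < i then k else Suc k) {..<n}"
      by (auto simp: inj_on_def split: if_splits)
    moreover have "velocity (if k < i then \<gamma> k else if k = i then \<zeta> else \<gamma> (Suc k))
        (if k < i then v k else if k = i then B else v (Suc k))" for k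
      using \<gamma> \<open>velocity \<zeta> B\<close> by simp
    ultimately show ?thesis
      by (simp only:) (rule cochain_deriv_curves[OF f])
  qed
  finally have "mixed_deriv A (Suc n) h - mixed_deriv A (Suc n) k
      = cochain_deriv n f (\<lambda>k. if k < i then v k else if k = i then B else v (Suc k))"
    unfolding M .
  moreover have "h = (\<lambda>t. f (merge_entries (Suc i) (\<lambda>k. \<gamma> k (t k))))"
    unfolding h_def slot_def merge_entries_def by (intro ext arg_cong[where f = f]) auto
  moreover have "k = (\<lambda>t. f (\<lambda>k. if k < i then \<gamma> k (t k)
        else if k = i then \<gamma> (Suc i) (t (Suc i)) * \<gamma> i (t i) else \<gamma> (Suc k) (t (Suc k))))"
    unfolding k_def slot_def by (intro ext arg_cong[where f = f] refl)
  ultimately show ?thesis unfolding B_def by simp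
qed

end

subsection \<open>Alternating sums\<close>

definition alternation :: "nat \<Rightarrow> ((nat \<Rightarrow> 'x) \<Rightarrow> 'y::real_vector) \<Rightarrow> (nat \<Rightarrow> 'x) \<Rightarrow> 'y"
  where "alternation n T x = (\<Sum>\<sigma> | \<sigma> permutes {..<n}. of_int (sign \<sigma>) *\<^sub>R T (x \<circ> \<sigma>))"

definition insert_entry :: "nat \<Rightarrow> 'x \<Rightarrow> (nat \<Rightarrow> 'x) \<Rightarrow> nat \<Rightarrow> 'x"
  where "insert_entry i z y = (\<lambda>k. if k < i then y k else if k = i then z else y (k - 1))"

lemma alt_sign_scaleR: "alt_sign k a = (-1::real) ^ k *\<^sub>R (a::'y::real_vector)"
  by (simp add: alt_sign_def)

lemma comp_permutation_insert:
  "x \<circ> permutation_insert i b q = insert_entry i (x b) (delete_entry b x \<circ> q)"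
  by (auto simp: permutation_insert_expand insert_entry_def delete_entry_def fun_eq_iff)

text \<open>The permutations sending i to b are the \<open>permutation_insert i b q\<close>, with
  sign (-1)^(i+b) times that of q: the combinatorics behind the Laplace expansion of
  determinants.\<close>

lemma alternation_fix:
  fixes T :: "(nat \<Rightarrow> 'x) \<Rightarrow> 'y::real_vector"
  assumes "i < Suc n" "b < Suc n"
  shows "(\<Sum>\<sigma> | \<sigma> permutes {0..<Suc n} \<and> \<sigma> i = b. of_int (sign \<sigma>) *\<^sub>R T (x \<circ> \<sigma>))
    = (-1) ^ (b + i) *\<^sub>R alternation n (\<lambda>y. T (insert_entry i (x b) y)) (delete_entry b x)"
proof -
  have "(\<Sum>\<sigma> | \<sigma> permutes {0..<Suc n} \<and> \<sigma> i = b. of_int (sign \<sigma>) *\<^sub>R T (x \<circ> \<sigma>))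
      = (\<Sum>q | q permutes {0..<n}. of_int (sign (permutation_insert i b q)) *\<^sub>R T (x \<circ> permutation_insert i b q))"
    unfolding permutation_fix[OF assms] by (simp add: sum.reindex[OF permutation_insert_inj_on[OF assms]])
  also have "\<dots> = (\<Sum>q | q permutes {0..<n}. (-1) ^ (b + i) *\<^sub>R of_int (sign q) *\<^sub>R T (insert_entry i (x b) (delete_entry b x \<circ> q)))"
  proof (rule sum.cong[OF refl])
    fix q assume "q \<in> {q. q permutes {0..<n}}"
    then have "of_int (sign (permutation_insert i b q)) = (-1::real) ^ (i + b) * of_int (sign q)"
      using signof_permutation_insert[of q n i b, where 'a = real] assms by simp
    then show "of_int (sign (permutation_insert i b q)) *\<^sub>R T (x \<circ> permutation_insert i b q)
      = (-1) ^ (b + i) *\<^sub>R of_int (sign q) *\<^sub>R T (insert_entry i (x b) (delete_entry b x \<circ> q))"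
      by (simp add: comp_permutation_insert add.commute)
  qed
  finally show ?thesis
    by (simp add: alternation_def atLeast0LessThan scaleR_right.sum)
qed

text \<open>Laplace expansion with the slot fixed and the entry varying;
  \<open>alternation_expand_entry\<close> is its transpose, with the entry fixed and the slot
  varying.\<close>

lemma alternation_expand_slot:
  fixes T :: "(nat \<Rightarrow> 'x) \<Rightarrow> 'y::real_vector"
  assumes i: "i \<le> n"
  shows "alternation (Suc n) T x
    = (\<Sum>b\<le>n. (-1) ^ (b + i) *\<^sub>R alternation n (\<lambda>y. T (insert_entry i (x b) y)) (delete_entry b x))"
proof -
  let ?S = "{0..<Suc n}"
  let ?f = "\<lambda>\<sigma>. of_int (sign \<sigma>) *\<^sub>R T (x \<circ> \<sigma>)"
  have "\<sigma> i < Suc n" if "\<sigma> permutes ?S" for \<sigma>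
    using permutes_in_image[OF that, of i] i by simp
  then have "{\<sigma>. \<sigma> permutes ?S} = (\<Union>b\<in>{..n}. {\<sigma>. \<sigma> permutes ?S \<and> \<sigma> i = b})"
    by (auto simp: less_Suc_eq_le)
  then have "alternation (Suc n) T x = sum ?f (\<Union>b\<in>{..n}. {\<sigma>. \<sigma> permutes ?S \<and> \<sigma> i = b})"
    by (simp only: alternation_def atLeast0LessThan)
  also have "\<dots> = (\<Sum>b\<le>n. sum ?f {\<sigma>. \<sigma> permutes ?S \<and> \<sigma> i = b})"
    by (rule sum.UNION_disjoint) (auto intro: finite_subset[OF _ finite_permutations[of ?S]])
  also have "\<dots> = (\<Sum>b\<le>n. (-1) ^ (b + i) *\<^sub>R alternation n (\<lambda>y. T (insert_entry i (x b) y)) (delete_entry b x))"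
    using i by (intro sum.cong refl alternation_fix) auto
  finally show ?thesis .
qed

lemma alternation_expand_entry:
  fixes T :: "(nat \<Rightarrow> 'x) \<Rightarrow> 'y::real_vector"
  assumes b: "b \<le> n"
  shows "alternation (Suc n) T x
    = (\<Sum>i\<le>n. (-1) ^ (b + i) *\<^sub>R alternation n (\<lambda>y. T (insert_entry i (x b) y)) (delete_entry b x))"
proof -
  let ?S = "{0..<Suc n}"
  let ?f = "\<lambda>\<sigma>. of_int (sign \<sigma>) *\<^sub>R T (x \<circ> \<sigma>)"
  have "\<exists>i\<le>n. \<sigma> i = b" if "\<sigma> permutes ?S" for \<sigma>
  proof -
    have "b \<in> \<sigma> ` ?S" using permutes_image[OF that] b by simp
    then show ?thesis by (auto simp: less_Suc_eq_le)
  qed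
  then have "{\<sigma>. \<sigma> permutes ?S} = (\<Union>i\<in>{..n}. {\<sigma>. \<sigma> permutes ?S \<and> \<sigma> i = b})"
    by auto
  then have "alternation (Suc n) T x = sum ?f (\<Union>i\<in>{..n}. {\<sigma>. \<sigma> permutes ?S \<and> \<sigma> i = b})"
    by (simp only: alternation_def atLeast0LessThan)
  also have "\<dots> = (\<Sum>i\<le>n. sum ?f {\<sigma>. \<sigma> permutes ?S \<and> \<sigma> i = b})"
  proof (rule sum.UNION_disjoint)
    show "\<forall>i\<in>{..n}. \<forall>j\<in>{..n}. i \<noteq> j \<longrightarrow> {\<sigma>. \<sigma> permutes ?S \<and> \<sigma> i = b} \<inter> {\<sigma>. \<sigma> permutes ?S \<and> \<sigma> j = b} = {}"
      using permutes_inj by (auto dest: injD)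
  qed (auto intro: finite_subset[OF _ finite_permutations[of ?S]])
  also have "\<dots> = (\<Sum>i\<le>n. (-1) ^ (b + i) *\<^sub>R alternation n (\<lambda>y. T (insert_entry i (x b) y)) (delete_entry b x))"
    using b by (intro sum.cong refl alternation_fix) auto
  finally show ?thesis .
qed

lemma alternation_linear:
  assumes "linear L"
  shows "alternation n (\<lambda>y. L (T y)) x = L (alternation n T x)"
  unfolding alternation_def by (simp add: linear_sum[OF assms] linear_cmul[OF assms])

lemma alternation_first:
  assumes L: "\<And>z. linear (L z)"
  shows "alternation (Suc n) (\<lambda>y. L (y 0) (T (\<lambda>k. y (Suc k)))) x
    = (\<Sum>j\<le>n. (-1) ^ j *\<^sub>R L (x j) (alternation n T (delete_entry j x)))"
  unfolding alternation_expand_slot[of 0 n, OF le0]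
  by (intro sum.cong refl) (simp add: insert_entry_def alternation_linear[OF L])

text \<open>Here c numbers the entries that remain after removal of entry b, so c < b stands for
  entry c and c \<ge> b for entry c + 1. A pair i < j is thus met as (j, i) and as (i, j -
  1).\<close>

lemma sum_pairs_split:
  fixes f :: "nat \<Rightarrow> nat \<Rightarrow> 'y::comm_monoid_add"
  shows "(\<Sum>b\<le>Suc m. \<Sum>c\<le>m. f b c) = (\<Sum>j\<le>Suc m. \<Sum>i<j. f j i + f i (j - 1))"
proof -
  have "(\<Sum>b\<le>Suc m. \<Sum>c\<le>m. f b c) = (\<Sum>(b, c)\<in>{..Suc m} \<times> {..m}. f b c)"
    by (rule sum.cartesian_product)
  also have "{..Suc m} \<times> {..m} = {(b, c). b \<le> Suc m \<and> c < b} \<union> {(b, c). c \<le> m \<and> b \<le> c}"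
    by auto
  also have "(\<Sum>(b, c)\<in>\<dots>. f b c)
     = (\<Sum>(b, c)\<in>{(b, c). b \<le> Suc m \<and> c < b}. f b c) + (\<Sum>(b, c)\<in>{(b, c). c \<le> m \<and> b \<le> c}. f b c)"
  proof (rule sum.union_disjoint)
    show "finite {(b, c). b \<le> Suc m \<and> c < b}" "finite {(b, c). c \<le> m \<and> b \<le> c}"
      by (auto intro: finite_subset[of _ "{..Suc m} \<times> {..Suc m}"])
  qed auto
  also have "(\<Sum>(b, c)\<in>{(b, c). c \<le> m \<and> b \<le> c}. f b c) = (\<Sum>(j, i)\<in>{(b, c). b \<le> Suc m \<and> c < b}. f i (j - 1))"
    by (rule sum.reindex_bij_witness[of _ "\<lambda>(j, i). (i, j - 1)" "\<lambda>(b, c). (Suc c, b)"]) auto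
  also have "{(b, c). b \<le> Suc m \<and> c < b} = Sigma {..Suc m} (\<lambda>j. {..<j})" by auto
  finally show ?thesis
    by (simp add: sum.Sigma[symmetric] sum.distrib)
qed

text \<open>Two expansions along slot i choose the ordered pair of entries fed into the bracket; the
  signed sum over i then reassembles the expansion along the first entry of an alternation that
  starts with the bracket. Exchanging the pair changes both the sign of the expansion and the sign
  of the bracket, so each unordered pair counts twice.\<close>

lemma alternation_bracket:
  fixes T :: "(nat \<Rightarrow> 'x::real_vector) \<Rightarrow> 'y::real_vector"
  assumes T: "\<And>i y w. i < n \<Longrightarrow> T (y(i := - w)) = - T (y(i := w))"
    and br: "\<And>u v. br v u = - br u v" and n: "n > 0"
  shows "(\<Sum>i<n. (-1) ^ Suc i *\<^sub>R alternation (Suc n)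
      (\<lambda>y. T (\<lambda>k. if k < i then y k else if k = i then br (y i) (y (Suc i)) else y (Suc k))) x)
    = 2 *\<^sub>R (\<Sum>j\<le>n. \<Sum>i<j. (-1) ^ (i + j) *\<^sub>R
        alternation n T (case_nat (br (x i) (x j)) (delete_entry i (delete_entry j x))))"
proof -
  obtain m where m: "n = Suc m" using n by (cases n) auto
  \<comment> \<open>The expansion over the slot s receiving w of the alternation that has w as first
    and d as remaining entries.\<close>
  define R where "R w d = (\<Sum>s\<le>m. (-1) ^ s *\<^sub>R alternation m (\<lambda>y. T (insert_entry s w y)) d)" for w d
  have R_eq: "alternation n T (case_nat w d) = R w d" for w d
  proof -
    have "delete_entry 0 (case_nat w d) = d" by (simp add: delete_entry_def)
    then show ?thesis unfolding m alternation_expand_entry[of 0 m, OF le0] R_def by simp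
  qed
  have R_uminus: "R (- w) d = - R w d" for w d
  proof -
    have "T (insert_entry s (- w) y) = - T (insert_entry s w y)" if "s \<le> m" for s y
    proof -
      have "insert_entry s z y = (insert_entry s w y)(s := z)" for z
        by (auto simp: insert_entry_def)
      then show ?thesis using T[of s "insert_entry s w y" w] that m by (metis less_Suc_eq_le)
    qed
    then have "alternation m (\<lambda>y. T (insert_entry s (- w) y)) d = - alternation m (\<lambda>y. T (insert_entry s w y)) d" if "s \<le> m" for s
      using that by (simp add: alternation_def sum_negf)
    then show ?thesis unfolding R_def by (simp add: sum_negf)
  qed
  have W: "alternation (Suc n) (\<lambda>y. T (\<lambda>k. if k < i then y k else if k = i then br (y i) (y (Suc i)) else y (Suc k))) x
    = (\<Sum>b\<le>n. \<Sum>c\<le>m. (-1) ^ (b + c) *\<^sub>R alternation m (\<lambda>y. T (insert_entry i (br (x b) (delete_entry b x c)) y)) (delete_entry c (delete_entry b x)))"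
    if i: "i \<le> m" for i
  proof -
    \<comment> \<open>With z in slot i, contracting slots i and i + 1 only replaces entry i of the
      remaining sequence by its bracket with z; this is why the second expansion is again along slot
      i.\<close>
    have 1: "(\<lambda>k. if k < i then insert_entry i z y k else if k = i then br (insert_entry i z y i) (insert_entry i z y (Suc i))
        else insert_entry i z y (Suc k)) = y(i := br z (y i))" for z y
      by (auto simp: insert_entry_def fun_eq_iff)
    have 2: "(insert_entry i z y)(i := w) = insert_entry i w y" "insert_entry i z y i = z" for z w :: 'x and y
      by (auto simp: insert_entry_def fun_eq_iff)
    have "alternation (Suc n) (\<lambda>y. T (\<lambda>k. if k < i then y k else if k = i then br (y i) (y (Suc i)) else y (Suc k))) x
      = (\<Sum>b\<le>n. (-1) ^ (b + i) *\<^sub>R alternation n (\<lambda>y. T (y(i := br (x b) (y i)))) (delete_entry b x))"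
      using i m by (subst alternation_expand_slot[of i n]) (simp_all only: 1)
    also have "\<dots> = (\<Sum>b\<le>n. (-1) ^ (b + i) *\<^sub>R (\<Sum>c\<le>m. (-1) ^ (c + i) *\<^sub>R
        alternation m (\<lambda>y. T (insert_entry i (br (x b) (delete_entry b x c)) y)) (delete_entry c (delete_entry b x))))"
      unfolding m alternation_expand_slot[OF i] 2 ..
    also have "\<dots> = (\<Sum>b\<le>n. \<Sum>c\<le>m. (-1) ^ (b + c) *\<^sub>R
        alternation m (\<lambda>y. T (insert_entry i (br (x b) (delete_entry b x c)) y)) (delete_entry c (delete_entry b x)))"
    proof -
      have "(-1::real) ^ (b + i) * (-1) ^ (c + i) = (-1) ^ (b + c)" for b c
        by (simp add: power_add)
      then show ?thesis by (simp add: scaleR_right.sum)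
    qed
    finally show ?thesis .
  qed
  let ?g = "\<lambda>b c. (-1) ^ (b + c) *\<^sub>R R (br (x b) (delete_entry b x c)) (delete_entry c (delete_entry b x))"
  have "(\<Sum>i<n. (-1) ^ Suc i *\<^sub>R alternation (Suc n)
      (\<lambda>y. T (\<lambda>k. if k < i then y k else if k = i then br (y i) (y (Suc i)) else y (Suc k))) x)
    = (\<Sum>i\<le>m. \<Sum>b\<le>n. \<Sum>c\<le>m. - ((-1) ^ (b + c) *\<^sub>R (-1) ^ i *\<^sub>R
        alternation m (\<lambda>y. T (insert_entry i (br (x b) (delete_entry b x c)) y)) (delete_entry c (delete_entry b x))))"
  proof (rule sum.cong)
    show "{..<n} = {..m}" by (auto simp: m)
  qed (simp add: W scaleR_right.sum sum_negf mult.commute)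
  also have "\<dots> = (\<Sum>b\<le>n. \<Sum>c\<le>m. \<Sum>i\<le>m. - ((-1) ^ (b + c) *\<^sub>R (-1) ^ i *\<^sub>R
        alternation m (\<lambda>y. T (insert_entry i (br (x b) (delete_entry b x c)) y)) (delete_entry c (delete_entry b x))))"
    by (subst sum.swap) (intro sum.cong refl sum.swap)
  also have "\<dots> = (\<Sum>b\<le>Suc m. \<Sum>c\<le>m. - ?g b c)"
    unfolding m R_def by (simp add: scaleR_right.sum sum_negf del: sum.atMost_Suc)
  also have "\<dots> = (\<Sum>j\<le>Suc m. \<Sum>i<j. - ?g j i + - ?g i (j - 1))"
    by (rule sum_pairs_split)
  also have "\<dots> = (\<Sum>j\<le>Suc m. \<Sum>i<j. 2 *\<^sub>R ((-1) ^ (i + j) *\<^sub>R R (br (x i) (x j)) (delete_entry i (delete_entry j x))))"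
  proof (intro sum.cong refl)
    fix j i :: nat assume "i \<in> {..<j}"
    then obtain j' where j: "j = Suc j'" "i \<le> j'" by (cases j) auto
    have 1: "delete_entry j x i = x i" "delete_entry i x (j - 1) = x j"
      using j by (auto simp: delete_entry_def)
    have 2: "delete_entry (j - 1) (delete_entry i x) = delete_entry i (delete_entry j x)"
      using j by (auto simp: delete_entry_def fun_eq_iff)
    have "- ?g j i = (-1) ^ (i + j) *\<^sub>R R (br (x i) (x j)) (delete_entry i (delete_entry j x))"
      unfolding 1 br[of "x j" "x i"] R_uminus by (simp add: add.commute)
    moreover have "- ?g i (j - 1) = (-1) ^ (i + j) *\<^sub>R R (br (x i) (x j)) (delete_entry i (delete_entry j x))"
      unfolding 1 2 using j by simp
    ultimately show "- ?g j i + - ?g i (j - 1) = 2 *\<^sub>R ((-1) ^ (i + j) *\<^sub>R R (br (x i) (x j)) (delete_entry i (delete_entry j x)))"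
      by (simp only: scaleR_2)
  qed
  finally show ?thesis by (simp only: R_eq m[symmetric] scaleR_right.sum)
qed

subsection \<open>Compatibility with the differentials\<close>

lemma alternation_add:
  "alternation n (\<lambda>y. T y + T' y) x = alternation n T x + alternation n T' x"
  by (simp add: alternation_def scaleR_right_distrib sum.distrib)

lemma alternation_scaleR: "alternation n (\<lambda>y. c *\<^sub>R T y) x = c *\<^sub>R alternation n T x"
  by (simp add: alternation_def scaleR_right.sum mult.commute)

lemma alternation_sum: "alternation n (\<lambda>y. \<Sum>i\<in>I. T i y) x = (\<Sum>i\<in>I. alternation n (T i) x)"
  unfolding alternation_def by (simp add: scaleR_right.sum sum.swap[of _ I])

text \<open>Composing all permutations with the transposition on the right flips every sign, so the
  swapped term contributes a second copy of the alternation.\<close>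

lemma alternation_transpose:
  fixes T :: "(nat \<Rightarrow> 'x) \<Rightarrow> 'y::real_vector"
  assumes i: "Suc i < n"
  shows "alternation n (\<lambda>y. T y - T (y \<circ> Transposition.transpose i (Suc i))) x = 2 *\<^sub>R alternation n T x"
proof -
  let ?\<tau> = "Transposition.transpose i (Suc i)"
  have \<tau>: "?\<tau> permutes {..<n}" using i by (intro permutes_swap_id) auto
  have "alternation n T x = (\<Sum>\<sigma> | \<sigma> permutes {..<n}. of_int (sign (\<sigma> \<circ> ?\<tau>)) *\<^sub>R T (x \<circ> (\<sigma> \<circ> ?\<tau>)))"
    unfolding alternation_def by (rule sum_permutations_compose_right[OF \<tau>])
  also have "\<dots> = (\<Sum>\<sigma> | \<sigma> permutes {..<n}. - (of_int (sign \<sigma>) *\<^sub>R T (x \<circ> \<sigma> \<circ> ?\<tau>)))"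
  proof (rule sum.cong[OF refl])
    fix \<sigma> assume "\<sigma> \<in> {\<sigma>. \<sigma> permutes {..<n}}"
    then have "permutation \<sigma>" by (auto simp: permutation_permutes)
    then have "sign (\<sigma> \<circ> ?\<tau>) = - sign \<sigma>"
      by (simp add: sign_compose permutation_swap_id sign_swap_id)
    then show "of_int (sign (\<sigma> \<circ> ?\<tau>)) *\<^sub>R T (x \<circ> (\<sigma> \<circ> ?\<tau>)) = - (of_int (sign \<sigma>) *\<^sub>R T (x \<circ> \<sigma> \<circ> ?\<tau>))"
      by (simp add: o_assoc)
  qed
  finally have "(\<Sum>\<sigma> | \<sigma> permutes {..<n}. of_int (sign \<sigma>) *\<^sub>R T (x \<circ> \<sigma> \<circ> ?\<tau>)) = - alternation n T x"
    by (simp add: sum_negf)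
  then show ?thesis
    unfolding alternation_def by (simp add: scaleR_right_diff_distrib sum_subtractf scaleR_2)
qed

context lie_module
begin

text \<open>The single terms of the group differential are not normalised cochains of degree n + 1,
  so they are differentiated through \<open>mixed_deriv\<close> along curves; only their sum is
  covered by \<open>cochain_deriv\<close>.\<close>

lemma cochain_deriv_group_diff:
  assumes f: "f \<in> loc_cochains n" and n: "n > 0" and \<gamma>: "\<And>k. velocity (\<gamma> k) (v k)"
  shows "cochain_deriv (Suc n) (group_diff act n f) v = lie_act G A act (v 0) (cochain_deriv n f (\<lambda>k. v (Suc k)))
    + (\<Sum>j=1..n. alt_sign j (mixed_deriv A (Suc n) (\<lambda>t. f (merge_entries j (\<lambda>k. \<gamma> k (t k))))))"
proof -
  have \<gamma>c: "germ\<^sub>G (\<lambda>t. \<gamma> k (t k)) 0" for k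
    using \<gamma>[of k] by (intro germ\<^sub>G_coordinate) (simp add: velocity_def)
  have m: "germ\<^sub>A (\<lambda>t. f (merge_entries j (\<lambda>k. \<gamma> k (t k)))) 0" for j
  proof (rule germ\<^sub>A_cochain[OF f])
    fix k
    show "germ\<^sub>G (\<lambda>t. merge_entries j (\<lambda>k. \<gamma> k (t k)) k) 0"
      unfolding merge_entries_def by (cases "k < j - 1"; cases "k = j - 1") (simp_all add: \<gamma>c germ\<^sub>G_mult)
  qed
  have m1: "germ\<^sub>A (\<lambda>t. act (\<gamma> 0 (t 0)) (f (\<lambda>k. \<gamma> (Suc k) (t (Suc k))))) 0"
    by (intro germ\<^sub>A_act \<gamma>c germ\<^sub>A_cochain[OF f, of "\<lambda>k t. \<gamma> (Suc k) (t (Suc k))"])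
  have m2: "germ\<^sub>A (\<lambda>t. f (\<lambda>k. \<gamma> k (t k))) 0"
    by (intro \<gamma>c germ\<^sub>A_cochain[OF f, of "\<lambda>k t. \<gamma> k (t k)"])
  have "depends_below n f" using f unfolding loc_cochains_def by blast
  then have "mixed_deriv A (Suc n) (\<lambda>t. f (\<lambda>k. \<gamma> k (t k))) = 0"
    by (intro mixed_deriv_indep[of n]) (simp_all add: depends_below_def)
  then have "mixed_deriv A (Suc n) (\<lambda>t. group_diff act n f (\<lambda>k. \<gamma> k (t k)))
     = mixed_deriv A (Suc n) (\<lambda>t. act (\<gamma> 0 (t 0)) (f (\<lambda>k. \<gamma> (Suc k) (t (Suc k)))))
     + (\<Sum>j=1..n. alt_sign j (mixed_deriv A (Suc n) (\<lambda>t. f (merge_entries j (\<lambda>k. \<gamma> k (t k))))))"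
    unfolding group_diff_def
    by (simp add: mixed_deriv_add mixed_deriv_sum mixed_deriv_alt_sign germ\<^sub>A_add germ\<^sub>A_sum germ\<^sub>A_alt_sign m m1 m2)
      (simp add: alt_sign_def)
  then show ?thesis
    using mixed_deriv_cochain[OF loc_cochains_group_diff[OF f n], of \<gamma> v] \<gamma> mixed_deriv_act[OF f n \<gamma>] by simp
qed

lemma Dmap_alternation:
  "f \<in> loc_cochains n \<Longrightarrow> n > 0 \<Longrightarrow> Dmap G A act n f = alternation n (cochain_deriv n f)"
  by (rule ext) (simp add: Dmap_eq alternation_def)

lemma Dmap_group_diff:
  assumes f: "f \<in> loc_cochains n" and n: "n > 0"
  shows "Dmap G A act (Suc n) (group_diff act n f) = lie_diff G A act n (Dmap G A act n f)"
proof
  fix x :: "nat \<Rightarrow> 'e"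
  let ?T = "cochain_deriv n f"
  \<comment> \<open>A curve is chosen for each vector and not for each index; \<open>S i\<close>
    becomes a function of y alone and can be evaluated at permuted arguments.\<close>
  have "\<exists>c. \<forall>v. velocity (c v) v"
    by (rule choice) (use exists_curve_with_velocity curve_with_velocity_imp in blast)
  then obtain c where c: "\<And>v. velocity (c v) v" by (elim exE) (rule that, erule spec)
  define S where "S i y = mixed_deriv A (Suc n) (\<lambda>t. f (merge_entries (Suc i) (\<lambda>k. c (y k) (t k))))" for i y
  let ?W = "\<lambda>i y. ?T (\<lambda>k. if k < i then y k else if k = i then lie_bracket G (y i) (y (Suc i)) else y (Suc k))"
  have df: "cochain_deriv (Suc n) (group_diff act n f) y = lie_act G A act (y 0) (?T (\<lambda>k. y (Suc k)))
      + (\<Sum>i<n. (-1) ^ Suc i *\<^sub>R S i y)" for y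
  proof -
    have "(\<Sum>j=1..n. alt_sign j (mixed_deriv A (Suc n) (\<lambda>t. f (merge_entries j (\<lambda>k. c (y k) (t k))))))
      = (\<Sum>i<n. alt_sign (Suc i) (S i y))"
      unfolding S_def by (rule sum.reindex_bij_witness[of _ Suc "\<lambda>j. j - 1"]) auto
    then show ?thesis
      using cochain_deriv_group_diff[OF f n, of "\<lambda>k. c (y k)" y] c by (simp add: alt_sign_scaleR)
  qed
  \<comment> \<open>Exchanging the velocities i and i + 1 is undone by exchanging the time
    parameters, to which mixed derivatives are insensitive. What remains is the same pair of curves
    multiplied in the opposite order.\<close>
  have S_W: "S i y - S i (y \<circ> Transposition.transpose i (Suc i)) = ?W i y" if i: "i < n" for i y
  proof -
    let ?\<tau> = "Transposition.transpose i (Suc i)"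
    let ?h = "\<lambda>t. f (merge_entries (Suc i) (\<lambda>k. c ((y \<circ> ?\<tau>) k) (t k)))"
    have "germ\<^sub>A ?h 0"
    proof (rule germ\<^sub>A_cochain[OF f])
      fix k
      have "germ\<^sub>G (\<lambda>t::nat \<Rightarrow> real. c v (t k)) 0" for v k
        using c[of v] by (intro germ\<^sub>G_coordinate) (simp add: velocity_def)
      then show "germ\<^sub>G (\<lambda>t. merge_entries (Suc i) (\<lambda>k. c ((y \<circ> ?\<tau>) k) (t k)) k) 0"
        unfolding merge_entries_def by (cases "k < i"; cases "k = i") (simp_all add: germ\<^sub>G_mult)
    qed
    then have "S i (y \<circ> ?\<tau>) = mixed_deriv A (Suc n) (\<lambda>t. ?h (t \<circ> ?\<tau>))"
      unfolding S_def using i by (intro mixed_deriv_transpose[symmetric]) auto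
    also have "(\<lambda>t. ?h (t \<circ> ?\<tau>)) = (\<lambda>t. f (\<lambda>k. if k < i then c (y k) (t k)
        else if k = i then c (y (Suc i)) (t (Suc i)) * c (y i) (t i) else c (y (Suc k)) (t (Suc k))))"
      by (intro ext arg_cong[where f = f]) (auto simp: merge_entries_def Transposition.transpose_def)
    finally show ?thesis
      using mixed_deriv_commutator[OF f i, of "\<lambda>k. c (y k)" y] c unfolding S_def by simp
  qed
  \<comment> \<open>The factor 1/2 cancels the 2 of \<open>alternation_bracket\<close>.\<close>
  have alt_S: "alternation (Suc n) (S i) x = (1/2) *\<^sub>R alternation (Suc n) (?W i) x" if "i < n" for i
    using alternation_transpose[of i "Suc n" "S i" x] that by (simp add: S_W)
  have "Dmap G A act (Suc n) (group_diff act n f) x = alternation (Suc n) (cochain_deriv (Suc n) (group_diff act n f)) x"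
    by (simp add: Dmap_alternation[OF loc_cochains_group_diff[OF f n]])
  also have "\<dots> = alternation (Suc n) (\<lambda>y. lie_act G A act (y 0) (?T (\<lambda>k. y (Suc k)))) x
      + (\<Sum>i<n. (-1) ^ Suc i *\<^sub>R alternation (Suc n) (S i) x)"
    unfolding df[abs_def] by (simp only: alternation_add alternation_sum alternation_scaleR)
  also have "alternation (Suc n) (\<lambda>y. lie_act G A act (y 0) (?T (\<lambda>k. y (Suc k)))) x
      = (\<Sum>j\<le>n. (-1) ^ j *\<^sub>R lie_act G A act (x j) (alternation n ?T (delete_entry j x)))"
    by (rule alternation_first[OF lie_act_linear])
  also have "(\<Sum>i<n. (-1) ^ Suc i *\<^sub>R alternation (Suc n) (S i) x)
      = (1/2) *\<^sub>R (\<Sum>i<n. (-1) ^ Suc i *\<^sub>R alternation (Suc n) (?W i) x)"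
    by (simp add: alt_S scaleR_right.sum mult.commute)
  also have "(\<Sum>i<n. (-1) ^ Suc i *\<^sub>R alternation (Suc n) (?W i) x)
     = 2 *\<^sub>R (\<Sum>j\<le>n. \<Sum>i<j. (-1) ^ (i + j) *\<^sub>R
        alternation n ?T (case_nat (lie_bracket G (x i) (x j)) (delete_entry i (delete_entry j x))))"
  proof (rule alternation_bracket[OF _ lie_bracket_antisym n])
    fix i y w assume "i < n"
    then show "?T (y(i := - w)) = - ?T (y(i := w))"
      using linear_neg[OF cochain_deriv_linear[OF f, of i y]] by simp
  qed
  finally show "Dmap G A act (Suc n) (group_diff act n f) x = lie_diff G A act n (Dmap G A act n f) x"
    by (simp add: lie_diff_def alt_sign_scaleR Dmap_alternation[OF f n])
qed

section \<open>Degree one and coboundaries of constants\<close>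

lemma loc_cochains_0: "0 \<in> loc_cochains n"
  unfolding loc_cochains_def depends_below_def using germ\<^sub>A_0 by auto

lemma Dmap_0: "n > 0 \<Longrightarrow> Dmap G A act n 0 = 0"
  using Dmap_add[OF loc_cochains_0 loc_cochains_0, of n] by simp

lemma Dmap_1:
  assumes "f \<in> loc_cochains 1"
  shows "Dmap G A act 1 f x = dir_deriv (\<lambda>u. snd ach (f (\<lambda>_. chart_inv gch u))) e\<^sub>0 (x 0)"
proof -
  have one: "0 < (1::nat)" by simp
  have dep: "\<And>x y. x 0 = y 0 \<Longrightarrow> f x = f y" using assms unfolding loc_cochains_def depends_below_def by blast
  have perm: "{\<sigma>. \<sigma> permutes {..<1::nat}} = {id}" by (auto simp: lessThan_Suc permutes_sing)
  have "Dmap G A act 1 f x = cochain_deriv 1 f x"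
    unfolding Dmap_eq[OF assms one] perm by (simp add: sign_id)
  also have "\<dots> = dir_deriv (\<lambda>u. snd ach (f (\<lambda>i. chart_inv gch (u i)))) (\<lambda>_. e\<^sub>0) (single 0 (x 0))"
    by (simp add: cochain_deriv_def)
  also have "\<dots> = dir_deriv (\<lambda>u. snd ach (f (\<lambda>_. chart_inv gch u))) e\<^sub>0 (x 0)"
    by (rule dir_deriv_affine, rule arg_cong[where f = "snd ach"], rule dep) (simp add: single_def scaleR_fun_def)
  finally show ?thesis .
qed

lemma Dmap_1_tangent_map:
  assumes f: "f \<in> loc_cochains 1"
  shows "Dmap G A act 1 f = (\<lambda>x. tangent_map G A (\<lambda>g. f (\<lambda>_. g)) 1 (x 0))"
proof
  fix x
  have "f (\<lambda>_. 1) = 0" using f unfolding loc_cochains_def by auto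
  then show "Dmap G A act 1 f x = tangent_map G A (\<lambda>g. f (\<lambda>_. g)) 1 (x 0)"
    unfolding Dmap_1[OF f] tangent_map_def by (simp add: o_def e\<^sub>0_def)
qed

lemma group_diff_0: "group_diff act 0 (\<lambda>_. a) = (\<lambda>g. act (g 0) a - a)"
  by (simp add: group_diff_def alt_sign_def fun_eq_iff)

lemma group_diff_add: "group_diff act n (f + g) = group_diff act n f + group_diff act n g"
proof
  fix x
  have alt: "alt_sign k (a + b) = alt_sign k a + alt_sign k b" for k and a b :: 'a
    by (simp add: alt_sign_def)
  show "group_diff act n (f + g) x = (group_diff act n f + group_diff act n g) x"
    by (simp add: group_diff_def act_simps alt sum.distrib algebra_simps)
qed

text \<open>
  For a homomorphism \<open>q\<close> from the Lie algebra of \<open>A\<close> to \<open>A\<close>, the derivative at \<open>1\<close> of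
  \<open>g \<mapsto> g.q(r w) - q(r w)\<close> is additive in \<open>r\<close>, hence equal to \<open>r\<close> times its derivative in \<open>r\<close> at \<open>0\<close>;
  there the order of differentiation can be exchanged.
\<close>

lemma Dmap_coboundary_0:
  fixes q :: "'b \<Rightarrow> 'a"
  assumes q: "\<And>u v. q (u + v) = q u + q v" and sq: "smooth_near ach q 0"
  shows "group_diff act 0 (\<lambda>_. q w) \<in> loc_cochains 1"
    and "Dmap G A act 1 (group_diff act 0 (\<lambda>_. q w)) x
      = lie_diff G A act 0 (\<lambda>_. dir_deriv (\<lambda>u. snd ach (q u)) 0 w) x"
proof -
  let ?Q = "dir_deriv (\<lambda>u. snd ach (q u)) 0 w"
  let ?c = "\<lambda>a. group_diff act 0 (\<lambda>_. a)"
  have one: "0 < (1::nat)" by simp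
  have q0: "q 0 = 0" using q[of 0 0] by simp
  have qg: "germ\<^sub>A q 0" using sq q0 by (simp add: germ\<^sub>A_def)
  have line: "smooth_on UNIV (\<lambda>z::'e \<times> real. snd z *\<^sub>R w)"
  proof (rule smooth_on_cont_linear[OF _ _ open_UNIV])
    show "linear (\<lambda>z::'e \<times> real. snd z *\<^sub>R w)" by (simp add: linear_iff scaleR_left_distrib)
    show "continuous_on UNIV (\<lambda>z::'e \<times> real. snd z *\<^sub>R w)"
      unfolding continuous_on_def
      by (intro ballI tendsto_scaleR_lc tendsto_snd tendsto_ident_at tendsto_const)
  qed
  define h where "h z = act (chart_inv gch (fst z)) (q (snd z *\<^sub>R w))" for z :: "'e \<times> real"
  define k where "k z = - q (snd z *\<^sub>R w)" for z :: "'e \<times> real"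
  have q2: "germ\<^sub>A (\<lambda>z::'e \<times> real. q (snd z *\<^sub>R w)) (e\<^sub>0, 0)"
    by (rule germ\<^sub>A_compose[OF qg line]) simp_all
  have g1: "germ\<^sub>G (\<lambda>z::'e \<times> real. chart_inv gch (fst z)) (e\<^sub>0, 0)"
    by (rule germ\<^sub>G_compose[OF germ\<^sub>G_chart_inv smooth_on_fst[OF open_UNIV]]) simp_all
  have hg: "germ\<^sub>A h (e\<^sub>0, 0)" unfolding h_def[abs_def] by (rule germ\<^sub>A_act[OF g1 q2])
  have kg: "germ\<^sub>A k (e\<^sub>0, 0)" unfolding k_def[abs_def] by (rule germ\<^sub>A_uminus[OF q2])
  \<comment> \<open>In the coordinate u of g, \<open>E (u, r)\<close> is g.q(r w) - q(r w) in the
    chart at 0. Both summands vanish for r = 0, so derivatives are additive there.\<close>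
  define E where "E z = snd ach (h z + k z)" for z
  obtain U where U: "open U" "(e\<^sub>0, 0) \<in> U" "smooth_on U (\<lambda>x. snd ach (h x))" "smooth_on U (\<lambda>x. snd ach (k x))"
    "\<And>x d. x \<in> U \<Longrightarrow> h x = 0 \<Longrightarrow> k x = 0 \<Longrightarrow> iter_deriv E [d] x
        = iter_deriv (\<lambda>x. snd ach (h x)) [d] x + iter_deriv (\<lambda>x. snd ach (k x)) [d] x"
    using deriv_add_at_zero[OF hg kg] unfolding E_def[abs_def] by blast
  from germ\<^sub>A_add[OF hg kg] obtain V where V: "open V" "(e\<^sub>0, 0) \<in> V" "\<And>z. z \<in> V \<Longrightarrow> h z + k z \<in> fst ach" "smooth_on V E"
    unfolding E_def[abs_def] by (rule germ\<^sub>AE) blast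
  have zero: "h (u, 0) = 0" "k (u, 0) = 0" for u by (simp_all add: h_def k_def q0 act_0)
  \<comment> \<open>For small r this is D_1 of the coboundary of q(r w), evaluated at x; for large r
    the coboundary may leave the region where E is known to be smooth.\<close>
  define D where "D r = iter_deriv E [(x 0, 0)] (e\<^sub>0, r)" for r
  have r_loc: "?c (q (r *\<^sub>R w)) \<in> loc_cochains 1" and r_D: "Dmap G A act 1 (?c (q (r *\<^sub>R w))) x = D r"
    if r: "(e\<^sub>0, r) \<in> V" for r
  proof -
    have c_eq: "?c (q (r *\<^sub>R w)) g = act (g 0) (q (r *\<^sub>R w)) - q (r *\<^sub>R w)" for g
      by (simp add: group_diff_0)
    have s: "smooth_on UNIV (\<lambda>u::nat \<Rightarrow> 'e. (u 0, r))"
      by (rule smooth_on_Pair(1)[OF smooth_on_coordinate smooth_on_const]) simp_all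
    have "smooth_near ach (\<lambda>z. h z + k z) (e\<^sub>0, r)"
      unfolding smooth_near_def using V r unfolding E_def[abs_def] by blast
    from smooth_near_compose[OF this s open_UNIV UNIV_I, of "\<lambda>_. e\<^sub>0"]
    have "smooth_near ach (\<lambda>u. ?c (q (r *\<^sub>R w)) (\<lambda>i. chart_inv gch (u i))) (\<lambda>_. e\<^sub>0)"
      by (simp add: c_eq h_def k_def)
    then have "germ\<^sub>A (\<lambda>u. ?c (q (r *\<^sub>R w)) (\<lambda>i. chart_inv gch (u i))) (\<lambda>_. e\<^sub>0)"
      unfolding germ\<^sub>A_def by (simp add: c_eq chart_inv_e\<^sub>0 act_simps)
    then show loc: "?c (q (r *\<^sub>R w)) \<in> loc_cochains 1"
      unfolding loc_cochains_def depends_below_def by (auto simp: c_eq act_simps)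
    show "Dmap G A act 1 (?c (q (r *\<^sub>R w))) x = D r"
      unfolding Dmap_1[OF loc] D_def iter_deriv.simps
      by (rule dir_deriv_affine) (simp add: E_def h_def k_def c_eq)
  qed
  have multiple: "(\<Sum>i<N. ?c a) = ?c (q (real N *\<^sub>R v))" if "a = q v" for N a v
  proof (induction N)
    case 0 then show ?case by (simp add: q0 group_diff_0 act_0 fun_eq_iff)
  next
    case (Suc N)
    have "?c (q (real (Suc N) *\<^sub>R v)) = ?c (q (real N *\<^sub>R v)) + ?c a"
      using group_diff_add[of 0 "\<lambda>_. q (real N *\<^sub>R v)" "\<lambda>_. q v"]
      by (simp add: that scaleR_left_distrib q plus_fun_def add.commute)
    then show ?case using Suc by simp
  qed
  have D_mult: "Dmap G A act 1 (\<Sum>i<N. g) x = real N *\<^sub>R Dmap G A act 1 g x \<and> (\<Sum>i<N. g) \<in> loc_cochains 1"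
    if g: "g \<in> loc_cochains 1" for g and N :: nat
  proof (induction N)
    case 0
    have "Dmap G A act 1 0 x = 0" using Dmap_0[of 1] by simp
    then show ?case
      unfolding lessThan_0 sum.empty of_nat_0 scaleR_zero_left using loc_cochains_0 by blast
  next
    case (Suc N)
    then have a: "(\<Sum>i<N. g) \<in> loc_cochains 1" and b: "Dmap G A act 1 (\<Sum>i<N. g) x = real N *\<^sub>R Dmap G A act 1 g x"
      by blast+
    have "Dmap G A act 1 ((\<Sum>i<N. g) + g) x = real N *\<^sub>R Dmap G A act 1 g x + Dmap G A act 1 g x"
      unfolding Dmap_add[OF a g one] plus_fun_apply b ..
    also have "\<dots> = real (Suc N) *\<^sub>R Dmap G A act 1 g x" by (simp add: scaleR_left_distrib)
    finally show ?case unfolding sum.lessThan_Suc using loc_cochains_add[OF a g] by blast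
  qed
  have D0: "D 0 = 0"
  proof -
    have "has_dir_deriv E (e\<^sub>0, 0) (x 0, 0) 0"
      by (simp add: has_dir_deriv_def E_def zero)
    then show ?thesis by (simp add: D_def dir_derivI)
  qed
  have "has_dir_deriv (\<lambda>r. (e\<^sub>0, r)) 0 1 (0, 1::real)"
    by (rule has_dir_deriv_Pair[OF has_dir_deriv_const has_dir_deriv_id])
  from iter_deriv_chain_curve[OF V(4,1) _ this, of "[(x 0, 0)]"]
  have D': "has_dir_deriv D 0 1 (iter_deriv E [(0, 1), (x 0, 0)] (e\<^sub>0, 0))"
    using V(2) by (simp add: D_def[abs_def])
  \<comment> \<open>The element q w may be far from 0 in A. Its coboundary is reached as an N-fold
    sum of the coboundary of q(w/N), which is covered by the chart.\<close>
  have loc: "?c (q w) \<in> loc_cochains 1"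
    if N: "(e\<^sub>0, inverse (real N)) \<in> V" "N > 0" for N
    using D_mult[OF r_loc[OF N(1)], of N] multiple[of _ "inverse (real N) *\<^sub>R w" N] N(2) by simp
  have const: "Dmap G A act 1 (?c (q w)) x = D (inverse (real N)) /\<^sub>R inverse (real N)"
    if N: "(e\<^sub>0, inverse (real N)) \<in> V" "N > 0" for N
  proof -
    have "Dmap G A act 1 (?c (q w)) x = Dmap G A act 1 (\<Sum>i<N. ?c (q (inverse (real N) *\<^sub>R w))) x"
      using multiple[of _ "inverse (real N) *\<^sub>R w" N] N(2) by simp
    also have "\<dots> = real N *\<^sub>R D (inverse (real N))"
      using D_mult[OF r_loc[OF N(1)], of N] r_D[OF N(1)] by simp
    finally show ?thesis by simp
  qed
  \<comment> \<open>The quotient of D at the step 1/N is eventually constant, equal to the value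
    sought; its limit is the derivative of D at 0.\<close>
  have inv0: "filterlim (\<lambda>N. inverse (real N)) (at 0) sequentially"
    unfolding filterlim_at
    using eventually_gt_at_top[of "0::nat"] by (auto intro: lim_inverse_n elim: eventually_mono)
  have "((\<lambda>r. (e\<^sub>0, r)) \<longlongrightarrow> (e\<^sub>0, 0)) (at 0)"
    by (rule tendsto_Pair[OF tendsto_const tendsto_ident_at])
  from topological_tendstoD[OF filterlim_compose[OF this inv0] V(1,2)]
  have ev: "eventually (\<lambda>N. (e\<^sub>0, inverse (real N)) \<in> V) sequentially" .
  then have "eventually (\<lambda>N::nat. ?c (q w) \<in> loc_cochains 1) sequentially"
    using eventually_gt_at_top[of "0::nat"] by eventually_elim (rule loc)
  then show "?c (q w) \<in> loc_cochains 1" by (simp add: eventually_const)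
  from ev have "eventually (\<lambda>N. (D (0 + inverse (real N) *\<^sub>R 1) - D 0) /\<^sub>R inverse (real N) = Dmap G A act 1 (?c (q w)) x) sequentially"
    using eventually_gt_at_top[of "0::nat"] by eventually_elim (simp add: const[unfolded One_nat_def] D0)
  moreover have "(\<lambda>N. (D (0 + inverse (real N) *\<^sub>R 1) - D 0) /\<^sub>R inverse (real N)) \<longlonglongrightarrow> iter_deriv E [(0, 1), (x 0, 0)] (e\<^sub>0, 0)"
    by (rule filterlim_compose[OF D'[unfolded has_dir_deriv_def] inv0])
  ultimately have "(\<lambda>N::nat. Dmap G A act 1 (?c (q w)) x) \<longlonglongrightarrow> iter_deriv E [(0, 1), (x 0, 0)] (e\<^sub>0, 0)"
    by (simp add: tendsto_cong)
  then have val: "Dmap G A act 1 (?c (q w)) x = iter_deriv E [(0, 1), (x 0, 0)] (e\<^sub>0, 0)"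
    by (simp add: LIMSEQ_const_iff)
  also have "\<dots> = iter_deriv E [(x 0, 0), (0, 1)] (e\<^sub>0, 0)"
    by (rule iter_deriv_schwarz[OF V(4,1,2)])
  also have "\<dots> = lie_act G A act (x 0) ?Q"
  proof -
    obtain N where N: "smooth_on N chart_act" "open N" "(e\<^sub>0, b\<^sub>0) \<in> N" by (rule chart_act_smooth)
    from qg obtain J where J: "open J" "0 \<in> J" "\<And>u. u \<in> J \<Longrightarrow> q u \<in> fst ach" "smooth_on J (\<lambda>u. snd ach (q u))"
      by (rule germ\<^sub>AE) blast
    have dq: "has_dir_deriv (\<lambda>u. snd ach (q u)) 0 w ?Q"
      using smooth_on_deriv[OF J(4,2), of "[]" w] by simp
    have dq': "has_dir_deriv (\<lambda>r. snd ach (q (r *\<^sub>R w))) 0 (1::real) ?Q"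
      using dq unfolding has_dir_deriv_curve[of _ 0 w] by simp
    \<comment> \<open>The r-derivative of the summand - q(r w). It does not depend on the group
      coordinate u and disappears on differentiation in the direction of x.\<close>
    define \<kappa> where "\<kappa> = dir_deriv (\<lambda>r. snd ach (k (e\<^sub>0, r))) 0 (1::real)"
    let ?O = "snd gch ` fst gch"
    have O: "open ?O" "e\<^sub>0 \<in> ?O" using gch unfolding is_chart_def e\<^sub>0_def by blast+
    have eq: "iter_deriv E [(0, 1)] (u, 0) = iter_deriv chart_act [(0, ?Q)] (u, b\<^sub>0) + \<kappa>"
      if u: "(u, 0) \<in> U" "(u, b\<^sub>0) \<in> N" for u
    proof -
      have "iter_deriv (\<lambda>z. snd ach (k z)) [(0, 1)] (u, 0) = \<kappa>"
        unfolding \<kappa>_def iter_deriv.simps by (rule dir_deriv_affine) (simp add: k_def)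
      moreover have "iter_deriv (\<lambda>z. snd ach (h z)) [(0, 1)] (u, 0) = iter_deriv chart_act [(0, ?Q)] (u, b\<^sub>0)"
      proof -
        have y0: "(u, snd ach (q (0 *\<^sub>R w))) = (u, b\<^sub>0)" by (simp add: q0 b\<^sub>0_def)
        have "has_dir_deriv (\<lambda>r. (u, snd ach (q (r *\<^sub>R w)))) 0 (1::real) (0, ?Q)"
          by (rule has_dir_deriv_Pair[OF has_dir_deriv_const dq'])
        from iter_deriv_chain_curve[OF N(1,2) _ this, of "[]"]
        have d: "has_dir_deriv (\<lambda>r. chart_act (u, snd ach (q (r *\<^sub>R w)))) 0 (1::real) (iter_deriv chart_act [(0, ?Q)] (u, b\<^sub>0))"
          unfolding y0 using u(2) by simp
        have "eventually (\<lambda>r::real. 0 + r *\<^sub>R w \<in> J) (at 0)" by (rule eventually_line[OF J(1,2)])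
        then have ev: "eventually (\<lambda>r. snd ach (h (u, 0 + r *\<^sub>R 1)) = chart_act (u, snd ach (q ((0 + r *\<^sub>R 1) *\<^sub>R w)))) (at 0)"
          by eventually_elim (use J(3) in \<open>simp add: h_def chart_act_def chart_inv_chart[OF ach(1)]\<close>)
        have at0: "snd ach (h (u, 0)) = chart_act (u, snd ach (q (0 *\<^sub>R w)))"
          using J(2,3) by (simp add: h_def chart_act_def chart_inv_chart[OF ach(1)])
        have "has_dir_deriv (\<lambda>r. snd ach (h (u, r))) 0 (1::real) (iter_deriv chart_act [(0, ?Q)] (u, b\<^sub>0))"
          by (rule has_dir_deriv_cong[THEN iffD2, OF ev at0 d])
        then have "dir_deriv (\<lambda>r. snd ach (h (u, r))) 0 (1::real) = iter_deriv chart_act [(0, ?Q)] (u, b\<^sub>0)"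
          by (rule dir_derivI)
        moreover have "dir_deriv (\<lambda>z. snd ach (h z)) (u, 0) (0, 1) = dir_deriv (\<lambda>r. snd ach (h (u, r))) 0 (1::real)"
          by (rule dir_deriv_affine) simp
        ultimately show ?thesis by simp
      qed
      ultimately show ?thesis using U(5)[OF u(1) zero] by simp
    qed
    have "has_dir_deriv (\<lambda>t. (e\<^sub>0 + t *\<^sub>R x 0, b\<^sub>0)) 0 (1::real) (x 0, 0)"
      using has_dir_deriv_id[of e\<^sub>0 "x 0"] unfolding has_dir_deriv_curve[of _ e\<^sub>0]
      by (intro has_dir_deriv_Pair has_dir_deriv_const) simp
    from has_dir_deriv_add[OF iter_deriv_chain_curve[OF N(1,2) _ this, of "[(0, ?Q)]"] has_dir_deriv_const[of \<kappa>]]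
    have d: "has_dir_deriv (\<lambda>t. iter_deriv chart_act [(0, ?Q)] (e\<^sub>0 + t *\<^sub>R x 0, b\<^sub>0) + \<kappa>) 0 (1::real)
        (iter_deriv chart_act [(x 0, 0), (0, ?Q)] (e\<^sub>0, b\<^sub>0))"
      using N(3) by (simp del: iter_deriv.simps)
    have "eventually (\<lambda>t. (e\<^sub>0, 0) + t *\<^sub>R (x 0, 0) \<in> U) (at 0)" by (rule eventually_line[OF U(1,2)])
    moreover have "eventually (\<lambda>t. (e\<^sub>0, b\<^sub>0) + t *\<^sub>R (x 0, 0) \<in> N) (at 0)" by (rule eventually_line[OF N(2,3)])
    ultimately have ev: "eventually (\<lambda>t. iter_deriv E [(0, 1)] ((e\<^sub>0, 0) + (0 + t *\<^sub>R 1) *\<^sub>R (x 0, 0))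
        = iter_deriv chart_act [(0, ?Q)] (e\<^sub>0 + (0 + t *\<^sub>R 1) *\<^sub>R x 0, b\<^sub>0) + \<kappa>) (at 0)"
      by eventually_elim (simp add: eq del: iter_deriv.simps)
    have at0: "iter_deriv E [(0, 1)] ((e\<^sub>0, 0) + 0 *\<^sub>R (x 0, 0)) = iter_deriv chart_act [(0, ?Q)] (e\<^sub>0 + 0 *\<^sub>R x 0, b\<^sub>0) + \<kappa>"
      using eq[OF U(2) N(3)] by (simp del: iter_deriv.simps)
    have "has_dir_deriv (\<lambda>t. iter_deriv E [(0, 1)] ((e\<^sub>0, 0) + t *\<^sub>R (x 0, 0))) 0 (1::real)
        (iter_deriv chart_act [(x 0, 0), (0, ?Q)] (e\<^sub>0, b\<^sub>0))"
      by (rule has_dir_deriv_cong[THEN iffD2, OF ev at0 d])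
    then have "has_dir_deriv (iter_deriv E [(0, 1)]) (e\<^sub>0, 0) (x 0, 0) (iter_deriv chart_act [(x 0, 0), (0, ?Q)] (e\<^sub>0, b\<^sub>0))"
      unfolding has_dir_deriv_curve[of "iter_deriv E [(0, 1)]"] .
    then have "iter_deriv E [(x 0, 0), (0, 1)] (e\<^sub>0, 0) = iter_deriv chart_act [(x 0, 0), (0, ?Q)] (e\<^sub>0, b\<^sub>0)"
      using dir_derivI by (simp only: iter_deriv.simps)
    then show ?thesis unfolding lie_act_eq .
  qed
  also have "\<dots> = lie_diff G A act 0 (\<lambda>_. ?Q) x" by (simp add: lie_diff_def alt_sign_def)
  finally show "Dmap G A act 1 (?c (q w)) x = lie_diff G A act 0 (\<lambda>_. ?Q) x" .
qed

end

subsection \<open>Maps induced in cohomology\<close>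

lemma set_mult_additive:
  "X <#>\<^bsub>additive_group C\<^esub> Y = {x + y | x y. x \<in> X \<and> y \<in> Y}"
  by (auto simp: set_mult_def additive_group_def)

lemma r_coset_additive: "B #>\<^bsub>additive_group C\<^esub> x = {b + x | b. b \<in> B}"
  by (auto simp: r_coset_def additive_group_def)

text \<open>The set \<open>L\<close> stands in for the cochain group. It allows the coboundaries of
  group cochains to be treated inside \<open>loc_cochains\<close>, where \<delta> is known to be
  additive, without showing that they are smooth in all charts.\<close>

lemma induces_cohomology_homI:
  fixes \<delta> :: "'x::ab_group_add \<Rightarrow> 'y::ab_group_add"
  assumes Z: "cocycles C d n \<subseteq> L" and B: "coboundaries C d n \<subseteq> L" "0 \<in> coboundaries C d n"
    and L: "\<And>x y. x \<in> L \<Longrightarrow> y \<in> L \<Longrightarrow> x + y \<in> L" "\<And>x y. x \<in> L \<Longrightarrow> y \<in> L \<Longrightarrow> \<delta> (x + y) = \<delta> x + \<delta> y"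
    and \<delta>: "\<delta> ` cocycles C d n \<subseteq> cocycles C' d' n" "\<delta> ` coboundaries C d n \<subseteq> coboundaries C' d' n"
    and B': "0 \<in> coboundaries C' d' n"
      "\<And>x y. x \<in> coboundaries C' d' n \<Longrightarrow> y \<in> coboundaries C' d' n \<Longrightarrow> x + y \<in> coboundaries C' d' n"
  shows "induces_cohomology_hom C d C' d' n \<delta>"
proof -
  let ?B = "coboundaries C d n" and ?B' = "coboundaries C' d' n"
  let ?Z = "cocycles C d n" and ?Z' = "cocycles C' d' n"
  \<comment> \<open>The image of the coset saturated by the target coboundaries, so that no
    representative has to be chosen.\<close>
  define \<Psi> where "\<Psi> X = {b + \<delta> x | b x. b \<in> ?B' \<and> x \<in> X}" for X
  have carrier: "carrier (cohomology C d n) = cohomology_class C d n ` cocycles C d n"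
    for C :: "nat \<Rightarrow> 'w::ab_group_add set" and d
    unfolding cohomology_def FactGroup_def RCOSETS_def cohomology_class_def additive_group_def
    by (simp add: UNION_singleton_eq_range)
  have \<Psi>: "\<Psi> (cohomology_class C d n f) = cohomology_class C' d' n (\<delta> f)" if f: "f \<in> ?Z" for f
  proof
    show "\<Psi> (cohomology_class C d n f) \<subseteq> cohomology_class C' d' n (\<delta> f)"
    proof
      fix y assume "y \<in> \<Psi> (cohomology_class C d n f)"
      then obtain b b' where b: "b' \<in> ?B'" "b \<in> ?B" "y = b' + \<delta> (b + f)"
        unfolding \<Psi>_def cohomology_class_def r_coset_additive by blast
      have "b \<in> L" "f \<in> L" using B(1) Z b(2) f by blast+
      then have "y = (b' + \<delta> b) + \<delta> f" using b(3) by (simp add: L(2) add.assoc)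
      moreover have "b' + \<delta> b \<in> ?B'" using \<delta>(2) b by (intro B'(2)) blast+
      ultimately show "y \<in> cohomology_class C' d' n (\<delta> f)"
        unfolding cohomology_class_def r_coset_additive by blast
    qed
    have "f = 0 + f" by simp
    then have "f \<in> cohomology_class C d n f"
      unfolding cohomology_class_def r_coset_additive using B(2) by blast
    then show "cohomology_class C' d' n (\<delta> f) \<subseteq> \<Psi> (cohomology_class C d n f)"
      unfolding \<Psi>_def cohomology_class_def[of C'] r_coset_additive by blast
  qed
  have sub: "X \<subseteq> L" if "X \<in> carrier (cohomology C d n)" for X
  proof
    fix x assume "x \<in> X"
    with that obtain b f where "x = b + f" "b \<in> ?B" "f \<in> ?Z"
      unfolding carrier cohomology_class_def r_coset_additive by blast
    then show "x \<in> L" using Z B(1) L(1)[of b f] by blast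
  qed
  have "\<Psi> \<in> hom (cohomology C d n) (cohomology C' d' n)"
  proof (rule homI)
    show "\<Psi> X \<in> carrier (cohomology C' d' n)" if "X \<in> carrier (cohomology C d n)" for X
    proof -
      from that obtain f where f: "f \<in> ?Z" "X = cohomology_class C d n f" unfolding carrier by (rule imageE)
      have "\<delta> f \<in> ?Z'" using \<delta>(1) f(1) by blast
      then show ?thesis unfolding carrier f(2) \<Psi>[OF f(1)] by (rule imageI)
    qed
    fix X Y assume XY: "X \<in> carrier (cohomology C d n)" "Y \<in> carrier (cohomology C d n)"
    have "\<Psi> {x + y | x y. x \<in> X \<and> y \<in> Y} = {x + y | x y. x \<in> \<Psi> X \<and> y \<in> \<Psi> Y}"
    proof (intro equalityI subsetI)
      fix z assume "z \<in> \<Psi> {x + y | x y. x \<in> X \<and> y \<in> Y}"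
      then obtain b x y where z: "z = b + \<delta> (x + y)" "b \<in> ?B'" "x \<in> X" "y \<in> Y"
        unfolding \<Psi>_def by blast
      then have "z = (b + \<delta> x) + (0 + \<delta> y)"
        using sub[OF XY(1)] sub[OF XY(2)] L(2)[of x y] by (simp add: subset_iff add.assoc)
      then show "z \<in> {x + y | x y. x \<in> \<Psi> X \<and> y \<in> \<Psi> Y}"
        unfolding \<Psi>_def using z B'(1) by blast
    next
      fix z assume "z \<in> {x + y | x y. x \<in> \<Psi> X \<and> y \<in> \<Psi> Y}"
      then obtain b b' x y where z: "z = (b + \<delta> x) + (b' + \<delta> y)" "b \<in> ?B'" "b' \<in> ?B'" "x \<in> X" "y \<in> Y"
        unfolding \<Psi>_def by blast
      then have "z = (b + b') + \<delta> (x + y)"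
        using sub[OF XY(1)] sub[OF XY(2)] L(2)[of x y] by (simp add: subset_iff algebra_simps)
      then show "z \<in> \<Psi> {x + y | x y. x \<in> X \<and> y \<in> Y}"
        unfolding \<Psi>_def using z(4,5) B'(2)[OF z(2,3)] by blast
    qed
    then show "\<Psi> (X \<otimes>\<^bsub>cohomology C d n\<^esub> Y) = \<Psi> X \<otimes>\<^bsub>cohomology C' d' n\<^esub> \<Psi> Y"
      by (simp add: cohomology_def FactGroup_def set_mult_additive)
  qed
  then show ?thesis
    unfolding induces_cohomology_hom_def using \<delta>(1) \<Psi> by (intro conjI bexI[of _ \<Psi>] ballI)
qed

section \<open>Closure properties of the cochain groups\<close>

lemma const_in_group_cochains:
  fixes G :: "('g::{group_mult,t2_space}, 'e::locally_convex) manifold"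
    and A :: "('a::{ab_group_add,t2_space}, 'b::locally_convex) manifold"
  shows "n = 0 \<or> a = 0 \<Longrightarrow> (\<lambda>_. a) \<in> group_cochains G A n"
  unfolding group_cochains_def smooth_on_power_def
  by (auto simp: depends_below_def intro!: exI[of _ UNIV] smooth_on_subset[OF smooth_on_const[OF open_UNIV]])

lemma group_cochains_0E:
  assumes "f \<in> group_cochains G A 0"
  obtains a where "f = (\<lambda>_. a)"
proof
  show "f = (\<lambda>_. f (\<lambda>_. 1))"
    using assms unfolding group_cochains_def depends_below_def by auto
qed

lemma lie_cochains_0: "0 \<in> lie_cochains n"
  by (auto simp: lie_cochains_def depends_below_def linear_iff zero_fun_def)

lemma const_in_lie_cochains_0: "(\<lambda>_. w) \<in> lie_cochains 0"
  by (auto simp: lie_cochains_def depends_below_def)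

lemma lie_cochains_add:
  fixes \<omega> \<eta> :: "(nat \<Rightarrow> 'e::locally_convex) \<Rightarrow> 'b::locally_convex"
  assumes "\<omega> \<in> lie_cochains n" "\<eta> \<in> lie_cochains n"
  shows "\<omega> + \<eta> \<in> lie_cochains n"
proof -
  have dep: "depends_below n \<omega>" "depends_below n \<eta>"
    and lin: "\<forall>i<n. \<forall>x. linear (\<lambda>v. \<omega> (x(i := v)))" "\<forall>i<n. \<forall>x. linear (\<lambda>v. \<eta> (x(i := v)))"
    and alt: "\<forall>x. \<forall>i<n. \<forall>j<n. i \<noteq> j \<longrightarrow> x i = x j \<longrightarrow> \<omega> x = 0"
      "\<forall>x. \<forall>i<n. \<forall>j<n. i \<noteq> j \<longrightarrow> x i = x j \<longrightarrow> \<eta> x = 0"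
    and cont: "continuous_on UNIV \<omega>" "continuous_on UNIV \<eta>"
    using assms unfolding lie_cochains_def mem_Collect_eq by - (elim conjE, assumption)+
  have "\<omega> x + \<eta> x = \<omega> y + \<eta> y" if xy: "\<forall>i<n. x i = y i" for x y
    by (rule arg_cong2[where f = "(+)"]; rule dep[unfolded depends_below_def, THEN spec, THEN spec, THEN mp, OF xy])
  then have "depends_below n (\<omega> + \<eta>)" unfolding depends_below_def plus_fun_apply by simp
  moreover have "\<forall>i<n. \<forall>x. linear (\<lambda>v. (\<omega> + \<eta>) (x(i := v)))"
    unfolding plus_fun_apply using lin by (intro allI impI linear_compose_add) blast+
  moreover have "\<forall>x. \<forall>i<n. \<forall>j<n. i \<noteq> j \<longrightarrow> x i = x j \<longrightarrow> (\<omega> + \<eta>) x = 0"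
  proof (intro allI impI)
    fix x :: "nat \<Rightarrow> 'e" and i j assume "i < n" "j < n" "i \<noteq> j" "x i = x j"
    then have "\<omega> x = 0" "\<eta> x = 0" using alt by blast+
    then show "(\<omega> + \<eta>) x = 0" unfolding plus_fun_apply by simp
  qed
  moreover have "continuous_on UNIV (\<omega> + \<eta>)"
    unfolding continuous_on_def plus_fun_def
    by (intro ballI tendsto_add) (use cont in \<open>simp_all add: continuous_on_def\<close>)
  ultimately show ?thesis unfolding lie_cochains_def mem_Collect_eq by (intro conjI)
qed

section \<open>Descent of D_n to cohomology\<close>

context lie_module
begin

lemma lie_diff_add: "lie_diff G A act n (\<omega> + \<eta>) = lie_diff G A act n \<omega> + lie_diff G A act n \<eta>"
proof
  fix x
  have alt: "alt_sign k (a + b) = alt_sign k a + alt_sign k b" for k and a b :: 'b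
    by (simp add: alt_sign_def)
  show "lie_diff G A act n (\<omega> + \<eta>) x = (lie_diff G A act n \<omega> + lie_diff G A act n \<eta>) x"
    by (simp add: lie_diff_def linear_add[OF lie_act_linear] alt sum.distrib algebra_simps)
qed

lemma group_diff_zero: "group_diff act n 0 = 0"
  using group_diff_add[of n 0 0] by simp

lemma lie_coboundaries:
  "0 \<in> coboundaries lie_cochains (lie_diff G A act) n"
  "x \<in> coboundaries lie_cochains (lie_diff G A act) n \<Longrightarrow> y \<in> coboundaries lie_cochains (lie_diff G A act) n
    \<Longrightarrow> x + y \<in> coboundaries lie_cochains (lie_diff G A act) n"
proof -
  have "lie_diff G A act m 0 = 0" for m using lie_diff_add[of m 0 0] by simp
  then show "0 \<in> coboundaries lie_cochains (lie_diff G A act) n"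
    by (cases n) (auto simp: coboundaries_def intro!: image_eqI[OF _ lie_cochains_0])
  show "x + y \<in> coboundaries lie_cochains (lie_diff G A act) n"
    if "x \<in> coboundaries lie_cochains (lie_diff G A act) n" "y \<in> coboundaries lie_cochains (lie_diff G A act) n"
    using that
    by (cases n) (auto simp: coboundaries_def lie_diff_add[symmetric] intro!: imageI lie_cochains_add)
qed

lemma zero_in_coboundaries: "0 \<in> coboundaries (group_cochains G A) (group_diff act) n"
proof (cases n)
  case (Suc m)
  have "0 \<in> group_cochains G A m" using const_in_group_cochains[of m "0::'a" G A] by (simp add: zero_fun_def)
  then have "group_diff act m 0 \<in> group_diff act m ` group_cochains G A m" by (rule imageI)
  then show ?thesis using Suc by (simp add: coboundaries_def group_diff_zero)
qed (simp add: coboundaries_def)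

lemma Dmap_cocycles:
  assumes "n > 0"
  shows "Dmap G A act n ` cocycles (group_cochains G A) (group_diff act) n
    \<subseteq> cocycles lie_cochains (lie_diff G A act) n"
proof
  fix \<omega> assume "\<omega> \<in> Dmap G A act n ` cocycles (group_cochains G A) (group_diff act) n"
  then obtain f where f: "f \<in> loc_cochains n" "group_diff act n f = 0" "\<omega> = Dmap G A act n f"
    unfolding cocycles_def using group_cochains_subset[OF assms] by blast
  have "lie_diff G A act n \<omega> = 0"
    using Dmap_group_diff[OF f(1) assms] f(2,3) Dmap_0[of "Suc n"] by simp
  then show "\<omega> \<in> cocycles lie_cochains (lie_diff G A act) n"
    unfolding cocycles_def using Dmap_in_lie_cochains[OF f(1) assms] f(3) by blast
qed

lemma Dmap_induces:
  assumes n: "n > 0"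
    and B: "coboundaries (group_cochains G A) (group_diff act) n \<subseteq> loc_cochains n"
    and \<delta>: "Dmap G A act n ` coboundaries (group_cochains G A) (group_diff act) n
      \<subseteq> coboundaries lie_cochains (lie_diff G A act) n"
  shows "induces_cohomology_hom (group_cochains G A) (group_diff act) lie_cochains (lie_diff G A act) n (Dmap G A act n)"
proof (rule induces_cohomology_homI[where L = "loc_cochains n"])
  show "cocycles (group_cochains G A) (group_diff act) n \<subseteq> loc_cochains n"
    unfolding cocycles_def using group_cochains_subset[OF n] by blast
qed (fact B zero_in_coboundaries Dmap_cocycles[OF n] \<delta> lie_coboundaries | rule loc_cochains_add Dmap_add[OF _ _ n], assumption+)+

lemma Dmap_cochain_morphism:
  "cochain_morphism 1 (group_cochains G A) (group_diff act) lie_cochains (lie_diff G A act) (Dmap G A act)"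
proof -
  have "Dmap G A act n \<in> hom (additive_group (group_cochains G A n)) (additive_group (lie_cochains n))" if n: "n > 0" for n
    unfolding additive_group_def
    by (rule homI) (use group_cochains_subset[OF n] Dmap_in_lie_cochains[OF _ n] Dmap_add[OF _ _ n] in \<open>auto simp: subset_iff\<close>)
  moreover have "Dmap G A act (Suc n) (group_diff act n f) = lie_diff G A act n (Dmap G A act n f)"
    if "n > 0" "f \<in> group_cochains G A n" for n f
    using that group_cochains_subset by (intro Dmap_group_diff) blast+
  ultimately show ?thesis unfolding cochain_morphism_def by auto
qed

lemma Dmap_induces_ge_2:
  assumes n: "n \<ge> 2"
  shows "induces_cohomology_hom (group_cochains G A) (group_diff act) lie_cochains (lie_diff G A act) n (Dmap G A act n)"
proof -
  obtain m where m: "n = Suc m" "m > 0" using n by (cases n) auto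
  have B: "coboundaries (group_cochains G A) (group_diff act) n = group_diff act m ` group_cochains G A m"
    "coboundaries lie_cochains (lie_diff G A act) n = lie_diff G A act m ` lie_cochains m"
    unfolding coboundaries_def m(1) by simp_all
  have loc: "f \<in> loc_cochains m" if "f \<in> group_cochains G A m" for f
    using that group_cochains_subset[OF m(2)] by blast
  show ?thesis
  proof (rule Dmap_induces)
    show "n > 0" using m(1) by simp
    show "coboundaries (group_cochains G A) (group_diff act) n \<subseteq> loc_cochains n"
      unfolding B using loc_cochains_group_diff[OF loc m(2)] m(1) by blast
    show "Dmap G A act n ` coboundaries (group_cochains G A) (group_diff act) n
      \<subseteq> coboundaries lie_cochains (lie_diff G A act) n"
      unfolding B using Dmap_group_diff[OF loc m(2)] Dmap_in_lie_cochains[OF loc m(2)] m(1) by auto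
  qed
qed

text \<open>Surjectivity writes every 0-cochain as a constant q w. The choice of w need not be
  unique, so no map in degree 0 is claimed, but any choice exhibits the image of the coboundary as a
  coboundary.\<close>

lemma Dmap_induces_1:
  fixes q :: "'b \<Rightarrow> 'a"
  assumes q: "\<And>u v. q (u + v) = q u + q v" "smooth_near ach q 0" "surj q"
  shows "induces_cohomology_hom (group_cochains G A) (group_diff act) lie_cochains (lie_diff G A act) 1 (Dmap G A act 1)"
proof (rule Dmap_induces)
  show "(0::nat) < 1" by simp
  have B: "coboundaries C d 1 = d 0 ` C 0" for C :: "nat \<Rightarrow> 'x::{plus,zero} set" and d
    unfolding coboundaries_def by simp
  have f: "\<exists>w. f = (\<lambda>_. q w)" if "f \<in> group_cochains G A 0" for f
    using that q(3) by (elim group_cochains_0E) (auto simp: surj_def)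
  show "coboundaries (group_cochains G A) (group_diff act) 1 \<subseteq> loc_cochains 1"
    unfolding B using f Dmap_coboundary_0(1)[OF q(1,2)] by fastforce
  show "Dmap G A act 1 ` coboundaries (group_cochains G A) (group_diff act) 1
      \<subseteq> coboundaries lie_cochains (lie_diff G A act) 1"
  proof
    fix \<omega> assume "\<omega> \<in> Dmap G A act 1 ` coboundaries (group_cochains G A) (group_diff act) 1"
    then obtain f where "f \<in> group_cochains G A 0" "\<omega> = Dmap G A act 1 (group_diff act 0 f)"
      unfolding B by blast
    then obtain w where "\<omega> = Dmap G A act 1 (group_diff act 0 (\<lambda>_. q w))" using f by blast
    then have "\<omega> = lie_diff G A act 0 (\<lambda>_. dir_deriv (\<lambda>u. snd ach (q u)) 0 w)"
      using Dmap_coboundary_0(2)[OF q(1,2)] by (simp add: fun_eq_iff)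
    then show "\<omega> \<in> coboundaries lie_cochains (lie_diff G A act) 1"
      unfolding B using const_in_lie_cochains_0 by blast
  qed
qed

text \<open>q is the projection onto the quotient followed by the isomorphism to A. Being a
  homomorphism it sends 0 to 0, so its smoothness near 0 can be expressed in the chart of A at
  0.\<close>

lemma iso_to_discrete_quotientE:
  assumes "iso_to_discrete_quotient A \<Gamma>"
  obtains q :: "'b \<Rightarrow> 'a" where "\<forall>u v. q (u + v) = q u + q v" "smooth_near ach q 0" "surj q"
proof -
  let ?V = "additive_group UNIV :: 'b monoid"
  interpret V: comm_group ?V
  proof (rule comm_groupI)
    fix x :: 'b
    show "\<exists>y\<in>carrier ?V. y \<otimes>\<^bsub>?V\<^esub> x = \<one>\<^bsub>?V\<^esub>"
      by (rule bexI[of _ "- x"]) (simp_all add: additive_group_def)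
  qed (simp_all add: additive_group_def ac_simps)
  obtain F where \<Gamma>: "subgroup \<Gamma> ?V" and F: "F \<in> iso (?V Mod \<Gamma>) (additive_group UNIV)"
    and s: "smooth_map vector_manifold A UNIV (\<lambda>v. F (\<Gamma> #>\<^bsub>?V\<^esub> v))"
    using assms unfolding iso_to_discrete_quotient_def by blast
  define q where "q v = F (\<Gamma> #>\<^bsub>?V\<^esub> v)" for v
  have cos: "carrier (?V Mod \<Gamma>) = range (\<lambda>v. \<Gamma> #>\<^bsub>?V\<^esub> v)"
    by (auto simp: FactGroup_def RCOSETS_def additive_group_def)
  have q: "q (u + v) = q u + q v" for u v
  proof -
    have "\<Gamma> #>\<^bsub>?V\<^esub> (u + v) = (\<Gamma> #>\<^bsub>?V\<^esub> u) \<otimes>\<^bsub>?V Mod \<Gamma>\<^esub> (\<Gamma> #>\<^bsub>?V\<^esub> v)"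
      using normal.rcos_sum[OF V.subgroup_imp_normal[OF \<Gamma>], of u v]
      by (simp add: FactGroup_def additive_group_def)
    moreover have "F (X \<otimes>\<^bsub>?V Mod \<Gamma>\<^esub> Y) = F X + F Y" if "X \<in> carrier (?V Mod \<Gamma>)" "Y \<in> carrier (?V Mod \<Gamma>)" for X Y
      using F that unfolding iso_def hom_def by (simp add: additive_group_def)
    ultimately show ?thesis unfolding q_def cos by simp
  qed
  have "q 0 = 0" using q[of 0 0] by simp
  then have "smooth_near ach q 0"
    using smooth_map_near[OF s open_UNIV is_chart_vector _ ach(1,2), of 0] ach(3) by (simp add: q_def[abs_def])
  moreover have "surj q"
    using F unfolding iso_def bij_betw_def cos q_def[abs_def] image_image by (simp add: additive_group_def)
  ultimately show ?thesis using that q by blast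
qed

end

section \<open>Coefficients in a locally convex space\<close>

locale lie_vector_module =
  lie_module G "vector_manifold :: ('v::locally_convex, 'v) manifold" act
  for G :: "('g::{group_mult,t2_space}, 'e::locally_convex) manifold" and act :: "'g \<Rightarrow> 'v::locally_convex \<Rightarrow> 'v"
begin

abbreviation VM :: "('v, 'v) manifold" where "VM \<equiv> vector_manifold"

lemma smooth_near_id: "smooth_near (chart_at VM 0) id 0"
  unfolding smooth_near_def using smooth_on_id[OF open_UNIV] by (intro exI[of _ UNIV]) simp

text \<open>For n = 0 there are no curves to choose, and the identity is the only permutation of the
  empty set.\<close>

lemma Dmap_degree_0: "Dmap G VM act 0 (\<lambda>_. w) = (\<lambda>_. w)"
  by (rule ext) (simp add: Dmap_def tau_def mixed_deriv_def Phi_def act_simps sign_id)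

text \<open>The case q = id of the coboundary formula; its derivative at 0 sends w to w, in
  accordance with \<open>Dmap_degree_0\<close>.\<close>

lemma Dmap_coboundary_vector:
  "Dmap G VM act 1 (group_diff act 0 (\<lambda>_. w)) = lie_diff G VM act 0 (\<lambda>_. w)"
proof -
  have "has_dir_deriv (\<lambda>u::'v. u) 0 w w"
    by (rule has_dir_deriv_id)
  then have "dir_deriv (\<lambda>u::'v. u) 0 w = w" by (rule dir_derivI)
  then show ?thesis
    using Dmap_coboundary_0(2)[OF _ smooth_near_id, of w] by (simp add: fun_eq_iff)
qed

lemma Dmap_vector_cochain_morphism:
  "cochain_morphism 0 (group_cochains G VM) (group_diff act) lie_cochains (lie_diff G VM act) (Dmap G VM act)"
proof -
  have "Dmap G VM act 0 \<in> hom (additive_group (group_cochains G VM 0)) (additive_group (lie_cochains 0))"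
  proof (rule homI)
    fix f assume "f \<in> carrier (additive_group (group_cochains G VM 0))"
    then obtain w where "f = (\<lambda>_. w)" by (auto simp: additive_group_def elim: group_cochains_0E)
    then show "Dmap G VM act 0 f \<in> carrier (additive_group (lie_cochains 0))"
      by (simp add: additive_group_def Dmap_degree_0 const_in_lie_cochains_0)
    fix g assume "g \<in> carrier (additive_group (group_cochains G VM 0))"
    then obtain v where "g = (\<lambda>_. v)" by (auto simp: additive_group_def elim: group_cochains_0E)
    then show "Dmap G VM act 0 (f \<otimes>\<^bsub>additive_group (group_cochains G VM 0)\<^esub> g)
        = Dmap G VM act 0 f \<otimes>\<^bsub>additive_group (lie_cochains 0)\<^esub> Dmap G VM act 0 g"
      using \<open>f = (\<lambda>_. w)\<close> by (simp add: additive_group_def plus_fun_def Dmap_degree_0)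
  qed
  moreover have "Dmap G VM act (Suc 0) (group_diff act 0 f) = lie_diff G VM act 0 (Dmap G VM act 0 f)"
    if "f \<in> group_cochains G VM 0" for f
    using that by (elim group_cochains_0E) (simp add: Dmap_degree_0 Dmap_coboundary_vector[unfolded One_nat_def])
  ultimately show ?thesis
    using Dmap_cochain_morphism unfolding cochain_morphism_def by (metis One_nat_def Suc_leI gr0I)
qed

lemma Dmap_vector_induces:
  "induces_cohomology_hom (group_cochains G VM) (group_diff act) lie_cochains (lie_diff G VM act) n (Dmap G VM act n)"
proof -
  consider "n = 0" | "n = 1" | "n \<ge> 2" by linarith
  then show ?thesis
  proof cases
    case 1
    \<comment> \<open>In degree 0 the set L consists of all constants; \<open>loc_cochains 0\<close>
      would be too small, since a germ in it has the value 0 at the base point.\<close>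
    have Z: "cocycles (group_cochains G VM) (group_diff act) 0 \<subseteq> range (\<lambda>w _. w)"
      unfolding cocycles_def by (auto elim: group_cochains_0E)
    show ?thesis unfolding 1
    proof (rule induces_cohomology_homI[where L = "range (\<lambda>w _. w)"])
      show "Dmap G VM act 0 ` cocycles (group_cochains G VM) (group_diff act) 0
        \<subseteq> cocycles lie_cochains (lie_diff G VM act) 0"
      proof
        fix \<omega> assume "\<omega> \<in> Dmap G VM act 0 ` cocycles (group_cochains G VM) (group_diff act) 0"
        then obtain w where w: "group_diff act 0 (\<lambda>_. w) = 0" "\<omega> = (\<lambda>_. w)"
          unfolding cocycles_def by (auto elim!: group_cochains_0E simp: Dmap_degree_0)
        then have "lie_diff G VM act 0 \<omega> = 0" using Dmap_coboundary_vector[of w] Dmap_0[of 1] by simp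
        then show "\<omega> \<in> cocycles lie_cochains (lie_diff G VM act) 0"
          unfolding cocycles_def w(2) using const_in_lie_cochains_0 by blast
      qed
    qed (use Z in \<open>auto simp: coboundaries_def plus_fun_def Dmap_degree_0 zero_fun_def\<close>)
  next
    case 2
    show ?thesis unfolding 2 by (rule Dmap_induces_1[OF _ smooth_near_id]) simp_all
  next
    case 3
    then show ?thesis by (rule Dmap_induces_ge_2)
  qed
qed

end

theorem theoremB6:
  fixes G :: "('g::{group_mult,t2_space}, 'e::locally_convex) manifold"
    and A :: "('a::{ab_group_add,t2_space}, 'b::locally_convex) manifold"
    and act :: "'g \<Rightarrow> 'a \<Rightarrow> 'a"
    and act\<^sub>V :: "'g \<Rightarrow> 'v \<Rightarrow> 'v::locally_convex"
  assumes "lie_group G"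
  shows
    "(smooth_module G A act \<longrightarrow>
       cochain_morphism 1 (group_cochains G A) (group_diff act)
         lie_cochains (lie_diff G A act) (Dmap G A act) \<and>
       (\<forall>n\<ge>2. induces_cohomology_hom (group_cochains G A) (group_diff act)
         lie_cochains (lie_diff G A act) n (Dmap G A act n)) \<and>
       ((\<exists>\<Gamma>. iso_to_discrete_quotient A \<Gamma>) \<longrightarrow>
         induces_cohomology_hom (group_cochains G A) (group_diff act)
           lie_cochains (lie_diff G A act) 1 (Dmap G A act 1) \<and>
         (\<forall>f\<in>cocycles (group_cochains G A) (group_diff act) 1.
            Dmap G A act 1 f = (\<lambda>x. tangent_map G A (\<lambda>g. f (\<lambda>_. g)) 1 (x 0)))))
     \<and>
     (smooth_module G (vector_manifold :: ('v, 'v) manifold) act\<^sub>V \<longrightarrow>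
       cochain_morphism 0 (group_cochains G vector_manifold) (group_diff act\<^sub>V)
         lie_cochains (lie_diff G vector_manifold act\<^sub>V) (Dmap G vector_manifold act\<^sub>V) \<and>
       (\<forall>n. induces_cohomology_hom (group_cochains G vector_manifold) (group_diff act\<^sub>V)
         lie_cochains (lie_diff G vector_manifold act\<^sub>V) n (Dmap G vector_manifold act\<^sub>V n)))"
proof (intro conjI impI allI ballI)
  assume "smooth_module G A act"
  then interpret lie_module G A act using assms by unfold_locales
  show "cochain_morphism 1 (group_cochains G A) (group_diff act)
         lie_cochains (lie_diff G A act) (Dmap G A act)"
    by (rule Dmap_cochain_morphism)
  show "induces_cohomology_hom (group_cochains G A) (group_diff act)
         lie_cochains (lie_diff G A act) n (Dmap G A act n)" if "n \<ge> 2" for n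
    using that by (rule Dmap_induces_ge_2)
  assume "\<exists>\<Gamma>. iso_to_discrete_quotient A \<Gamma>"
  then obtain \<Gamma> where "iso_to_discrete_quotient A \<Gamma>" ..
  then obtain q :: "'b \<Rightarrow> 'a" where q: "\<forall>u v. q (u + v) = q u + q v" "smooth_near ach q 0" "surj q"
    by (rule iso_to_discrete_quotientE)
  show "induces_cohomology_hom (group_cochains G A) (group_diff act)
           lie_cochains (lie_diff G A act) 1 (Dmap G A act 1)"
    by (rule Dmap_induces_1[OF q(1)[rule_format] q(2,3)])
  fix f assume "f \<in> cocycles (group_cochains G A) (group_diff act) 1"
  then have "f \<in> loc_cochains 1" unfolding cocycles_def using group_cochains_subset[of 1] by auto
  then show "Dmap G A act 1 f = (\<lambda>x. tangent_map G A (\<lambda>g. f (\<lambda>_. g)) 1 (x 0))"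
    by (rule Dmap_1_tangent_map)
next
  assume "smooth_module G (vector_manifold :: ('v, 'v) manifold) act\<^sub>V"
  then interpret lie_vector_module G act\<^sub>V using assms by unfold_locales
  show "cochain_morphism 0 (group_cochains G vector_manifold) (group_diff act\<^sub>V)
         lie_cochains (lie_diff G vector_manifold act\<^sub>V) (Dmap G vector_manifold act\<^sub>V)"
    by (rule Dmap_vector_cochain_morphism)
  show "induces_cohomology_hom (group_cochains G vector_manifold) (group_diff act\<^sub>V)
         lie_cochains (lie_diff G vector_manifold act\<^sub>V) n (Dmap G vector_manifold act\<^sub>V n)" for n
    by (rule Dmap_vector_induces)
qed

end
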